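(* Let $\hat t_{m,\perp}$ be the Projected Stochastic Lanczos Quadrature (P-SLQ) estimator with $N$ independent probe vectors and $l$ quadrature nodes per probe ($l\ll d-m$), also written $\hat t_{m,\perp}^{(N,l)}$ to display $N$ and $l$. Define the target scalar $$t_{m,\perp}=\mathrm{tr}\bigl((P_m^\perp AP_m^\perp)^{+}\bigr)=\mathrm{tr}(A_{m,\perp}^{+})=\mathrm{tr}(T_{m,\perp}^{-1}).$$ Then: (i) (Bias) $$\bigl|\mathbb{E}[\hat t_{m,\perp}]-t_{m,\perp}\bigr|\le C_{\rho_\perp}\rho_\perp^{-2l}\,\mathrm{tr}(P_m^\perp)=C_{\rho_\perp}\rho_\perp^{-2l}(d-m),$$ where $C_{\rho_\perp}>0$ and $\rho_\perp=\frac{\sqrt{\kappa^\perp(m)}+1}{\sqrt{\kappa^\perp(m)}-1}>1$ are the constants of the Gauss–Lanczos quadrature error bound recalled in the context (depending only on the spectrum of $T_{m,\perp}$). In particular the bias decays exponentially in $l$. (ii) (Variance) $$\mathrm{Var}[\hat t_{m,\perp}]\le\frac1N\Bigl(\sqrt2\,\|A_{m,\perp}^{+}\|_F+C_{\rho_\perp}\rho_\perp^{-2l}(d-m+1)\Bigr)^2\le\frac{2(d-m)\lambda_d^{-2}}{N}(1+r_l)^2,$$ where $r_l=\dfrac{C_{\rho_\perp}\rho_\perp^{-2l}(d-m+1)}{\sqrt2\,\|A_{m,\perp}^{+}\|_F}\to0$ when $l\to\infty$. In particular $\mathrm{Var}[\hat t_{m,\perp}]=O(N^{-1})$ for every fixed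 $l$, and the pure Monte Carlo bound $\frac{2\|A_{m,\perp}^{+}\|_F^2}{N}$ is recovered in the limit $l\to\infty$. (iii) (Almost sure convergence) For every fixed $l$, $\hat t_{m,\perp}\to\mathbb{E}[S_1]$ almost surely as $N\to\infty$, with $|\mathbb{E}[S_1]-t_{m,\perp}|\le C_{\rho_\perp}\rho_\perp^{-2l}(d-m)$ by (i). When $l_N\to\infty$, one has $\hat t_{m,\perp}^{(N,l_N)}\to t_{m,\perp}$ almost surely as $N\to\infty$.
   Context: $A\in\mathbb{R}^{d\times d}$ is symmetric positive definite with eigenvalues $\lambda_1\ge\cdots\ge\lambda_d>0$, and $1\le m<d$. $Q_m\in\mathbb{R}^{d\times m}$ is the matrix with orthonormal columns produced by $m$ Lanczos steps on $A$ from a fixed reference vector (built once, before the probes are drawn). $P_m^\perp=I_d-Q_mQ_m^{\top}$. $Q_{m,\perp}\in\mathbb{R}^{d\times(d-m)}$ is an orthonormal basis of the orthogonal complement of $\mathrm{range}(Q_m)$. $T_{m,\perp}=Q_{m,\perp}^{\top}AQ_{m,\perp}$ has eigenvalues $\mu_1\ge\cdots\ge\mu_{d-m}>0$, and $\kappa^\perp(m)=\mu_1/\mu_{d-m}$ is the complement condition number. $A_{m,\perp}=P_m^\perp AP_m^\perp$, with Moore–Penrose pseudoinverse $A_{m,\perp}^{+}=Q_{m,\perp}T_{m,\perp}^{-1}Q_{m,\perp}^{\top}$. $\|\cdot\|_F$ is the Frobenius norm and $e_1$ is the first coordinate vector. Re-projected Lanczos iteration: from a unit vector $v_1\in\mathrm{range}(P_m^\perp)$,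 set $w_j=Av_j-\alpha_jv_j-\beta_{j-1}v_{j-1}$ with $\alpha_j=v_j^{\top}Av_j$ (and $\beta_0v_0=0$), $\beta_j=\|P_m^\perp w_j\|_2$ and $v_{j+1}=P_m^\perp w_j/\|P_m^\perp w_j\|_2$. This is equivalent to the Lanczos process applied to $A_{m,\perp}$. After $l$ steps it yields the $l\times l$ symmetric tridiagonal matrix with diagonal $\alpha_1,\dots,\alpha_l$ and off-diagonal $\beta_1,\dots,\beta_{l-1}$. P-SLQ estimator: draw i.i.d. probes $\xi_1,\dots,\xi_N\sim\mathcal{N}(0,I_d)$, set $u_i=P_m^\perp\xi_i$, run $l$ steps of the re-projected Lanczos iteration from $u_i/\|u_i\|_2$ to obtain the tridiagonal matrix $\Theta_l^{(i)}$, and set $$S_i=\|u_i\|_2^2\;e_1^{\top}\bigl(\Theta_l^{(i)}\bigr)^{-1}e_1,\qquad \hat t_{m,\perp}=\frac1N\sum_{i=1}^N S_i .$$ Gauss–Lanczos quadrature error bound (defining the constants): if $\Theta_l$ is the tridiagonal matrix produced by $l$ ($l\ll d-m$) steps of the re-projected Lanczos iteration started from $\hat u\in\mathrm{range}(P_m^\perp)$ with $\|\hat u\|_2=1$, then $$\bigl|\hat u^{\top}A_{m,\perp}^{+}\hat u-e_1^{\top}\Theta_l^{-1}e_1\bigr|\le C_{\rho_\perp}\rho_\perp^{-2l},$$ where $\rho_\perp=\frac{\sqrt{\kappa^\perp(m)}+1}{\sqrt{\kappa^\perp(m)}-1}>1$ and $C_{\rho_\perp}>0$ depends only on the spectrum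 of $T_{m,\perp}$. *)

theory Defs
  imports
    "HOL-Probability.Probability"
    "Jordan_Normal_Form.Char_Poly"
    "Jordan_Normal_Form.Gauss_Jordan_Elimination"
begin

unbundle no vec_syntax and no inner_syntax
hide_type (open) Finite_Cartesian_Product.vec

definition vnorm :: "real vec \<Rightarrow> real" where
  "vnorm v = sqrt (v \<bullet> v)"

definition mat_trace :: "real mat \<Rightarrow> real" where
  "mat_trace A = (\<Sum>i<dim_row A. A $$ (i, i))"

definition frobenius_norm :: "real mat \<Rightarrow> real" where
  "frobenius_norm A = sqrt (\<Sum>i<dim_row A. \<Sum>j<dim_col A. (A $$ (i, j))\<^sup>2)"

definition sym_pos_def :: "nat \<Rightarrow> real mat \<Rightarrow> bool" where
  "sym_pos_def n A \<longleftrightarrow> A \<in> carrier_mat n n \<and> A\<^sup>T = A \<and>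
     (\<forall>x\<in>carrier_vec n. x \<noteq> 0\<^sub>v n \<longrightarrow> 0 < x \<bullet> (A *\<^sub>v x))"

text \<open>Non-increasing, with algebraic multiplicity; complete for symmetric matrices.\<close>
definition eigs :: "real mat \<Rightarrow> real list" where
  "eigs A = rev (sorted_list_of_multiset (proots (char_poly A)))"

abbreviation minv :: "real mat \<Rightarrow> real mat" where
  "minv A \<equiv> the (mat_inverse A)"

definition is_moore_penrose :: "real mat \<Rightarrow> real mat \<Rightarrow> bool" where
  "is_moore_penrose A X \<longleftrightarrow> X \<in> carrier_mat (dim_col A) (dim_row A) \<and>
     A * X * A = A \<and> X * A * X = X \<and> (A * X)\<^sup>T = A * X \<and> (X * A)\<^sup>T = X * A"

definition pinv :: "real mat \<Rightarrow> real mat" where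
  "pinv A = (THE X. is_moore_penrose A X)"

text \<open>
  \<^term>\<open>lanczos_vec A P v j\<close> is $v_j$ and \<^term>\<open>lanczos_res A P v j\<close> is $P w_j$, started from
  $v_1 = v$, with $v_0 = 0$ and $\beta_0 = 0$. The ordinary Lanczos process is the case
  where \<^term>\<open>P\<close> is the identity matrix.
\<close>
fun lanczos_vec :: "real mat \<Rightarrow> real mat \<Rightarrow> real vec \<Rightarrow> nat \<Rightarrow> real vec"
  and lanczos_res :: "real mat \<Rightarrow> real mat \<Rightarrow> real vec \<Rightarrow> nat \<Rightarrow> real vec" where
  "lanczos_vec A P v 0 = 0\<^sub>v (dim_row A)"
| "lanczos_vec A P v (Suc 0) = v"
| "lanczos_vec A P v (Suc (Suc j)) =
     (1 / vnorm (lanczos_res A P v (Suc j))) \<cdot>\<^sub>v lanczos_res A P v (Suc j)"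
| "lanczos_res A P v 0 = 0\<^sub>v (dim_row A)"
| "lanczos_res A P v (Suc j) =
     P *\<^sub>v (A *\<^sub>v lanczos_vec A P v (Suc j)
           - (lanczos_vec A P v (Suc j) \<bullet> (A *\<^sub>v lanczos_vec A P v (Suc j)))
               \<cdot>\<^sub>v lanczos_vec A P v (Suc j)
           - vnorm (lanczos_res A P v j) \<cdot>\<^sub>v lanczos_vec A P v j)"

definition lanczos_alpha :: "real mat \<Rightarrow> real mat \<Rightarrow> real vec \<Rightarrow> nat \<Rightarrow> real" where
  "lanczos_alpha A P v j = lanczos_vec A P v j \<bullet> (A *\<^sub>v lanczos_vec A P v j)"

definition lanczos_beta :: "real mat \<Rightarrow> real mat \<Rightarrow> real vec \<Rightarrow> nat \<Rightarrow> real" where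
  "lanczos_beta A P v j = vnorm (lanczos_res A P v j)"

text \<open>
  The iteration stops at the first \<^term>\<open>j\<close> with $\beta_j = 0$, since $v_{j+1}$ is then undefined;
  so at most \<^term>\<open>l\<close> steps are carried out. Without breakdown the number of steps is \<^term>\<open>l\<close>.
\<close>
definition lanczos_steps :: "real mat \<Rightarrow> real mat \<Rightarrow> real vec \<Rightarrow> nat \<Rightarrow> nat" where
  "lanczos_steps A P v l = (LEAST j. j = l \<or> (1 \<le> j \<and> lanczos_beta A P v j = 0))"

definition lanczos_tridiag :: "real mat \<Rightarrow> real mat \<Rightarrow> real vec \<Rightarrow> nat \<Rightarrow> real mat" where
  "lanczos_tridiag A P v l = (let k = lanczos_steps A P v l in
     mat k k (\<lambda>(i, j).
       if i = j then lanczos_alpha A P v (Suc i)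
       else if j = Suc i then lanczos_beta A P v j
       else if i = Suc j then lanczos_beta A P v i
       else 0))"

definition lanczos_quad :: "real mat \<Rightarrow> real mat \<Rightarrow> real vec \<Rightarrow> nat \<Rightarrow> real" where
  "lanczos_quad A P v l = (let \<Theta> = lanczos_tridiag A P v l; e\<^sub>1 = unit_vec (dim_row \<Theta>) 0 in
     e\<^sub>1 \<bullet> (minv \<Theta> *\<^sub>v e\<^sub>1))"

definition lanczos_basis :: "real mat \<Rightarrow> real vec \<Rightarrow> nat \<Rightarrow> real mat" where
  "lanczos_basis A b m = mat_of_cols (dim_row A)
     (map (lanczos_vec A (1\<^sub>m (dim_row A)) ((1 / vnorm b) \<cdot>\<^sub>v b)) [1..<Suc m])"

definition perp_proj :: "real mat \<Rightarrow> real mat" where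
  "perp_proj Q = 1\<^sub>m (dim_row Q) - Q * Q\<^sup>T"

text \<open>
  The orthonormality of the columns of \<^term>\<open>Q\<close> says that the $m$ steps from the reference
  vector \<^term>\<open>b\<close> run without breakdown. \<^term>\<open>Qp\<close> is an arbitrary orthonormal basis of the
  complement.
\<close>
definition lanczos_deflation ::
    "nat \<Rightarrow> nat \<Rightarrow> real mat \<Rightarrow> real vec \<Rightarrow> real mat \<Rightarrow> real mat \<Rightarrow> bool" where
  "lanczos_deflation d m A b Q Qp \<longleftrightarrow>
     sym_pos_def d A \<and> 1 \<le> m \<and> m < d \<and> b \<in> carrier_vec d \<and>
     Q = lanczos_basis A b m \<and> Q\<^sup>T * Q = 1\<^sub>m m \<and>
     Qp \<in> carrier_mat d (d - m) \<and> Qp\<^sup>T * Qp = 1\<^sub>m (d - m) \<and> Q\<^sup>T * Qp = 0\<^sub>m m (d - m)"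

definition cond_number :: "real mat \<Rightarrow> real" where
  "cond_number T = hd (eigs T) / last (eigs T)"

text \<open>
  For condition number 1 the mathematical value is infinite, so that negative powers of it vanish.
  Here division by zero gives the value 0, whose negative integer powers are 0 as well.
\<close>
definition lanczos_rate :: "real mat \<Rightarrow> real" where
  "lanczos_rate T = (sqrt (cond_number T) + 1) / (sqrt (cond_number T) - 1)"

definition gauss_lanczos_bound :: "real mat \<Rightarrow> real mat \<Rightarrow> real mat \<Rightarrow> real \<Rightarrow> bool" where
  "gauss_lanczos_bound A Q Qp C \<longleftrightarrow>
     (let P = perp_proj Q; T = Qp\<^sup>T * A * Qp in
      \<forall>l\<ge>1. \<forall>u\<in>(\<lambda>x. P *\<^sub>v x) ` carrier_vec (dim_row A). vnorm u = 1 \<longrightarrow>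
        \<bar>u \<bullet> (pinv (P * A * P) *\<^sub>v u) - lanczos_quad A P u l\<bar>
          \<le> C * lanczos_rate T powi (- 2 * int l))"

definition vec_coords :: "nat \<Rightarrow> real vec \<Rightarrow> nat \<Rightarrow> real" where
  "vec_coords d x = (\<lambda>j\<in>{..<d}. x $ j)"

text \<open>
  The vectors of dimension \<^term>\<open>d\<close> are identified with the extensional functions on
  \<^term>\<open>{..<d}\<close>, on which $N(0, I_d)$ is the product of standard normal distributions.
\<close>
definition std_gaussian :: "nat \<Rightarrow> (nat \<Rightarrow> real) measure" where
  "std_gaussian d = PiM {..<d} (\<lambda>_. density lborel (\<lambda>x. ennreal (std_normal_density x)))"

definition iid_std_gaussian :: "'w measure \<Rightarrow> nat \<Rightarrow> (nat \<Rightarrow> 'w \<Rightarrow> real vec) \<Rightarrow> bool" where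
  "iid_std_gaussian M d \<xi> \<longleftrightarrow>
     (\<forall>i. \<forall>\<omega>\<in>space M. \<xi> i \<omega> \<in> carrier_vec d) \<and>
     prob_space.indep_vars M (\<lambda>_. PiM {..<d} (\<lambda>_. borel)) (\<lambda>i \<omega>. vec_coords d (\<xi> i \<omega>)) UNIV \<and>
     (\<forall>i. distr M (PiM {..<d} (\<lambda>_. borel)) (\<lambda>\<omega>. vec_coords d (\<xi> i \<omega>)) = std_gaussian d)"

definition slq_sample :: "real mat \<Rightarrow> real mat \<Rightarrow> nat \<Rightarrow> real vec \<Rightarrow> real" where
  "slq_sample A P l x = (let u = P *\<^sub>v x in
     (vnorm u)\<^sup>2 * lanczos_quad A P ((1 / vnorm u) \<cdot>\<^sub>v u) l)"

definition pslq_estimator ::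
    "real mat \<Rightarrow> real mat \<Rightarrow> (nat \<Rightarrow> 'w \<Rightarrow> real vec) \<Rightarrow> nat \<Rightarrow> nat \<Rightarrow> 'w \<Rightarrow> real" where
  "pslq_estimator A P \<xi> N l \<omega> = (\<Sum>i<N. slq_sample A P l (\<xi> i \<omega>)) / real N"

end

theory Submission
  imports
    Defs
    "Jordan_Normal_Form.Spectral_Radius"
    "HOL-Library.Discrete_Functions"
begin

text \<open>
  In an orthonormal eigenbasis of the compression of \<^term>\<open>A\<close> to the complement of the deflation
  space, the exact quadratic form of the pseudoinverse is a weighted sum of the \<open>1 / \<mu>\<^sub>i\<close>. The Lanczos
  quadrature is the same form with the solution of the linear system replaced by its Galerkin
  approximation from the Krylov space; the error is the squared energy norm of the Galerkin error,
  which is minimal over the Krylov space and is bounded with a Chebyshev polynomial. Breakdown is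
  harmless: the Krylov space is then invariant.

  For a Gaussian probe \<open>\<xi>\<close>, the sample therefore differs from \<open>\<xi> \<bullet> A\<^sup>+ \<xi>\<close> by at most \<open>\<epsilon>\<close> times
  \<open>\<xi> \<bullet> P \<xi>\<close>. Isserlis' formula gives mean and variance of both quadratic forms, hence the bias, and,
  by the triangle inequality for standard deviations, the variance. The strong laws hold because all
  summands are nonnegative and square integrable: Chebyshev's inequality gives convergence along the
  squares, and monotonicity of the partial sums fills the gaps.
\<close>

section \<open>Real symmetric matrices\<close>

text \<open>The quadrature bound is both a hypothesis and a result. The estimates that mention
  \<open>C\<close> hold for every positive constant satisfying \<open>gauss_lanczos_bound\<close>;
  the claims without \<open>C\<close> (integrability, exponential decay of the bias, the O(1/N)
  rate, almost sure limits) rest on the existence of one, so the bound is proved with 4 divided by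
  the least eigenvalue of the compression. The 4 is the square of the 2 in the estimate 2 / \<rho>^l
  for a Chebyshev polynomial of degree l normalised to be 1 at the origin; the eigenvalue comes from
  dividing the squared residual by \<open>\<mu>\<close>. The number of Lanczos steps really executed
  depends on the probe and may be smaller than l. Hence orthogonality, the Galerkin property and the
  Krylov argument are phrased with that number, and measurability of a sample is obtained by
  splitting over its values. What crosses from linear algebra to probability is one inequality,
  |exact - sample| <= \<epsilon> times the squared norm of the projected probe, together with
  measurability and nonnegativity of the samples.\<close>

lemma scalar_prod_self_nonneg: "0 \<le> (v :: real vec) \<bullet> v"
  by (auto simp: scalar_prod_def intro!: sum_nonneg)

lemma vnorm_power2: "(vnorm v)\<^sup>2 = v \<bullet> v"
  by (simp add: vnorm_def scalar_prod_self_nonneg)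

lemma vnorm_nonneg: "0 \<le> vnorm v"
  by (simp add: vnorm_def scalar_prod_self_nonneg)

lemma scalar_prod_self_eq_0:
  assumes "(v :: real vec) \<in> carrier_vec n"
  shows "v \<bullet> v = 0 \<longleftrightarrow> v = 0\<^sub>v n"
proof
  assume "v \<bullet> v = 0"
  hence "\<forall>i\<in>{0..<n}. v $ i * v $ i = 0"
    using assms unfolding scalar_prod_def
    by (subst (asm) sum_nonneg_eq_0_iff) auto
  thus "v = 0\<^sub>v n" using assms by (intro eq_vecI) auto
qed (use assms in auto)

lemma vnorm_eq_0:
  assumes "v \<in> carrier_vec n"
  shows "vnorm v = 0 \<longleftrightarrow> v = 0\<^sub>v n"
  using scalar_prod_self_eq_0[OF assms] by (simp add: vnorm_def)

lemma sym_scalar_prod: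
  assumes "(T :: real mat) \<in> carrier_mat n n" "T\<^sup>T = T" "x \<in> carrier_vec n" "y \<in> carrier_vec n"
  shows "x \<bullet> (T *\<^sub>v y) = (T *\<^sub>v x) \<bullet> y"
  using transpose_vec_mult_scalar[OF assms(1,4,3)] assms(2) by simp

text \<open>A complex eigenvector exists because the complex spectrum is nonempty. With real and
  imaginary parts \<open>x\<close>, \<open>y\<close> and eigenvalue \<open>a + ib\<close>, symmetry
  of \<open>T\<close> applied to the pair \<open>x\<close>, \<open>y\<close> gives
  \<open>b * (x \<bullet> x + y \<bullet> y) = 0\<close>. So the eigenvalue is real, and each
  nonzero part is a real eigenvector.\<close>

lemma sym_eigenvector_exists:
  fixes T :: "real mat"
  assumes T: "T \<in> carrier_mat n n" and sym: "T\<^sup>T = T" and n: "0 < n"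
  obtains a v where "v \<in> carrier_vec n" "v \<bullet> v = 1" "T *\<^sub>v v = a \<cdot>\<^sub>v v"
proof -
  let ?Tc = "map_mat complex_of_real T"
  have Tc: "?Tc \<in> carrier_mat n n" using T by auto
  obtain k where "eigenvalue ?Tc k"
    using spectrum_non_empty[OF Tc n] by (auto simp: spectrum_def)
  then obtain z where z: "z \<in> carrier_vec n" "z \<noteq> 0\<^sub>v n" and ev: "?Tc *\<^sub>v z = k \<cdot>\<^sub>v z"
    using T by (auto simp: eigenvalue_def eigenvector_def)
  define x where "x = map_vec Re z"
  define y where "y = map_vec Im z"
  define a where "a = Re k"
  define b where "b = Im k"
  have x: "x \<in> carrier_vec n" and y: "y \<in> carrier_vec n" using z by (auto simp: x_def y_def)
  have comp: "(\<Sum>j = 0..<n. complex_of_real (T $$ (i, j)) * z $ j) = k * z $ i" if "i < n" for i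
    using arg_cong[OF ev, of "\<lambda>w. w $ i"] that T z
    by (auto simp: scalar_prod_def)
  have Tx: "T *\<^sub>v x = a \<cdot>\<^sub>v x - b \<cdot>\<^sub>v y"
  proof (rule eq_vecI)
    fix i assume "i < dim_vec (a \<cdot>\<^sub>v x - b \<cdot>\<^sub>v y)"
    hence i: "i < n" using y by auto
    show "(T *\<^sub>v x) $ i = (a \<cdot>\<^sub>v x - b \<cdot>\<^sub>v y) $ i"
      using arg_cong[OF comp[OF i], of Re] i T z x y
      by (auto simp: scalar_prod_def x_def y_def a_def b_def)
  qed (use T y in auto)
  have Ty: "T *\<^sub>v y = b \<cdot>\<^sub>v x + a \<cdot>\<^sub>v y"
  proof (rule eq_vecI)
    fix i assume "i < dim_vec (b \<cdot>\<^sub>v x + a \<cdot>\<^sub>v y)"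
    hence i: "i < n" using y by auto
    show "(T *\<^sub>v y) $ i = (b \<cdot>\<^sub>v x + a \<cdot>\<^sub>v y) $ i"
      using arg_cong[OF comp[OF i], of Im] i T z x y
      by (auto simp: scalar_prod_def x_def y_def a_def b_def algebra_simps)
  qed (use T y in auto)
  have "y \<bullet> (T *\<^sub>v x) = (T *\<^sub>v y) \<bullet> x" by (rule sym_scalar_prod[OF T sym y x])
  hence "a * (y \<bullet> x) - b * (y \<bullet> y) = b * (x \<bullet> x) + a * (y \<bullet> x)"
    using x y by (simp add: Tx Ty scalar_prod_minus_distrib[of _ n] add_scalar_prod_distrib[of _ n])
  hence "b * (x \<bullet> x + y \<bullet> y) = 0" by (simp add: algebra_simps)
  moreover have nz: "x \<noteq> 0\<^sub>v n \<or> y \<noteq> 0\<^sub>v n"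
  proof (rule ccontr)
    assume "\<not> ?thesis"
    hence "x = 0\<^sub>v n" "y = 0\<^sub>v n" by auto
    hence "Re (z $ i) = 0 \<and> Im (z $ i) = 0" if "i < n" for i
    proof -
      have "x $ i = 0" "y $ i = 0" using that \<open>x = 0\<^sub>v n\<close> \<open>y = 0\<^sub>v n\<close> by simp_all
      thus ?thesis using that z by (simp add: x_def y_def)
    qed
    hence "z = 0\<^sub>v n" using z by (intro eq_vecI) (auto simp: complex_eq_iff)
    thus False using z by simp
  qed
  ultimately have "b = 0"
    using scalar_prod_self_eq_0[OF x] scalar_prod_self_eq_0[OF y]
      scalar_prod_self_nonneg[of x] scalar_prod_self_nonneg[of y]
    by (auto simp: add_nonneg_eq_0_iff)
  hence "T *\<^sub>v x = a \<cdot>\<^sub>v x" "T *\<^sub>v y = a \<cdot>\<^sub>v y" using Tx Ty x y by auto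
  with nz x y obtain w where w: "w \<in> carrier_vec n" "w \<noteq> 0\<^sub>v n" "T *\<^sub>v w = a \<cdot>\<^sub>v w" by auto
  have pos: "0 < vnorm w" using vnorm_nonneg[of w] vnorm_eq_0[OF w(1)] w(2) by simp
  show ?thesis
  proof (rule that[of "(1 / vnorm w) \<cdot>\<^sub>v w" a])
    have "((1 / vnorm w) \<cdot>\<^sub>v w) \<bullet> ((1 / vnorm w) \<cdot>\<^sub>v w) = (1 / vnorm w)\<^sup>2 * (vnorm w)\<^sup>2"
      using w unfolding vnorm_power2 by (simp add: power2_eq_square)
    also have "\<dots> = (1 / vnorm w * vnorm w)\<^sup>2" by (simp only: power_mult_distrib)
    also have "\<dots> = 1" using pos by simp
    finally show "((1 / vnorm w) \<cdot>\<^sub>v w) \<bullet> ((1 / vnorm w) \<cdot>\<^sub>v w) = 1" .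
    show "T *\<^sub>v ((1 / vnorm w) \<cdot>\<^sub>v w) = a \<cdot>\<^sub>v ((1 / vnorm w) \<cdot>\<^sub>v w)"
      using w T by (simp add: mult_mat_vec smult_smult_assoc mult.commute)
  qed (use w in auto)
qed

text \<open>The reflection along the difference of two unit vectors swaps them. The case
  \<open>v = unit_vec n 0\<close> is separate because the difference is then zero.\<close>

lemma householder_exists:
  fixes v :: "real vec"
  assumes v: "v \<in> carrier_vec n" and unit: "v \<bullet> v = 1" and n: "0 < n"
  obtains H where "H \<in> carrier_mat n n" "H\<^sup>T = H" "H * H = 1\<^sub>m n" "H *\<^sub>v unit_vec n 0 = v"
proof (cases "v = unit_vec n 0")
  case True
  thus ?thesis by (intro that[of "1\<^sub>m n"]) auto
next
  case False
  define w where "w = v - unit_vec n 0"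
  define s where "s = w \<bullet> w"
  define H where "H = mat n n (\<lambda>(i, j). (if i = j then 1 else 0) - 2 / s * (w $ i * w $ j))"
  have w: "w \<in> carrier_vec n" using v by (auto simp: w_def)
  have "w \<noteq> 0\<^sub>v n"
  proof
    assume 0: "w = 0\<^sub>v n"
    have "v $ i = unit_vec n 0 $ i" if "i < n" for i
      using arg_cong[OF 0, of "\<lambda>x. x $ i"] that v by (auto simp: w_def)
    thus False using False v by (auto intro!: eq_vecI)
  qed
  hence s0: "s \<noteq> 0" using scalar_prod_self_eq_0[OF w] by (simp add: s_def)
  have s: "s = (\<Sum>i = 0..<n. w $ i * w $ i)" using w by (auto simp: s_def scalar_prod_def)
  \<comment> \<open>As both vectors have norm 1, \<open>s = - 2 * w $ 0\<close>; this is what makes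
    the reflection carry the first unit vector exactly to \<open>v\<close>.\<close>
  have s2: "s = 2 - 2 * v $ 0"
    using v n unit unfolding s_def w_def
    by (simp add: minus_scalar_prod_distrib[of _ n] scalar_prod_minus_distrib[of _ n])
  have w0: "w $ 0 = v $ 0 - 1" using v n by (auto simp: w_def)
  have H: "H \<in> carrier_mat n n" by (simp add: H_def)
  have e: "(\<Sum>k = 0..<n. ((if i = k then 1 else 0) - 2 / s * (w $ i * w $ k)) *
        ((if k = j then 1 else 0) - 2 / s * (w $ k * w $ j))) = (if i = j then 1 else 0)"
    if "i < n" "j < n" for i j
  proof -
    have "(\<Sum>k = 0..<n. ((if i = k then 1 else 0) - 2 / s * (w $ i * w $ k)) *
        ((if k = j then 1 else 0) - 2 / s * (w $ k * w $ j)))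
      = (\<Sum>k = 0..<n. (if i = k then (if i = j then 1 else 0) else 0)
         - (if k = j then 2 / s * (w $ i * w $ j) else 0)
         - (if i = k then 2 / s * (w $ i * w $ j) else 0)
         + 4 / s\<^sup>2 * w $ i * w $ j * (w $ k * w $ k))"
      by (rule sum.cong) (auto simp: algebra_simps power2_eq_square)
    also have "\<dots> = (if i = j then 1 else 0) - 2 / s * (w $ i * w $ j) - 2 / s * (w $ i * w $ j)
         + 4 / s\<^sup>2 * w $ i * w $ j * s"
      using that by (simp add: sum.distrib sum_subtractf s sum_distrib_left)
    also have "\<dots> = (if i = j then 1 else 0)"
      using s0 by (simp add: field_simps power2_eq_square)
    finally show ?thesis .
  qed
  show ?thesis
  proof (rule that[OF H])
    show "H\<^sup>T = H" by (rule eq_matI) (auto simp: H_def)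
    show "H * H = 1\<^sub>m n"
      using e by (intro eq_matI) (auto simp: H_def scalar_prod_def)
    show "H *\<^sub>v unit_vec n 0 = v"
    proof (rule eq_vecI)
      fix i assume "i < dim_vec v"
      hence i: "i < n" using v by auto
      have "2 / s * (w $ i * w $ 0) = - w $ i"
        using s0 by (simp add: s2 w0 field_simps)
      thus "(H *\<^sub>v unit_vec n 0) $ i = v $ i"
        using i n v by (auto simp: H_def w_def)
    qed (use v in \<open>auto simp: H_def\<close>)
  qed
qed

section \<open>Orthogonal diagonalisation and lists of eigenvalues\<close>

definition diagm :: "nat \<Rightarrow> (nat \<Rightarrow> real) \<Rightarrow> real mat" where
  "diagm n f = mat n n (\<lambda>(i, j). if i = j then f i else 0)"

lemma diagm_carrier [simp]: "diagm n f \<in> carrier_mat n n"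
  by (simp add: diagm_def)

lemma diagm_dim [simp]: "dim_row (diagm n f) = n" "dim_col (diagm n f) = n"
  by (simp_all add: diagm_def)

lemma diagm_transpose [simp]: "(diagm n f)\<^sup>T = diagm n f"
  by (rule eq_matI) (auto simp: diagm_def)

lemma diagm_mult_vec:
  assumes "v \<in> carrier_vec n"
  shows "diagm n f *\<^sub>v v = vec n (\<lambda>i. f i * v $ i)"
  using assms by (intro eq_vecI) (auto simp: diagm_def scalar_prod_def if_distrib[of "\<lambda>x. x * _"] cong: if_cong)

lemma diagm_mult: "diagm n f * diagm n g = diagm n (\<lambda>i. f i * g i)"
  by (rule eq_matI) (auto simp: diagm_def scalar_prod_def if_distrib[of "\<lambda>x. x * _"] cong: if_cong)

lemma diagm_one: "(\<And>i. i < n \<Longrightarrow> f i = 1) \<Longrightarrow> diagm n f = 1\<^sub>m n"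
  by (rule eq_matI) (auto simp: diagm_def)

text \<open>Deflation by one dimension: conjugating with a reflection that sends the first unit
  vector to an eigenvector makes the first column a multiple of that unit vector, symmetry does the
  same for the first row, and the induction hypothesis diagonalises the remaining block.\<close>

lemma spectral_theorem:
  fixes T :: "real mat"
  assumes "T \<in> carrier_mat n n" "T\<^sup>T = T"
  shows "\<exists>U f. U \<in> carrier_mat n n \<and> U\<^sup>T * U = 1\<^sub>m n \<and> T = U * diagm n f * U\<^sup>T"
  using assms
proof (induction n arbitrary: T)
  case 0
  hence "T = diagm 0 f" for f by (intro eq_matI) auto
  hence "1\<^sub>m 0 \<in> carrier_mat 0 0 \<and> (1\<^sub>m 0)\<^sup>T * 1\<^sub>m 0 = 1\<^sub>m 0 \<and> T = 1\<^sub>m 0 * diagm 0 undefined * (1\<^sub>m 0)\<^sup>T"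
    using 0 by auto
  thus ?case by blast
next
  case (Suc n)
  note T = Suc.prems(1) and sym = Suc.prems(2)
  let ?N = "Suc n"
  obtain a v where v: "v \<in> carrier_vec ?N" "v \<bullet> v = 1" "T *\<^sub>v v = a \<cdot>\<^sub>v v"
    by (rule sym_eigenvector_exists[OF T sym]) auto
  obtain H where H: "H \<in> carrier_mat ?N ?N" "H\<^sup>T = H" "H * H = 1\<^sub>m ?N"
    and Hv: "H *\<^sub>v unit_vec ?N 0 = v"
    by (rule householder_exists[OF v(1,2)]) auto
  define B where "B = H * T * H"
  have B: "B \<in> carrier_mat ?N ?N" using H T by (auto simp: B_def)
  have symB: "B\<^sup>T = B"
  proof -
    have "B\<^sup>T = H * (T * H)"
      using H T sym by (simp add: B_def transpose_mult[of H ?N ?N "T * H" ?N] transpose_mult[of T ?N ?N H ?N])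
    also have "\<dots> = B" using H(1) T by (simp add: B_def assoc_mult_mat[of _ ?N ?N _ ?N])
    finally show ?thesis .
  qed
  have HBH: "T = H * B * H"
  proof -
    have "H * B * H = (H * H) * T * (H * H)"
      using H(1) T by (simp add: B_def assoc_mult_mat[of _ ?N ?N _ ?N _ ?N])
    thus ?thesis using H(3) T by simp
  qed
  have "B *\<^sub>v unit_vec ?N 0 = a \<cdot>\<^sub>v (H *\<^sub>v v)"
    using H(1) T v by (simp add: B_def assoc_mult_mat_vec[of _ ?N ?N _ ?N] Hv mult_mat_vec[of _ ?N ?N])
  also have "H *\<^sub>v v = (H * H) *\<^sub>v unit_vec ?N 0"
    using H(1) by (simp add: assoc_mult_mat_vec[of _ ?N ?N _ ?N] Hv)
  finally have Be: "B *\<^sub>v unit_vec ?N 0 = a \<cdot>\<^sub>v unit_vec ?N 0" using H(3) by simp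
  have col0: "B $$ (i, 0) = (if i = 0 then a else 0)" if "i < ?N" for i
    using arg_cong[OF Be, of "\<lambda>w. w $ i"] that B by simp
  have row0: "B $$ (0, i) = (if i = 0 then a else 0)" if "i < ?N" for i
    using col0[OF that] that B arg_cong[OF symB, of "\<lambda>M. M $$ (0, i)"] by simp
  define B' where "B' = mat n n (\<lambda>(i, j). B $$ (Suc i, Suc j))"
  have B': "B' \<in> carrier_mat n n" by (simp add: B'_def)
  have "B'\<^sup>T = B'"
  proof (rule eq_matI)
    fix i j assume "i < dim_row B'" "j < dim_col B'"
    thus "B'\<^sup>T $$ (i, j) = B' $$ (i, j)"
      using B arg_cong[OF symB, of "\<lambda>M. M $$ (Suc i, Suc j)"] by (simp add: B'_def)
  qed (simp_all add: B'_def)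
  from Suc.IH[OF B' this] obtain U' g where U': "U' \<in> carrier_mat n n" "U'\<^sup>T * U' = 1\<^sub>m n"
    and B'eq: "B' = U' * diagm n g * U'\<^sup>T" by blast
  define f where "f = case_nat a g"
  let ?one = "1\<^sub>m 1 :: real mat"
  define Z where "Z = four_block_mat ?one (0\<^sub>m 1 n) (0\<^sub>m n 1) U'"
  have Z: "Z \<in> carrier_mat ?N ?N" using U' by (auto simp: Z_def)
  have ZT: "Z\<^sup>T = four_block_mat ?one (0\<^sub>m 1 n) (0\<^sub>m n 1) (U'\<^sup>T)"
    unfolding Z_def using U' by (subst transpose_four_block_mat[of _ 1 1 _ n _ n]) auto
  have ZZ: "Z\<^sup>T * Z = 1\<^sub>m ?N"
    unfolding ZT unfolding Z_def using U' by (subst mult_four_block_mat[of _ 1 1 _ n _ n _ _ 1 _ n]) auto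
  have D: "diagm ?N f = four_block_mat (a \<cdot>\<^sub>m ?one) (0\<^sub>m 1 n) (0\<^sub>m n 1) (diagm n g)"
    by (rule eq_matI) (auto simp: diagm_def f_def split: nat.split)
  have BZ: "B = Z * diagm ?N f * Z\<^sup>T"
  proof -
    have "Z * diagm ?N f * Z\<^sup>T = four_block_mat (a \<cdot>\<^sub>m ?one) (0\<^sub>m 1 n) (0\<^sub>m n 1) B'"
      unfolding D ZT unfolding Z_def using U' B'
      by (simp add: mult_four_block_mat[of _ 1 1 _ n _ n _ _ 1 _ n] flip: B'eq)
    also have "\<dots> = B"
    proof (rule eq_matI)
      fix i j assume "i < dim_row B" "j < dim_col B"
      thus "four_block_mat (a \<cdot>\<^sub>m ?one) (0\<^sub>m 1 n) (0\<^sub>m n 1) B' $$ (i, j) = B $$ (i, j)"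
        using B col0 row0 by (cases i; cases j) (auto simp: B'_def)
    qed (use B B' in auto)
    finally show ?thesis by simp
  qed
  let ?U = "H * Z"
  have UT: "?U\<^sup>T = Z\<^sup>T * H" using H Z by (simp add: transpose_mult[of _ ?N ?N])
  have ZTc: "Z\<^sup>T \<in> carrier_mat ?N ?N" using Z by auto
  have "?U\<^sup>T * ?U = Z\<^sup>T * (H * H) * Z"
    unfolding UT using H(1) Z ZTc by (simp add: assoc_mult_mat[of _ ?N ?N _ ?N _ ?N] del: transpose_carrier_mat)
  also have "\<dots> = 1\<^sub>m ?N" using ZZ H(3) ZTc by simp
  finally have 1: "?U\<^sup>T * ?U = 1\<^sub>m ?N" .
  have 2: "T = ?U * diagm ?N f * ?U\<^sup>T"
    unfolding UT using HBH BZ H(1) Z ZTc diagm_carrier[of ?N f]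
    by (simp add: assoc_mult_mat[of _ ?N ?N _ ?N _ ?N] del: transpose_carrier_mat)
  from 1 2 show ?case using H Z by (intro exI[of _ ?U] exI[of _ f]) auto
qed


text \<open>\<open>T\<close> is similar to \<open>diagm n f\<close>, whose characteristic polynomial
  splits into linear factors. So every orthogonal diagonalisation determines \<open>eigs T\<close>,
  in whatever order its eigenvectors come.\<close>

lemma sorted_eigs_of_diag:
  assumes U: "U \<in> carrier_mat n n" "U\<^sup>T * U = 1\<^sub>m n" and T: "T = U * diagm n f * U\<^sup>T"
  shows "eigs T = rev (sort (map f [0..<n]))"
proof -
  have UU: "U * U\<^sup>T = 1\<^sub>m n"
    by (rule mat_mult_left_right_inverse[OF _ U(1) U(2)]) (use U in auto)
  have "similar_mat_wit T (diagm n f) U (U\<^sup>T)"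
    unfolding similar_mat_wit_def Let_def using U UU T by auto
  hence "char_poly T = char_poly (diagm n f)"
    by (intro char_poly_similar) (auto simp: similar_mat_def)
  also have "\<dots> = (\<Prod>a\<leftarrow>map f [0..<n]. [:- a, 1:])"
    by (subst char_poly_upper_triangular[OF diagm_carrier])
      (auto simp: diagm_def diag_mat_def intro!: arg_cong[of _ _ prod_list] map_cong)
  finally have cp: "char_poly T = (\<Prod>a\<leftarrow>map f [0..<n]. [:- a, 1:])" .
  have "proots (\<Prod>a\<leftarrow>xs. [:- a, 1:]) = mset xs" for xs :: "real list"
  proof (induction xs)
    case (Cons x xs)
    have "(\<Prod>a\<leftarrow>xs. [:- a, 1:]) \<noteq> 0" by (auto simp: prod_list_zero_iff)
    thus ?case using Cons by (simp add: proots_mult proots_linear_factor[of "- x", simplified] del: mult_pCons_left)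
  qed simp
  note this[of "map f [0..<n]"]
  thus ?thesis unfolding eigs_def cp by (simp only: sorted_list_of_multiset_mset)
qed

lemma eigs_extremes:
  assumes "eigs T = rev (sort (map f [0..<n]))" "0 < n"
  shows "i < n \<Longrightarrow> last (eigs T) \<le> f i" "i < n \<Longrightarrow> f i \<le> hd (eigs T)"
    "\<exists>i<n. last (eigs T) = f i" "\<exists>i<n. hd (eigs T) = f i"
proof -
  let ?s = "sort (map f [0..<n])"
  have ne: "?s \<noteq> []" using assms(2) by (metis length_sort length_map length_upt list.size(3) diff_zero less_irrefl)
  have set: "set ?s = f ` {0..<n}" by simp
  have l: "last (eigs T) = hd ?s" and h: "hd (eigs T) = last ?s"
    using ne by (simp_all add: assms(1) last_rev hd_rev)
  show "\<exists>i<n. last (eigs T) = f i" "\<exists>i<n. hd (eigs T) = f i"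
    using hd_in_set[OF ne] last_in_set[OF ne] unfolding l h set by auto
  have srt: "sorted ?s" by simp
  show "last (eigs T) \<le> f i" if "i < n"
  proof -
    have "f i \<in> set ?s" using that by auto
    then obtain k where "k < length ?s" "?s ! k = f i" by (auto simp only: in_set_conv_nth)
    thus ?thesis unfolding l using srt ne by (metis hd_conv_nth le0 sorted_iff_nth_mono)
  qed
  show "f i \<le> hd (eigs T)" if "i < n"
  proof -
    have "f i \<in> set ?s" using that by auto
    then obtain k where k: "k < length ?s" "?s ! k = f i" by (auto simp only: in_set_conv_nth)
    hence "?s ! k \<le> ?s ! (length ?s - 1)" by (intro sorted_nth_mono[OF srt]) auto
    thus ?thesis unfolding h using k ne by (simp add: last_conv_nth)
  qed
qed

section \<open>Trace, Frobenius norm, pseudoinverse and inverse\<close>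

lemma mat_trace_comm:
  assumes A: "A \<in> carrier_mat r c" and B: "B \<in> carrier_mat c r"
  shows "mat_trace (A * B) = mat_trace (B * A)"
proof -
  have "mat_trace (A * B) = (\<Sum>i<r. \<Sum>j<c. A $$ (i, j) * B $$ (j, i))"
    using A B by (auto simp: mat_trace_def scalar_prod_def lessThan_atLeast0)
  also have "\<dots> = (\<Sum>j<c. \<Sum>i<r. B $$ (j, i) * A $$ (i, j))"
    by (subst sum.swap) (simp add: mult.commute)
  also have "\<dots> = mat_trace (B * A)"
    using A B by (auto simp: mat_trace_def scalar_prod_def lessThan_atLeast0)
  finally show ?thesis .
qed

lemma mat_trace_diagm: "mat_trace (diagm n f) = (\<Sum>i<n. f i)"
  by (simp add: mat_trace_def diagm_def)

lemma frobenius_norm_power2: "(frobenius_norm X)\<^sup>2 = mat_trace (X * X\<^sup>T)"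
  by (auto simp: frobenius_norm_def mat_trace_def scalar_prod_def lessThan_atLeast0
      power2_eq_square sum_nonneg)

text \<open>Penrose's argument: symmetry of the products gives \<open>A * X = A * Y\<close> and
  \<open>X * A = Y * A\<close>, and then X = XAX = YAX = YAY = Y. This makes the definite
  description in \<open>pinv\<close> meaningful.\<close>

lemma moore_penrose_unique:
  assumes X: "is_moore_penrose A X" and Y: "is_moore_penrose A Y"
  shows "X = Y"
proof -
  obtain r k where c: "A \<in> carrier_mat r k" "X \<in> carrier_mat k r" "Y \<in> carrier_mat k r"
    using X Y by (auto simp: is_moore_penrose_def)
  have x: "A * X * A = A" "X * A * X = X" "(A * X)\<^sup>T = A * X" "(X * A)\<^sup>T = X * A"
    and y: "A * Y * A = A" "Y * A * Y = Y" "(A * Y)\<^sup>T = A * Y" "(Y * A)\<^sup>T = Y * A"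
    using X Y unfolding is_moore_penrose_def by blast+
  have 1: "A * Y * (A * X) = A * X"
  proof -
    have "A * Y * (A * X) = A * Y * A * X"
      by (rule assoc_mult_mat[OF mult_carrier_mat[OF c(1,3)] c(1,2), symmetric])
    thus ?thesis by (simp only: y)
  qed
  have 2: "A * X * (A * Y) = A * Y"
  proof -
    have "A * X * (A * Y) = A * X * A * Y"
      by (rule assoc_mult_mat[OF mult_carrier_mat[OF c(1,2)] c(1,3), symmetric])
    thus ?thesis by (simp only: x)
  qed
  have AX: "A * X = A * Y"
  proof -
    have "A * X = (A * Y * (A * X))\<^sup>T" by (simp only: 1 x)
    also have "\<dots> = (A * X)\<^sup>T * (A * Y)\<^sup>T" using c by (intro transpose_mult) auto
    also have "\<dots> = A * Y" by (simp only: x y 2)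
    finally show ?thesis .
  qed
  have 3: "X * A * (Y * A) = X * A"
  proof -
    have "X * A * (Y * A) = X * (A * Y * A)"
      by (simp only: assoc_mult_mat[OF c(1,3,1)] assoc_mult_mat[OF c(2,1) mult_carrier_mat[OF c(3,1)]])
    thus ?thesis by (simp only: y)
  qed
  have 4: "Y * A * (X * A) = Y * A"
  proof -
    have "Y * A * (X * A) = Y * (A * X * A)"
      by (simp only: assoc_mult_mat[OF c(1,2,1)] assoc_mult_mat[OF c(3,1) mult_carrier_mat[OF c(2,1)]])
    thus ?thesis by (simp only: x)
  qed
  have XA: "X * A = Y * A"
  proof -
    have "X * A = (X * A * (Y * A))\<^sup>T" by (simp only: 3 x)
    also have "\<dots> = (Y * A)\<^sup>T * (X * A)\<^sup>T" using c by (intro transpose_mult) auto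
    also have "\<dots> = Y * A" by (simp only: x y 4)
    finally show ?thesis .
  qed
  have "X = X * A * X" by (simp only: x)
  also have "\<dots> = Y * (A * X)" unfolding XA by (rule assoc_mult_mat[OF c(3,1,2)])
  also have "\<dots> = Y * A * Y" unfolding AX by (rule assoc_mult_mat[OF c(3,1,3), symmetric])
  finally show ?thesis by (simp only: y)
qed

lemma pinv_eqI: "is_moore_penrose A X \<Longrightarrow> pinv A = X"
  unfolding pinv_def by (rule the_equality) (auto intro: moore_penrose_unique)

lemma minv_inverse:
  fixes T :: "real mat"
  assumes T: "T \<in> carrier_mat n n" and det: "det T \<noteq> 0"
  shows "T * minv T = 1\<^sub>m n" "minv T * T = 1\<^sub>m n" "minv T \<in> carrier_mat n n"
proof -
  have "T \<in> Units (ring_mat TYPE(real) n ())" by (rule det_non_zero_imp_unit[OF T det])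
  with mat_inverse(1)[OF T] obtain B where "mat_inverse T = Some B" by fastforce
  with mat_inverse(2)[OF T this]
  show "T * minv T = 1\<^sub>m n" "minv T * T = 1\<^sub>m n" "minv T \<in> carrier_mat n n" by auto
qed

lemma minv_eqI:
  fixes T :: "real mat"
  assumes T: "T \<in> carrier_mat n n" and X: "X \<in> carrier_mat n n" and TX: "T * X = 1\<^sub>m n"
  shows "minv T = X"
proof -
  have XT: "X * T = 1\<^sub>m n" by (rule mat_mult_left_right_inverse[OF T X TX])
  have "det T * det X = 1" using arg_cong[OF TX, of det] T X by (simp add: det_mult)
  hence "det T \<noteq> 0" by auto
  note i = minv_inverse[OF T this]
  have "X = X * (T * minv T)" using i X by simp
  also have "\<dots> = X * T * minv T" using i X T by simp
  also have "\<dots> = minv T" using i XT by simp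
  finally show ?thesis by simp
qed

text \<open>
  All matrices of interest are diagonal in the orthonormal basis of $\mathrm{range}(P)$ given by
  the columns of \<^term>\<open>W\<close>.
\<close>
locale spectral_frame =
  fixes d n :: nat and A P W :: "real mat" and \<mu> :: "nat \<Rightarrow> real"
  assumes A: "A \<in> carrier_mat d d" and A_sym: "A\<^sup>T = A"
    and W: "W \<in> carrier_mat d n" and WTW: "W\<^sup>T * W = 1\<^sub>m n" and WWT: "W * W\<^sup>T = P"
    and PAP: "P * A * P = W * diagm n \<mu> * W\<^sup>T"
    and mu_pos: "\<And>i. i < n \<Longrightarrow> 0 < \<mu> i"
    and n_pos: "0 < n"
begin

text \<open>A functional calculus on the range of \<open>P\<close>: it is multiplicative with unit
  \<open>P\<close> (the value at 1), and takes \<open>\<mu>\<close> to \<open>P * A * P\<close> and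
  \<open>1 / \<mu>\<close> to the pseudoinverse. Penrose equations, traces and Frobenius norms
  thereby become statements about scalar functions.\<close>

definition conj_diag :: "(nat \<Rightarrow> real) \<Rightarrow> real mat" where
  "conj_diag f = W * diagm n f * W\<^sup>T"

lemma WT: "W\<^sup>T \<in> carrier_mat n d" using W by simp

lemma diagm_WT: "diagm n f * W\<^sup>T \<in> carrier_mat n d"
  by (rule mult_carrier_mat[OF diagm_carrier WT])

lemma W_diagm: "W * diagm n f \<in> carrier_mat d n"
  by (rule mult_carrier_mat[OF W diagm_carrier])

lemma conj_diag_carrier [simp]: "conj_diag f \<in> carrier_mat d d"
  unfolding conj_diag_def by (rule mult_carrier_mat[OF W_diagm WT])

lemma conj_diag_cong: "(\<And>i. i < n \<Longrightarrow> f i = g i) \<Longrightarrow> conj_diag f = conj_diag g"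
  unfolding conj_diag_def diagm_def by (intro arg_cong[of _ _ "\<lambda>X. W * X * W\<^sup>T"] cong_mat) auto

lemma conj_diag_alt: "conj_diag f = W * (diagm n f * W\<^sup>T)"
  unfolding conj_diag_def by (rule assoc_mult_mat[OF W diagm_carrier WT])

lemma conj_diag_transpose: "(conj_diag f)\<^sup>T = conj_diag f"
proof -
  have "(conj_diag f)\<^sup>T = (diagm n f * W\<^sup>T)\<^sup>T * W\<^sup>T"
    unfolding conj_diag_alt by (rule transpose_mult[OF W diagm_WT])
  also have "(diagm n f * W\<^sup>T)\<^sup>T = W * diagm n f"
    by (simp add: transpose_mult[OF diagm_carrier WT])
  finally show ?thesis by (simp only: conj_diag_def)
qed

lemma WT_W_cancel: "X \<in> carrier_mat n k \<Longrightarrow> W\<^sup>T * (W * X) = X"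
  by (simp add: WTW flip: assoc_mult_mat[OF WT W])

lemma conj_diag_mult: "conj_diag f * conj_diag g = conj_diag (\<lambda>i. f i * g i)"
proof -
  have "conj_diag f * conj_diag g = W * diagm n f * (W\<^sup>T * (W * (diagm n g * W\<^sup>T)))"
    unfolding conj_diag_alt[of g] unfolding conj_diag_def
    by (rule assoc_mult_mat[OF W_diagm WT mult_carrier_mat[OF W diagm_WT]])
  also have "\<dots> = W * (diagm n f * (diagm n g * W\<^sup>T))"
    unfolding WT_W_cancel[OF diagm_WT] by (rule assoc_mult_mat[OF W diagm_carrier diagm_WT])
  also have "diagm n f * (diagm n g * W\<^sup>T) = diagm n f * diagm n g * W\<^sup>T"
    by (rule assoc_mult_mat[OF diagm_carrier diagm_carrier WT, symmetric])
  finally show ?thesis unfolding conj_diag_alt diagm_mult .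
qed

lemma P_eq: "P = conj_diag (\<lambda>_. 1)"
  using W WWT by (simp add: conj_diag_def diagm_one)

lemma PAP_eq: "P * A * P = conj_diag \<mu>"
  by (simp add: PAP conj_diag_def)

lemma P: "P \<in> carrier_mat d d" and P_sym: "P\<^sup>T = P" and P_idem: "P * P = P"
  by (simp_all add: P_eq conj_diag_transpose conj_diag_mult)

lemma pinv_PAP: "pinv (P * A * P) = conj_diag (\<lambda>i. 1 / \<mu> i)"
proof -
  have e: "conj_diag (\<lambda>i. \<mu> i * (1 / \<mu> i)) = P" "conj_diag (\<lambda>i. 1 / \<mu> i * \<mu> i) = P"
    unfolding P_eq using mu_pos by (auto intro!: conj_diag_cong simp: less_imp_neq[symmetric])
  have "is_moore_penrose (conj_diag \<mu>) (conj_diag (\<lambda>i. 1 / \<mu> i))"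
    unfolding is_moore_penrose_def conj_diag_mult e conj_diag_transpose P_sym
    using mu_pos carrier_matD[OF conj_diag_carrier]
    by (auto simp: P_eq conj_diag_mult conj_diag_transpose intro!: conj_diag_cong)
  thus ?thesis unfolding PAP_eq by (rule pinv_eqI)
qed

lemma trace_conj_diag: "mat_trace (conj_diag f) = (\<Sum>i<n. f i)"
proof -
  have "mat_trace (conj_diag f) = mat_trace (W\<^sup>T * (W * diagm n f))"
    unfolding conj_diag_def using W by (intro mat_trace_comm[of _ d n]) auto
  thus ?thesis by (simp only: WT_W_cancel[OF diagm_carrier] mat_trace_diagm)
qed

lemma frobenius_conj_diag: "(frobenius_norm (conj_diag f))\<^sup>2 = (\<Sum>i<n. (f i)\<^sup>2)"
  unfolding frobenius_norm_power2 conj_diag_transpose conj_diag_mult trace_conj_diag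
  by (simp add: power2_eq_square)

lemma P_mult_vec:
  assumes "x \<in> carrier_vec d"
  shows "P *\<^sub>v x \<in> carrier_vec d" "P *\<^sub>v (P *\<^sub>v x) = P *\<^sub>v x"
  using assms P assoc_mult_mat_vec[OF P P assms] by (auto simp: P_idem)

lemma W_coords:
  assumes "c \<in> carrier_vec n"
  shows "W\<^sup>T *\<^sub>v (W *\<^sub>v c) = c"
  using assms assoc_mult_mat_vec[OF WT W assms] by (simp add: WTW)

lemma W_inner:
  assumes "x \<in> carrier_vec n" "y \<in> carrier_vec n"
  shows "(W *\<^sub>v x) \<bullet> (W *\<^sub>v y) = x \<bullet> y"
proof -
  have "(W *\<^sub>v x) \<bullet> (W *\<^sub>v y) = (W\<^sup>T *\<^sub>v (W *\<^sub>v x)) \<bullet> y"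
    using transpose_vec_mult_scalar[OF W assms(2), of "W *\<^sub>v x"] W assms by simp
  thus ?thesis using W_coords[OF assms(1)] by simp
qed

lemma W_range:
  assumes "x \<in> carrier_vec d" "P *\<^sub>v x = x"
  shows "W *\<^sub>v (W\<^sup>T *\<^sub>v x) = x"
  using assms assoc_mult_mat_vec[OF W WT assms(1)] by (simp add: WWT)

lemma conj_diag_mult_vec:
  assumes "c \<in> carrier_vec n"
  shows "conj_diag f *\<^sub>v (W *\<^sub>v c) = W *\<^sub>v vec n (\<lambda>i. f i * c $ i)"
proof -
  have Wc: "W *\<^sub>v c \<in> carrier_vec d" using W assms by simp
  have "conj_diag f *\<^sub>v (W *\<^sub>v c) = W *\<^sub>v (diagm n f *\<^sub>v (W\<^sup>T *\<^sub>v (W *\<^sub>v c)))"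
    unfolding conj_diag_alt assoc_mult_mat_vec[OF W diagm_WT Wc] assoc_mult_mat_vec[OF diagm_carrier WT Wc] ..
  thus ?thesis using assms by (simp add: W_coords diagm_mult_vec)
qed

end

context spectral_frame
begin

lemma conj_diag_quad:
  assumes x: "x \<in> carrier_vec d"
  shows "x \<bullet> (conj_diag f *\<^sub>v x) = (\<Sum>i<n. f i * ((W\<^sup>T *\<^sub>v x) $ i)\<^sup>2)"
proof -
  define c where "c = W\<^sup>T *\<^sub>v x"
  have c: "c \<in> carrier_vec n" using WT x by (simp add: c_def)
  have Dc: "diagm n f *\<^sub>v c \<in> carrier_vec n" by (rule mult_mat_vec_carrier[OF diagm_carrier c])
  have "conj_diag f *\<^sub>v x = W *\<^sub>v (diagm n f *\<^sub>v c)"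
    unfolding conj_diag_alt assoc_mult_mat_vec[OF W diagm_WT x] assoc_mult_mat_vec[OF diagm_carrier WT x] c_def ..
  hence "x \<bullet> (conj_diag f *\<^sub>v x) = c \<bullet> (diagm n f *\<^sub>v c)"
    using transpose_vec_mult_scalar[OF W Dc x] by (simp add: c_def)
  also have "\<dots> = (\<Sum>i<n. f i * (c $ i)\<^sup>2)"
    using c by (auto simp: diagm_mult_vec scalar_prod_def power2_eq_square lessThan_atLeast0 intro!: sum.cong)
  finally show ?thesis by (simp add: c_def)
qed

text \<open>\<open>\<mu> i\<close> is the Rayleigh quotient of \<open>A\<close> at the unit vector
  \<open>W *\<^sub>v unit_vec n i\<close>, which \<open>P\<close> fixes. Hence a lower bound for the
  form of \<open>A\<close> passes to the compression.\<close>

lemma mu_lower: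
  assumes i: "i < n" and low: "\<And>x. x \<in> carrier_vec d \<Longrightarrow> l * (x \<bullet> x) \<le> x \<bullet> (A *\<^sub>v x)"
  shows "l \<le> \<mu> i"
proof -
  define x where "x = W *\<^sub>v unit_vec n i"
  have x: "x \<in> carrier_vec d" using W by (simp add: x_def)
  have xx: "x \<bullet> x = 1" using i W_inner[of "unit_vec n i" "unit_vec n i"] by (simp add: x_def)
  have "P *\<^sub>v x = W *\<^sub>v vec n (\<lambda>j. unit_vec n i $ j)"
    using conj_diag_mult_vec[of "unit_vec n i" "\<lambda>_. 1"] by (simp add: P_eq x_def)
  also have "vec n (\<lambda>j. unit_vec n i $ j) = (unit_vec n i :: real vec)" by (rule eq_vecI) auto
  finally have Px: "P *\<^sub>v x = x" by (simp add: x_def)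
  have Ax: "A *\<^sub>v x \<in> carrier_vec d" using A x by simp
  have PA: "P * A \<in> carrier_mat d d" using P A by simp
  have "P * A * P *\<^sub>v x = P *\<^sub>v (A *\<^sub>v x)"
    by (simp only: assoc_mult_mat_vec[OF PA P x] assoc_mult_mat_vec[OF P A x] Px)
  hence "x \<bullet> (P * A * P *\<^sub>v x) = x \<bullet> (A *\<^sub>v x)"
    using sym_scalar_prod[OF P P_sym x Ax] Px by simp
  moreover have "x \<bullet> (P * A * P *\<^sub>v x) = \<mu> i"
  proof -
    have "W\<^sup>T *\<^sub>v x = unit_vec n i" unfolding x_def by (rule W_coords) simp
    hence "x \<bullet> (P * A * P *\<^sub>v x) = (\<Sum>j<n. if j = i then \<mu> j else 0)"
      unfolding PAP_eq conj_diag_quad[OF x] using i by (intro sum.cong) auto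
    thus ?thesis using i by simp
  qed
  ultimately show ?thesis using low[OF x] xx by simp
qed

end

text \<open>What remains to be shown is positivity of \<open>\<mu>\<close>: \<open>\<mu> i\<close>
  is the value of the form of \<open>A\<close> at the nonzero vector
  \<open>W *\<^sub>v unit_vec n i\<close>.\<close>

lemma spectral_frame_posI:
  assumes A: "sym_pos_def d A"
    and W: "W \<in> carrier_mat d n" "W\<^sup>T * W = 1\<^sub>m n" "W * W\<^sup>T = P"
    and PAP: "P * A * P = W * diagm n \<mu> * W\<^sup>T" and n: "0 < n"
  shows "spectral_frame d n A P W \<mu>"
proof -
  have Ac: "A \<in> carrier_mat d d" "A\<^sup>T = A" using A by (auto simp: sym_pos_def_def)
  have pos: "0 < \<mu> i" if i: "i < n" for i
  proof -
    define x where "x = W *\<^sub>v unit_vec n i"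
    have x: "x \<in> carrier_vec d" using W by (simp add: x_def)
    have WT: "W\<^sup>T \<in> carrier_mat n d" using W by simp
    have P: "P \<in> carrier_mat d d" using W by auto
    have Wx: "W\<^sup>T *\<^sub>v x = unit_vec n i"
      using assoc_mult_mat_vec[OF WT W(1), of "unit_vec n i"] by (simp add: x_def W)
    have Px: "P *\<^sub>v x = x"
      using assoc_mult_mat_vec[OF W(1) WT x] by (simp add: W Wx) (simp add: x_def)
    have "P\<^sup>T = P" unfolding W(3)[symmetric] using W(1) by (simp add: transpose_mult[of W d n])
    have PA: "P * A \<in> carrier_mat d d" using P Ac by simp
    have D: "diagm n \<mu> * W\<^sup>T \<in> carrier_mat n d" by (rule mult_carrier_mat[OF diagm_carrier WT])
    have y: "diagm n \<mu> *\<^sub>v unit_vec n i \<in> carrier_vec n" by (rule mult_mat_vec_carrier[OF diagm_carrier]) simp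
    have "P * A * P *\<^sub>v x = P *\<^sub>v (A *\<^sub>v x)"
      by (simp only: assoc_mult_mat_vec[OF PA P x] assoc_mult_mat_vec[OF P Ac(1) x] Px)
    hence "x \<bullet> (A *\<^sub>v x) = x \<bullet> (P * A * P *\<^sub>v x)"
      using sym_scalar_prod[OF P \<open>P\<^sup>T = P\<close> x, of "A *\<^sub>v x"] Px Ac x by simp
    also have "P * A * P *\<^sub>v x = W *\<^sub>v (diagm n \<mu> *\<^sub>v unit_vec n i)"
      unfolding PAP assoc_mult_mat[OF W(1) diagm_carrier WT] assoc_mult_mat_vec[OF W(1) D x]
        assoc_mult_mat_vec[OF diagm_carrier WT x] Wx ..
    also have "x \<bullet> \<dots> = unit_vec n i \<bullet> (diagm n \<mu> *\<^sub>v unit_vec n i)"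
      using transpose_vec_mult_scalar[OF W(1) y x] by (simp add: Wx)
    also have "\<dots> = \<mu> i" using i by (simp add: diagm_mult_vec)
    finally have "x \<bullet> (A *\<^sub>v x) = \<mu> i" .
    moreover have "x \<noteq> 0\<^sub>v d"
    proof
      assume "x = 0\<^sub>v d"
      hence "unit_vec n i = W\<^sup>T *\<^sub>v 0\<^sub>v d" using Wx by simp
      also have "\<dots> = 0\<^sub>v n" using WT by (intro eq_vecI) auto
      finally have "unit_vec n i $ i = (0\<^sub>v n :: real vec) $ i" by simp
      thus False using i by simp
    qed
    ultimately show ?thesis using A x by (auto simp: sym_pos_def_def)
  qed
  show ?thesis by unfold_locales (use Ac W PAP n pos in auto)
qed

section \<open>Frames for the full matrix and for its deflation\<close>

lemma sym_pos_def_frame: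
  assumes A: "sym_pos_def d A" and d: "0 < d"
  obtains U f where "spectral_frame d d A (1\<^sub>m d) U f" "eigs A = rev (sort (map f [0..<d]))"
proof -
  have Ac: "A \<in> carrier_mat d d" "A\<^sup>T = A" using A by (auto simp: sym_pos_def_def)
  obtain U f where U: "U \<in> carrier_mat d d" "U\<^sup>T * U = 1\<^sub>m d" "A = U * diagm d f * U\<^sup>T"
    using spectral_theorem[OF Ac] by blast
  have "U * U\<^sup>T = 1\<^sub>m d"
    by (rule mat_mult_left_right_inverse[OF _ U(1) U(2)]) (use U in auto)
  moreover have "1\<^sub>m d * A * 1\<^sub>m d = U * diagm d f * U\<^sup>T" using Ac U by simp
  ultimately have "spectral_frame d d A (1\<^sub>m d) U f"
    using spectral_frame_posI[OF A U(1,2)] d by blast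
  thus ?thesis using that sorted_eigs_of_diag[OF U] by blast
qed

lemma sym_pos_def_rayleigh:
  assumes A: "sym_pos_def d A" and d: "0 < d"
  shows "0 < last (eigs A)" "x \<in> carrier_vec d \<Longrightarrow> last (eigs A) * (x \<bullet> x) \<le> x \<bullet> (A *\<^sub>v x)"
proof -
  obtain U f where fr: "spectral_frame d d A (1\<^sub>m d) U f" and e: "eigs A = rev (sort (map f [0..<d]))"
    using sym_pos_def_frame[OF A d] by blast
  interpret spectral_frame d d A "1\<^sub>m d" U f by (rule fr)
  show "0 < last (eigs A)" using eigs_extremes(3)[OF e d] mu_pos by auto
  assume x: "x \<in> carrier_vec d"
  have "last (eigs A) * (x \<bullet> x) = last (eigs A) * (x \<bullet> (conj_diag (\<lambda>_. 1) *\<^sub>v x))"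
    using x by (simp flip: P_eq)
  also have "\<dots> = (\<Sum>i<d. last (eigs A) * ((U\<^sup>T *\<^sub>v x) $ i)\<^sup>2)"
    unfolding conj_diag_quad[OF x] by (simp add: sum_distrib_left)
  also have "\<dots> \<le> (\<Sum>i<d. f i * ((U\<^sup>T *\<^sub>v x) $ i)\<^sup>2)"
    using eigs_extremes(1)[OF e d] by (intro sum_mono mult_right_mono) auto
  also have "\<dots> = x \<bullet> (conj_diag f *\<^sub>v x)" by (rule conj_diag_quad[OF x, symmetric])
  also have "conj_diag f = A" using A PAP_eq by (simp add: sym_pos_def_def)
  finally show "last (eigs A) * (x \<bullet> x) \<le> x \<bullet> (A *\<^sub>v x)" .
qed

lemma sum_lessThan_split:
  fixes f :: "nat \<Rightarrow> 'b :: comm_monoid_add"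
  assumes "m \<le> d"
  shows "(\<Sum>j = 0..<d. f j) = (\<Sum>j = 0..<m. f j) + (\<Sum>j = 0..<d - m. f (m + j))"
  using sum.atLeastLessThan_concat[of 0 m d f] sum.shift_bounds_nat_ivl[of f 0 m "d - m"] assms
  by (simp add: add.commute)

text \<open>\<open>Q\<close> and \<open>Qp\<close> side by side form a square matrix
  \<open>V\<close> with orthonormal columns, so its rows are orthonormal too; the entries of
  \<open>V * V\<^sup>T = 1\<^sub>m d\<close> split into the contributions of \<open>Q\<close> and
  \<open>Qp\<close>.\<close>

lemma orthonormal_complement:
  fixes Q Qp :: "real mat"
  assumes Q: "Q \<in> carrier_mat d m" "Q\<^sup>T * Q = 1\<^sub>m m"
    and Qp: "Qp \<in> carrier_mat d (d - m)" "Qp\<^sup>T * Qp = 1\<^sub>m (d - m)"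
    and orth: "Q\<^sup>T * Qp = 0\<^sub>m m (d - m)" and m: "m \<le> d"
  shows "perp_proj Q = Qp * Qp\<^sup>T"
proof -
  let ?n = "d - m"
  define V where "V = mat d d (\<lambda>(i, j). if j < m then Q $$ (i, j) else Qp $$ (i, j - m))"
  have V: "V \<in> carrier_mat d d" by (simp add: V_def)
  have q: "(\<Sum>k = 0..<d. Q $$ (k, i) * Q $$ (k, j)) = (if i = j then 1 else 0)" if "i < m" "j < m" for i j
    using arg_cong[OF Q(2), of "\<lambda>M. M $$ (i, j)"] that Q(1) by (simp add: scalar_prod_def)
  have qp: "(\<Sum>k = 0..<d. Qp $$ (k, i) * Qp $$ (k, j)) = (if i = j then 1 else 0)" if "i < ?n" "j < ?n" for i j
    using arg_cong[OF Qp(2), of "\<lambda>M. M $$ (i, j)"] that Qp(1) by (simp add: scalar_prod_def)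
  have o: "(\<Sum>k = 0..<d. Q $$ (k, i) * Qp $$ (k, j)) = 0" if "i < m" "j < ?n" for i j
    using arg_cong[OF orth, of "\<lambda>M. M $$ (i, j)"] that Qp(1) Q(1) by (simp add: scalar_prod_def)
  have "V\<^sup>T * V = 1\<^sub>m d"
  proof (rule eq_matI)
    fix i j assume "i < dim_row (1\<^sub>m d :: real mat)" "j < dim_col (1\<^sub>m d :: real mat)"
    hence ij: "i < d" "j < d" by auto
    have "(V\<^sup>T * V) $$ (i, j) = (\<Sum>k = 0..<d. V $$ (k, i) * V $$ (k, j))"
      using V ij by (simp add: scalar_prod_def)
    also have "\<dots> = (if i = j then 1 else 0)"
    proof (cases "i < m")
      case True
      show ?thesis
      proof (cases "j < m")
        case True
        thus ?thesis using q[OF \<open>i < m\<close> True] ij \<open>i < m\<close> by (simp add: V_def)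
      next
        case False
        thus ?thesis using o[OF \<open>i < m\<close>, of "j - m"] ij \<open>i < m\<close> by (simp add: V_def)
      qed
    next
      case False
      show ?thesis
      proof (cases "j < m")
        case True
        thus ?thesis using o[OF True, of "i - m"] ij False by (simp add: V_def mult.commute)
      next
        case j: False
        thus ?thesis using qp[of "i - m" "j - m"] ij False by (auto simp: V_def)
      qed
    qed
    finally show "(V\<^sup>T * V) $$ (i, j) = 1\<^sub>m d $$ (i, j)" using ij by simp
  qed (use V in auto)
  hence VVT: "V * V\<^sup>T = 1\<^sub>m d"
    by (intro mat_mult_left_right_inverse[OF _ V]) (use V in auto)
  show ?thesis
  proof (rule eq_matI)
    fix i j assume "i < dim_row (Qp * Qp\<^sup>T)" "j < dim_col (Qp * Qp\<^sup>T)"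
    hence ij: "i < d" "j < d" using Qp by auto
    have "1\<^sub>m d $$ (i, j) = (\<Sum>k = 0..<d. V $$ (i, k) * V $$ (j, k))"
      using V ij by (simp add: scalar_prod_def flip: VVT)
    also have "\<dots> = (\<Sum>k = 0..<m. Q $$ (i, k) * Q $$ (j, k)) + (\<Sum>k = 0..<?n. Qp $$ (i, k) * Qp $$ (j, k))"
      using ij m by (subst sum_lessThan_split[OF m]) (simp add: V_def)
    finally show "perp_proj Q $$ (i, j) = (Qp * Qp\<^sup>T) $$ (i, j)"
      using ij Q(1) Qp(1) by (simp add: perp_proj_def scalar_prod_def)
  qed (use Q Qp in \<open>auto simp: perp_proj_def\<close>)
qed

text \<open>If \<open>U\<close> diagonalises the small compression, \<open>W = Qp * U\<close>
  diagonalises \<open>P * A * P\<close> with the same \<open>\<mu>\<close>. Sharing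
  \<open>\<mu>\<close> is the point: the first frame serves the estimator, the second the trace of
  the inverse, and the last clause ties both to \<open>eigs\<close>.\<close>

lemma deflation_frame:
  assumes "lanczos_deflation d m A b Q Qp"
  obtains U W \<mu> where "spectral_frame d (d - m) A (perp_proj Q) W \<mu>"
    "spectral_frame (d - m) (d - m) (Qp\<^sup>T * A * Qp) (1\<^sub>m (d - m)) U \<mu>"
    "eigs (Qp\<^sup>T * A * Qp) = rev (sort (map \<mu> [0..<d - m]))"
proof -
  let ?n = "d - m" and ?T = "Qp\<^sup>T * A * Qp"
  from assms have spd: "sym_pos_def d A" and m: "m < d" and Qb: "Q = lanczos_basis A b m"
    and Q2: "Q\<^sup>T * Q = 1\<^sub>m m" and Qp: "Qp \<in> carrier_mat d ?n" "Qp\<^sup>T * Qp = 1\<^sub>m ?n"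
    and orth: "Q\<^sup>T * Qp = 0\<^sub>m m ?n"
    by (auto simp: lanczos_deflation_def)
  have A: "A \<in> carrier_mat d d" "A\<^sup>T = A" using spd by (auto simp: sym_pos_def_def)
  have Q: "Q \<in> carrier_mat d m" using A unfolding Qb lanczos_basis_def by (auto simp: mat_of_cols_def)
  have P: "perp_proj Q = Qp * Qp\<^sup>T"
    by (rule orthonormal_complement[OF Q Q2 Qp orth]) (use m in simp)
  have QpT: "Qp\<^sup>T \<in> carrier_mat ?n d" using Qp by simp
  have AQ: "A * Qp \<in> carrier_mat d ?n" using A Qp by simp
  have QA: "Qp\<^sup>T * A \<in> carrier_mat ?n d" using A QpT by simp
  have T: "?T \<in> carrier_mat ?n ?n" using A Qp by simp
  have Talt: "?T = Qp\<^sup>T * (A * Qp)" by (rule assoc_mult_mat[OF QpT A(1) Qp(1)])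
  have Tsym: "?T\<^sup>T = ?T"
  proof -
    have "?T\<^sup>T = (A * Qp)\<^sup>T * Qp" unfolding Talt by (simp add: transpose_mult[OF QpT AQ])
    also have "(A * Qp)\<^sup>T = Qp\<^sup>T * A" using A by (simp add: transpose_mult[OF A(1) Qp(1)])
    finally show ?thesis .
  qed
  from spectral_theorem[OF T Tsym] obtain U \<mu> where U: "U \<in> carrier_mat ?n ?n" "U\<^sup>T * U = 1\<^sub>m ?n"
    and TU: "?T = U * diagm ?n \<mu> * U\<^sup>T" by blast
  have UT: "U\<^sup>T \<in> carrier_mat ?n ?n" using U by simp
  have UUT: "U * U\<^sup>T = 1\<^sub>m ?n" by (rule mat_mult_left_right_inverse[OF UT U(1,2)])
  define W where "W = Qp * U"
  have W: "W \<in> carrier_mat d ?n" using Qp U by (simp add: W_def)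
  have WT: "W\<^sup>T = U\<^sup>T * Qp\<^sup>T" unfolding W_def by (rule transpose_mult[OF Qp(1) U(1)])
  have "Qp\<^sup>T * (Qp * U) = U"
    using assoc_mult_mat[OF QpT Qp(1) U(1)] U Qp by simp
  hence WTW: "W\<^sup>T * W = 1\<^sub>m ?n"
    unfolding WT unfolding W_def by (simp add: assoc_mult_mat[OF UT QpT mult_carrier_mat[OF Qp(1) U(1)]] U)
  have "U * (U\<^sup>T * Qp\<^sup>T) = Qp\<^sup>T"
    using assoc_mult_mat[OF U(1) UT QpT] UUT QpT by simp
  hence WWT: "W * W\<^sup>T = perp_proj Q"
    unfolding WT P unfolding W_def by (simp add: assoc_mult_mat[OF Qp(1) U(1) mult_carrier_mat[OF UT QpT]])
  have "perp_proj Q * A * perp_proj Q = Qp * ?T * Qp\<^sup>T"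
  proof -
    have "perp_proj Q * A * perp_proj Q = Qp * (Qp\<^sup>T * A) * (Qp * Qp\<^sup>T)"
      unfolding P by (simp only: assoc_mult_mat[OF Qp(1) QpT A(1)])
    also have "\<dots> = Qp * (Qp\<^sup>T * A * (Qp * Qp\<^sup>T))"
      by (rule assoc_mult_mat[OF Qp(1) QA mult_carrier_mat[OF Qp(1) QpT]])
    also have "Qp\<^sup>T * A * (Qp * Qp\<^sup>T) = ?T * Qp\<^sup>T"
      by (rule assoc_mult_mat[OF QA Qp(1) QpT, symmetric])
    also have "Qp * (?T * Qp\<^sup>T) = Qp * ?T * Qp\<^sup>T"
      by (rule assoc_mult_mat[OF Qp(1) T QpT, symmetric])
    finally show ?thesis .
  qed
  also have "\<dots> = W * diagm ?n \<mu> * W\<^sup>T"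
  proof -
    have D: "diagm ?n \<mu> * U\<^sup>T \<in> carrier_mat ?n ?n" by (rule mult_carrier_mat[OF diagm_carrier UT])
    have "W * diagm ?n \<mu> * W\<^sup>T = W * diagm ?n \<mu> * U\<^sup>T * Qp\<^sup>T"
      unfolding WT by (rule assoc_mult_mat[OF mult_carrier_mat[OF W diagm_carrier] UT QpT, symmetric])
    also have "W * diagm ?n \<mu> * U\<^sup>T = Qp * (U * (diagm ?n \<mu> * U\<^sup>T))"
      unfolding assoc_mult_mat[OF W diagm_carrier UT] unfolding W_def by (rule assoc_mult_mat[OF Qp(1) U(1) D])
    also have "U * (diagm ?n \<mu> * U\<^sup>T) = ?T"
      unfolding TU by (rule assoc_mult_mat[OF U(1) diagm_carrier UT, symmetric])
    finally show ?thesis by simp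
  qed
  finally have fr: "spectral_frame d ?n A (perp_proj Q) W \<mu>"
    using m by (intro spectral_frame_posI[OF spd W WTW WWT]) auto
  have "1\<^sub>m ?n * ?T * 1\<^sub>m ?n = U * diagm ?n \<mu> * U\<^sup>T"
    using T unfolding TU[symmetric] by (simp only: left_mult_one_mat right_mult_one_mat)
  hence "spectral_frame ?n ?n ?T (1\<^sub>m ?n) U \<mu>"
    using m U UUT T Tsym spectral_frame.mu_pos[OF fr] by unfold_locales auto
  thus ?thesis using that fr sorted_eigs_of_diag[OF U TU] by blast
qed

section \<open>Lanczos iteration and Gauss quadrature\<close>

declare lanczos_vec.simps [simp del] lanczos_res.simps [simp del]

lemma lanczos_steps_bounds:
  assumes l: "1 \<le> l"
  shows "1 \<le> lanczos_steps A P u l" "lanczos_steps A P u l \<le> l"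
    "lanczos_steps A P u l = l \<or> lanczos_beta A P u (lanczos_steps A P u l) = 0"
    "\<And>j. 1 \<le> j \<Longrightarrow> j < lanczos_steps A P u l \<Longrightarrow> lanczos_beta A P u j \<noteq> 0"
proof -
  let ?Q = "\<lambda>j. j = l \<or> (1 \<le> j \<and> lanczos_beta A P u j = 0)"
  have Q: "?Q (lanczos_steps A P u l)" unfolding lanczos_steps_def by (rule LeastI[of ?Q l]) simp
  show "1 \<le> lanczos_steps A P u l" "lanczos_steps A P u l = l \<or> lanczos_beta A P u (lanczos_steps A P u l) = 0"
    using Q l by auto
  show "lanczos_steps A P u l \<le> l" unfolding lanczos_steps_def by (rule Least_le) simp
  show "lanczos_beta A P u j \<noteq> 0" if "1 \<le> j" "j < lanczos_steps A P u l" for j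
    using not_less_Least[of j ?Q] that unfolding lanczos_steps_def by auto
qed

context spectral_frame
begin

text \<open>\<open>A\<close> need not preserve the range of \<open>P\<close>, but between two
  vectors fixed by \<open>P\<close> it may be replaced by \<open>P * A * P\<close>, which is
  diagonal in the frame.\<close>

lemma range_quad:
  assumes x: "x \<in> carrier_vec d" "P *\<^sub>v x = x" and y: "y \<in> carrier_vec d" "P *\<^sub>v y = y"
  shows "x \<bullet> (A *\<^sub>v y) = (\<Sum>i<n. \<mu> i * (W\<^sup>T *\<^sub>v x) $ i * (W\<^sup>T *\<^sub>v y) $ i)"
proof -
  have c: "W\<^sup>T *\<^sub>v x \<in> carrier_vec n" "W\<^sup>T *\<^sub>v y \<in> carrier_vec n" using WT x y by auto
  have Ay: "A *\<^sub>v y \<in> carrier_vec d" using A y by simp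
  have PA: "P * A \<in> carrier_mat d d" using P A by simp
  have "P * A * P *\<^sub>v y = P *\<^sub>v (A *\<^sub>v y)"
    by (simp only: assoc_mult_mat_vec[OF PA P y(1)] assoc_mult_mat_vec[OF P A y(1)] y)
  hence "x \<bullet> (A *\<^sub>v y) = x \<bullet> (conj_diag \<mu> *\<^sub>v y)"
    using sym_scalar_prod[OF P P_sym x(1) Ay] x PAP_eq by simp
  also have "\<dots> = (W *\<^sub>v (W\<^sup>T *\<^sub>v x)) \<bullet> (conj_diag \<mu> *\<^sub>v (W *\<^sub>v (W\<^sup>T *\<^sub>v y)))"
    using W_range x y by simp
  also have "\<dots> = (W\<^sup>T *\<^sub>v x) \<bullet> vec n (\<lambda>i. \<mu> i * (W\<^sup>T *\<^sub>v y) $ i)"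
    unfolding conj_diag_mult_vec[OF c(2)] using c by (simp add: W_inner)
  finally show ?thesis
    by (simp add: scalar_prod_def lessThan_atLeast0 mult_ac)
qed

lemma range_inner:
  assumes "x \<in> carrier_vec d" "P *\<^sub>v x = x" "y \<in> carrier_vec d" "P *\<^sub>v y = y"
  shows "x \<bullet> y = (\<Sum>i<n. (W\<^sup>T *\<^sub>v x) $ i * (W\<^sup>T *\<^sub>v y) $ i)"
proof -
  have c: "W\<^sup>T *\<^sub>v x \<in> carrier_vec n" "W\<^sup>T *\<^sub>v y \<in> carrier_vec n" using WT assms by auto
  have "x \<bullet> y = (W *\<^sub>v (W\<^sup>T *\<^sub>v x)) \<bullet> (W *\<^sub>v (W\<^sup>T *\<^sub>v y))" using W_range assms by simp
  also have "\<dots> = (W\<^sup>T *\<^sub>v x) \<bullet> (W\<^sup>T *\<^sub>v y)" by (rule W_inner[OF c])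
  finally show ?thesis using W by (simp add: scalar_prod_def lessThan_atLeast0)
qed

lemma range_quad_nonneg:
  assumes "x \<in> carrier_vec d" "P *\<^sub>v x = x"
  shows "0 \<le> x \<bullet> (A *\<^sub>v x)" "x \<bullet> (A *\<^sub>v x) = 0 \<Longrightarrow> x = 0\<^sub>v d"
proof -
  have nn: "0 \<le> \<mu> i * (W\<^sup>T *\<^sub>v x) $ i * (W\<^sup>T *\<^sub>v x) $ i" if "i \<in> {..<n}" for i
    using mu_pos[of i] that by (simp add: mult.assoc)
  show "0 \<le> x \<bullet> (A *\<^sub>v x)" unfolding range_quad[OF assms assms] by (rule sum_nonneg[OF nn])
  assume "x \<bullet> (A *\<^sub>v x) = 0"
  hence "\<forall>i\<in>{..<n}. \<mu> i * (W\<^sup>T *\<^sub>v x) $ i * (W\<^sup>T *\<^sub>v x) $ i = 0"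
    unfolding range_quad[OF assms assms] by (subst (asm) sum_nonneg_eq_0_iff) (use nn in auto)
  hence "(W\<^sup>T *\<^sub>v x) $ i = 0" if "i < n" for i using mu_pos[of i] that by force
  hence "W\<^sup>T *\<^sub>v x = 0\<^sub>v n" using WT by (intro eq_vecI) auto
  hence "x = W *\<^sub>v 0\<^sub>v n" using W_range[OF assms] by simp
  thus "x = 0\<^sub>v d" using W by (auto intro!: eq_vecI)
qed

end

section \<open>Lanczos vectors, tridiagonal matrix and Galerkin solution\<close>

locale lanczos_run = spectral_frame +
  fixes u :: "real vec" and l :: nat
  assumes u: "u \<in> carrier_vec d" "P *\<^sub>v u = u" "u \<bullet> u = 1" and l: "1 \<le> l"
begin

abbreviation "v \<equiv> lanczos_vec A P u"
abbreviation "\<beta> \<equiv> lanczos_beta A P u"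
abbreviation "\<alpha> \<equiv> lanczos_alpha A P u"
abbreviation "k \<equiv> lanczos_steps A P u l"
abbreviation "\<Theta> \<equiv> lanczos_tridiag A P u l"

lemmas k = lanczos_steps_bounds[OF l, where A = A and P = P and u = u]

lemma vec_res_range:
  "v j \<in> carrier_vec d \<and> P *\<^sub>v v j = v j" "lanczos_res A P u j \<in> carrier_vec d \<and> P *\<^sub>v lanczos_res A P u j = lanczos_res A P u j"
proof -
  have P0: "P *\<^sub>v 0\<^sub>v d = 0\<^sub>v d" using P by (auto intro!: eq_vecI)
  have dA: "dim_row A = d" using A by simp
  \<comment> \<open>Two consecutive vectors and a residual are carried together because the
    recursion reaches back to all of them.\<close>
  have "(v j \<in> carrier_vec d \<and> P *\<^sub>v v j = v j) \<and> (v (Suc j) \<in> carrier_vec d \<and> P *\<^sub>v v (Suc j) = v (Suc j)) \<and>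
    (lanczos_res A P u j \<in> carrier_vec d \<and> P *\<^sub>v lanczos_res A P u j = lanczos_res A P u j)"
  proof (induction j)
    case 0
    show ?case using u P0 dA by (simp add: lanczos_vec.simps lanczos_res.simps)
  next
    case (Suc j)
    let ?r = "lanczos_res A P u (Suc j)"
    have "A *\<^sub>v v (Suc j) - (v (Suc j) \<bullet> (A *\<^sub>v v (Suc j))) \<cdot>\<^sub>v v (Suc j) - vnorm (lanczos_res A P u j) \<cdot>\<^sub>v v j
      \<in> carrier_vec d"
      using Suc A by auto
    from P_mult_vec[OF this] have r: "?r \<in> carrier_vec d" "P *\<^sub>v ?r = ?r"
      by (simp_all only: lanczos_res.simps)
    hence "v (Suc (Suc j)) \<in> carrier_vec d \<and> P *\<^sub>v v (Suc (Suc j)) = v (Suc (Suc j))"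
      using P by (simp add: mult_mat_vec lanczos_vec.simps)
    with Suc r show ?case by blast
  qed
  thus "v j \<in> carrier_vec d \<and> P *\<^sub>v v j = v j" "lanczos_res A P u j \<in> carrier_vec d \<and> P *\<^sub>v lanczos_res A P u j = lanczos_res A P u j"
    by blast+
qed

lemma v_carrier [simp]: "v j \<in> carrier_vec d" and v_range [simp]: "P *\<^sub>v v j = v j"
  and res_carrier [simp]: "lanczos_res A P u j \<in> carrier_vec d"
  using vec_res_range by auto

lemma v_dim [simp]: "dim_vec (v j) = d"
  using v_carrier by (rule carrier_vecD)

lemma res_dim [simp]: "dim_vec (lanczos_res A P u j) = d"
  using res_carrier by (rule carrier_vecD)

lemma v_inner_smult: "v i \<bullet> (c \<cdot>\<^sub>v v j) = c * (v i \<bullet> v j)"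
  by (rule scalar_prod_smult_distrib) (rule v_carrier)+

lemma v0: "v 0 = 0\<^sub>v d" and v1: "v (Suc 0) = u" and beta0: "\<beta> 0 = 0"
  using A by (simp_all add: lanczos_beta_def vnorm_def lanczos_vec.simps lanczos_res.simps)

text \<open>Valid at breakdown as well: if the norm is 0, the residual is the zero vector, and so is
  the zero multiple on the right, whatever the next vector is.\<close>

lemma res_eq: "lanczos_res A P u (Suc j) = \<beta> (Suc j) \<cdot>\<^sub>v v (Suc (Suc j))"
proof (cases "\<beta> (Suc j) = 0")
  case True
  hence "lanczos_res A P u (Suc j) = 0\<^sub>v d"
    using vnorm_eq_0[OF res_carrier] by (simp add: lanczos_beta_def)
  moreover have "0 \<cdot>\<^sub>v v (Suc (Suc j)) = 0\<^sub>v d" using v_carrier[of "Suc (Suc j)"] by (auto intro!: eq_vecI simp del: v_carrier)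
  ultimately show ?thesis unfolding True by metis
next
  case False
  thus ?thesis unfolding lanczos_vec.simps(3)
    by (simp add: lanczos_beta_def smult_smult_assoc)
qed

text \<open>The re-projection acts only on \<open>A *\<^sub>v v (Suc j)\<close>, since the
  subtracted Lanczos vectors already lie in the range of \<open>P\<close>. This is the ordinary
  three-term recurrence for the compressed operator.\<close>

lemma recurrence:
  "P *\<^sub>v (A *\<^sub>v v (Suc j)) = \<beta> (Suc j) \<cdot>\<^sub>v v (Suc (Suc j)) + \<alpha> (Suc j) \<cdot>\<^sub>v v (Suc j) + \<beta> j \<cdot>\<^sub>v v j"
proof -
  have Av: "A *\<^sub>v v (Suc j) \<in> carrier_vec d" using A by simp
  have "\<beta> (Suc j) \<cdot>\<^sub>v v (Suc (Suc j)) = P *\<^sub>v (A *\<^sub>v v (Suc j) - \<alpha> (Suc j) \<cdot>\<^sub>v v (Suc j) - \<beta> j \<cdot>\<^sub>v v j)"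
    unfolding res_eq[symmetric] by (simp add: lanczos_alpha_def lanczos_beta_def lanczos_res.simps)
  also have "\<dots> = P *\<^sub>v (A *\<^sub>v v (Suc j)) - \<alpha> (Suc j) \<cdot>\<^sub>v v (Suc j) - \<beta> j \<cdot>\<^sub>v v j"
    using Av P by (simp add: mult_minus_distrib_mat_vec[of _ d d] mult_mat_vec[of _ d d])
  finally have e: "\<beta> (Suc j) \<cdot>\<^sub>v v (Suc (Suc j)) = P *\<^sub>v (A *\<^sub>v v (Suc j)) - \<alpha> (Suc j) \<cdot>\<^sub>v v (Suc j) - \<beta> j \<cdot>\<^sub>v v j" .
  have c: "v j \<in> carrier_vec d" "v (Suc j) \<in> carrier_vec d" "P *\<^sub>v (A *\<^sub>v v (Suc j)) \<in> carrier_vec d"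
    using P Av by auto
  show ?thesis unfolding e using c P by (intro eq_vecI) auto
qed

lemma A_inner: "v i \<bullet> (A *\<^sub>v v j) = v i \<bullet> (P *\<^sub>v (A *\<^sub>v v j))"
  using sym_scalar_prod[OF P P_sym v_carrier, of "A *\<^sub>v v j" i] A by simp

lemma A_inner_sym: "v i \<bullet> (A *\<^sub>v v j) = v j \<bullet> (A *\<^sub>v v i)"
  using sym_scalar_prod[OF A A_sym v_carrier v_carrier, of i j] A
  by (simp add: comm_scalar_prod[of "A *\<^sub>v v i" d "v j"])

lemma A_inner_recurrence:
  "v i \<bullet> (A *\<^sub>v v (Suc j)) = \<beta> (Suc j) * (v i \<bullet> v (Suc (Suc j))) + \<alpha> (Suc j) * (v i \<bullet> v (Suc j)) + \<beta> j * (v i \<bullet> v j)"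
  unfolding A_inner recurrence by (simp add: scalar_prod_add_distrib[of _ d] v_inner_smult)

text \<open>The bound \<open>j \<le> k\<close> guarantees that the norms divided by so far are
  nonzero. The clause \<open>a \<noteq> 0\<close> accounts for the auxiliary vector
  \<open>v 0\<close>, which is zero.\<close>

lemma orthonormal:
  "j \<le> k \<Longrightarrow> \<forall>a\<le>j. \<forall>b\<le>j. v a \<bullet> v b = (if a = b \<and> a \<noteq> 0 then 1 else 0)"
proof (induction j)
  case 0
  show ?case using v0 by simp
next
  case (Suc j)
  hence IH: "v a \<bullet> v b = (if a = b \<and> a \<noteq> 0 then 1 else 0)" if "a \<le> j" "b \<le> j" for a b
    using that by simp
  have comm: "v a \<bullet> v b = v b \<bullet> v a" for a b by (rule comm_scalar_prod[of _ d]) simp_all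
  have "v (Suc j) \<bullet> v (Suc j) = 1 \<and> (\<forall>a\<le>j. v a \<bullet> v (Suc j) = 0)"
  proof (cases j)
    case 0
    thus ?thesis using v0 v1 u by simp
  next
    case (Suc i)
    have b: "\<beta> j \<noteq> 0" using k(4)[of j] Suc Suc.prems by simp
    have 1: "v (Suc j) \<bullet> v (Suc j) = 1"
    proof -
      have "(\<beta> j)\<^sup>2 = lanczos_res A P u j \<bullet> lanczos_res A P u j"
        by (simp add: lanczos_beta_def vnorm_power2)
      also have "lanczos_res A P u j = \<beta> j \<cdot>\<^sub>v v (Suc j)" unfolding Suc by (rule res_eq)
      also have "(\<beta> j \<cdot>\<^sub>v v (Suc j)) \<bullet> (\<beta> j \<cdot>\<^sub>v v (Suc j)) = (\<beta> j)\<^sup>2 * (v (Suc j) \<bullet> v (Suc j))"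
        by (simp add: power2_eq_square)
      finally show ?thesis using b by simp
    qed
    have "v a \<bullet> v (Suc j) = 0" if a: "a \<le> j" for a
    proof (cases a)
      case 0
      thus ?thesis using v0 by simp
    next
      case (Suc a')
      have "\<beta> j * (v a \<bullet> v (Suc j)) = v a \<bullet> (A *\<^sub>v v j) - \<alpha> j * (v a \<bullet> v j) - \<beta> i * (v a \<bullet> v i)"
        using A_inner_recurrence[of a i] \<open>j = Suc i\<close> by simp
      also have "\<dots> = 0"
      proof -
        \<comment> \<open>For \<open>a = j\<close> the definition of \<open>\<alpha>\<close>
          cancels. Otherwise symmetry moves \<open>A\<close> onto \<open>v a\<close>, where the
          recurrence applies: for \<open>a = i\<close> the surviving term is
          \<open>\<beta> i\<close> and cancels, and for smaller \<open>a\<close> only vectors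
          orthogonal to \<open>v j\<close> occur.\<close>
        consider "a = j" | "a = i" "a \<noteq> j" | "a < i" using a \<open>j = Suc i\<close> by linarith
        thus ?thesis
        proof cases
          case 1
          have "\<alpha> j = v j \<bullet> (A *\<^sub>v v j)" by (simp add: lanczos_alpha_def)
          thus ?thesis using IH[of j j] IH[of j i] 1 \<open>j = Suc i\<close> by simp
        next
          case 2
          have "v a \<bullet> (A *\<^sub>v v j) = \<beta> a * (v j \<bullet> v j) + \<alpha> a * (v j \<bullet> v a) + \<beta> a' * (v j \<bullet> v a')"
            unfolding A_inner_sym[of a j] using A_inner_recurrence[of j a'] 2 \<open>j = Suc i\<close> Suc by simp
          thus ?thesis using IH[of j j] IH[of j a] IH[of j a'] IH[of a j] IH[of a i] 2 \<open>j = Suc i\<close> Suc by simp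
        next
          case 3
          have "v a \<bullet> (A *\<^sub>v v j) = \<beta> a * (v j \<bullet> v (Suc a)) + \<alpha> a * (v j \<bullet> v a) + \<beta> a' * (v j \<bullet> v a')"
            unfolding A_inner_sym[of a j] using A_inner_recurrence[of j a'] Suc by simp
          thus ?thesis using IH[of j "Suc a"] IH[of j a] IH[of j a'] IH[of a j] IH[of a i] 3 \<open>j = Suc i\<close> Suc by simp
        qed
      qed
      finally show ?thesis using b by simp
    qed
    with 1 show ?thesis by blast
  qed
  thus ?case using IH comm by (auto simp: le_Suc_eq)
qed

lemma ortho: "a \<le> k \<Longrightarrow> b \<le> k \<Longrightarrow> v a \<bullet> v b = (if a = b \<and> a \<noteq> 0 then 1 else 0)"
  using orthonormal[of k] by simp

text \<open>Identifies the tridiagonal matrix as the Rayleigh-Ritz compression of \<open>A\<close>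
  to the Lanczos vectors: away from the three diagonals, recurrence and orthogonality leave
  nothing.\<close>

lemma Theta_entry:
  assumes "i < k" "j < k"
  shows "\<Theta> $$ (i, j) = v (Suc i) \<bullet> (A *\<^sub>v v (Suc j))"
proof -
  have lt: "v (Suc a) \<bullet> (A *\<^sub>v v (Suc b)) = (if b = Suc a then \<beta> b else 0)" if "a < b" "b < k" for a b
    unfolding A_inner_sym[of "Suc a" "Suc b"] unfolding A_inner_recurrence
    using ortho[of "Suc b" "Suc (Suc a)"] ortho[of "Suc b" "Suc a"] ortho[of "Suc b" a] that by simp
  consider "i = j" | "i < j" | "j < i" by linarith
  thus ?thesis
  proof cases
    case 1
    thus ?thesis using assms by (simp add: lanczos_tridiag_def lanczos_alpha_def Let_def)
  next
    case 2
    thus ?thesis using assms lt[of i j] by (simp add: lanczos_tridiag_def Let_def)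
  next
    case 3
    thus ?thesis using assms lt[of j i] unfolding A_inner_sym[of "Suc i" "Suc j"]
      by (simp add: lanczos_tridiag_def Let_def)
  qed
qed

lemma Theta_carrier [simp]: "\<Theta> \<in> carrier_mat k k"
  by (simp add: lanczos_tridiag_def Let_def)

definition V :: "real mat" where "V = mat d k (\<lambda>(r, c). v (Suc c) $ r)"

lemma V [simp]: "V \<in> carrier_mat d k" by (simp add: V_def)
lemma VT [simp]: "V\<^sup>T \<in> carrier_mat k d" by (simp add: V_def)

lemma col_V: "c < k \<Longrightarrow> col V c = v (Suc c)"
  using v_carrier[of "Suc c"] by (intro eq_vecI) (auto simp: V_def simp del: v_carrier)

lemma VTV: "V\<^sup>T * V = 1\<^sub>m k"
proof (rule eq_matI)
  fix i j assume "i < dim_row (1\<^sub>m k :: real mat)" "j < dim_col (1\<^sub>m k :: real mat)"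
  hence ij: "i < k" "j < k" by auto
  have "(V\<^sup>T * V) $$ (i, j) = col V i \<bullet> col V j" using ij V by (simp del: V)
  thus "(V\<^sup>T * V) $$ (i, j) = 1\<^sub>m k $$ (i, j)"
    using ij ortho[of "Suc i" "Suc j"] by (simp add: col_V)
qed (auto simp: V_def)

lemma VT_mult: "x \<in> carrier_vec d \<Longrightarrow> V\<^sup>T *\<^sub>v x = vec k (\<lambda>i. v (Suc i) \<bullet> x)"
  using V by (intro eq_vecI) (auto simp: col_V simp del: V)

lemma V_range:
  assumes y: "y \<in> carrier_vec k"
  shows "V *\<^sub>v y \<in> carrier_vec d" "P *\<^sub>v (V *\<^sub>v y) = V *\<^sub>v y"
proof -
  show "V *\<^sub>v y \<in> carrier_vec d" by (rule mult_mat_vec_carrier[OF V y])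
  have "P * V = V"
  proof (rule eq_matI)
    fix i j assume ij: "i < dim_row V" "j < dim_col V"
    hence "(P * V) $$ (i, j) = (P *\<^sub>v v (Suc j)) $ i"
      using P carrier_matD[OF V] by (simp add: col_V del: v_range)
    also have "P *\<^sub>v v (Suc j) = v (Suc j)" by (rule v_range)
    finally show "(P * V) $$ (i, j) = V $$ (i, j)" using ij by (simp add: V_def)
  qed (use P in \<open>auto simp: V_def\<close>)
  thus "P *\<^sub>v (V *\<^sub>v y) = V *\<^sub>v y" using assoc_mult_mat_vec[OF P V y] by simp
qed

lemma VT_A_V: "y \<in> carrier_vec k \<Longrightarrow> V\<^sup>T *\<^sub>v (A *\<^sub>v (V *\<^sub>v y)) = \<Theta> *\<^sub>v y"
proof -
  assume y: "y \<in> carrier_vec k"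
  have AV: "A * V \<in> carrier_mat d k" using A by simp
  have "V\<^sup>T * (A * V) = \<Theta>"
  proof (rule eq_matI)
    fix i j assume "i < dim_row \<Theta>" "j < dim_col \<Theta>"
    hence ij: "i < k" "j < k" using carrier_matD[OF Theta_carrier] by auto
    have "(V\<^sup>T * (A * V)) $$ (i, j) = col V i \<bullet> col (A * V) j"
      using ij carrier_matD[OF V] carrier_matD[OF AV] by simp
    also have "col (A * V) j = A *\<^sub>v col V j" using ij A by (intro col_mult2[OF A V])
    finally show "(V\<^sup>T * (A * V)) $$ (i, j) = \<Theta> $$ (i, j)" using ij by (simp add: col_V Theta_entry)
  qed (use A carrier_matD[OF Theta_carrier] in \<open>auto simp: V_def\<close>)
  thus ?thesis
    using assoc_mult_mat_vec[OF VT AV y] assoc_mult_mat_vec[OF A V y] by simp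
qed

text \<open>A kernel vector \<open>y\<close> would give \<open>V *\<^sub>v y\<close> zero energy, so
  \<open>V *\<^sub>v y = 0\<^sub>v d\<close> by definiteness on the range of \<open>P\<close>, and
  \<open>y = 0\<^sub>v k\<close> since \<open>V\<close> has orthonormal columns. Thus
  \<open>minv\<close> really returns an inverse in the quadrature.\<close>

lemma Theta_det: "det \<Theta> \<noteq> 0"
proof
  assume "det \<Theta> = 0"
  then obtain y where y: "y \<in> carrier_vec k" "y \<noteq> 0\<^sub>v k" "\<Theta> *\<^sub>v y = 0\<^sub>v k"
    using det_0_iff_vec_prod_zero_field[OF Theta_carrier] by blast
  note x = V_range[OF y(1)]
  have "A *\<^sub>v (V *\<^sub>v y) \<in> carrier_vec d" using A x by simp
  from transpose_vec_mult_scalar[OF V y(1) this]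
  have "(V *\<^sub>v y) \<bullet> (A *\<^sub>v (V *\<^sub>v y)) = 0"
    using VT_A_V[OF y(1)] y \<open>A *\<^sub>v (V *\<^sub>v y) \<in> carrier_vec d\<close> x
    by (simp add: comm_scalar_prod[of "V *\<^sub>v y" d])
  hence "V *\<^sub>v y = 0\<^sub>v d" by (rule range_quad_nonneg(2)[OF x])
  moreover have "V\<^sup>T *\<^sub>v (V *\<^sub>v y) = y"
    using assoc_mult_mat_vec[OF VT V y(1)] y by (simp add: VTV)
  moreover have "V\<^sup>T *\<^sub>v 0\<^sub>v d = 0\<^sub>v k"
    unfolding VT_mult[OF zero_carrier_vec] by (intro eq_vecI) (auto simp: scalar_prod_right_zero[OF v_carrier])
  ultimately show False using y by simp
qed

text \<open>As \<open>u\<close> is the first Lanczos vector, its coordinates are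
  \<open>unit_vec k 0\<close>; so \<open>y_gal\<close> solves the Galerkin system for
  \<open>P * A * P\<close> with right-hand side \<open>u\<close>, and \<open>x_gal\<close> is the
  approximate solution it represents.\<close>

definition y_gal :: "real vec" where "y_gal = minv \<Theta> *\<^sub>v unit_vec k 0"
definition x_gal :: "real vec" where "x_gal = V *\<^sub>v y_gal"

lemma y_gal: "y_gal \<in> carrier_vec k" "\<Theta> *\<^sub>v y_gal = unit_vec k 0"
proof -
  note i = minv_inverse[OF Theta_carrier Theta_det]
  show "y_gal \<in> carrier_vec k" unfolding y_gal_def by (rule mult_mat_vec_carrier[OF i(3)]) simp
  show "\<Theta> *\<^sub>v y_gal = unit_vec k 0"
    using assoc_mult_mat_vec[OF Theta_carrier i(3), of "unit_vec k 0"] i by (simp add: y_gal_def)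
qed

lemma x_gal: "x_gal \<in> carrier_vec d" "P *\<^sub>v x_gal = x_gal"
  using V_range[OF y_gal(1)] by (simp_all add: x_gal_def)

lemma VT_u: "V\<^sup>T *\<^sub>v u = unit_vec k 0"
  unfolding VT_mult[OF u(1)] using ortho[of _ "Suc 0"] k(1) by (intro eq_vecI) (auto simp: v1)

lemma quad_eq_y: "lanczos_quad A P u l = y_gal $ 0"
  using k(1) y_gal(1) carrier_matD[OF Theta_carrier]
  by (simp add: lanczos_quad_def Let_def y_gal_def)

lemma quad_eq: "lanczos_quad A P u l = u \<bullet> x_gal"
proof -
  have "lanczos_quad A P u l = (V\<^sup>T *\<^sub>v u) \<bullet> y_gal"
    unfolding quad_eq_y VT_u using k(1) y_gal(1) by simp
  also have "\<dots> = u \<bullet> x_gal" unfolding x_gal_def by (rule transpose_vec_mult_scalar[OF V y_gal(1) u(1)])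
  finally show ?thesis .
qed

lemma galerkin:
  assumes y: "y \<in> carrier_vec k"
  shows "(V *\<^sub>v y) \<bullet> (A *\<^sub>v x_gal) = u \<bullet> (V *\<^sub>v y)"
proof -
  have Ax: "A *\<^sub>v x_gal \<in> carrier_vec d" using A x_gal by simp
  have "(V *\<^sub>v y) \<bullet> (A *\<^sub>v x_gal) = (V\<^sup>T *\<^sub>v (A *\<^sub>v x_gal)) \<bullet> y"
    using transpose_vec_mult_scalar[OF V y Ax] comm_scalar_prod[OF Ax V_range(1)[OF y]] by simp
  also have "\<dots> = (V\<^sup>T *\<^sub>v u) \<bullet> y"
    unfolding x_gal_def VT_A_V[OF y_gal(1)] y_gal(2) VT_u ..
  finally show ?thesis by (simp only: transpose_vec_mult_scalar[OF V y u(1)])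
qed

text \<open>By the Galerkin identity tested with \<open>x_gal\<close> itself, the quadrature value
  is the energy of \<open>x_gal\<close>. The strong law below relies on this sign.\<close>

lemma quad_nonneg: "0 \<le> lanczos_quad A P u l"
  using galerkin[OF y_gal(1)] range_quad_nonneg(1)[OF x_gal] by (simp add: quad_eq x_gal_def)

definition coord :: "real vec \<Rightarrow> nat \<Rightarrow> real" where "coord x i = (W\<^sup>T *\<^sub>v x) $ i"

lemma exact_quad: "u \<bullet> (pinv (P * A * P) *\<^sub>v u) = (\<Sum>i<n. (coord u i)\<^sup>2 / \<mu> i)"
  unfolding pinv_PAP conj_diag_quad[OF u(1)] by (simp add: coord_def)

lemma coord_norm: "(\<Sum>i<n. (coord u i)\<^sup>2) = 1"
  using range_inner[OF u(1,2) u(1,2)] u(3) by (simp add: coord_def power2_eq_square)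

text \<open>
  The energy error \<^term>\<open>u \<bullet> (pinv (P * A * P) *\<^sub>v u) - 2 * (u \<bullet> z) + z \<bullet> (A *\<^sub>v z)\<close> of an approximate
  solution \<^term>\<open>z\<close> is minimised over the Krylov space by the Galerkin solution \<^term>\<open>x_gal\<close>, where
  it is the quadrature error.
\<close>

lemma energy_coords:
  assumes z: "z \<in> carrier_vec d" "P *\<^sub>v z = z"
  shows "u \<bullet> (pinv (P * A * P) *\<^sub>v u) - 2 * (u \<bullet> z) + z \<bullet> (A *\<^sub>v z) =
    (\<Sum>i<n. (coord u i - \<mu> i * coord z i)\<^sup>2 / \<mu> i)"
proof -
  have "(\<Sum>i<n. (coord u i - \<mu> i * coord z i)\<^sup>2 / \<mu> i) =
    (\<Sum>i<n. (coord u i)\<^sup>2 / \<mu> i - 2 * (coord u i * coord z i) + \<mu> i * coord z i * coord z i)"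
    using mu_pos by (intro sum.cong) (auto simp: field_simps power2_eq_square less_imp_neq[symmetric])
  thus ?thesis
    unfolding exact_quad range_quad[OF z z] range_inner[OF u(1,2) z]
    by (simp add: coord_def sum.distrib sum_subtractf sum_distrib_left)
qed

text \<open>For \<open>x_gal\<close> the last two terms of the energy error combine to minus the
  quadrature value, and the energy error is a sum of squares with positive weights. So the Gauss
  rule never overestimates, and only an upper bound remains to be proved.\<close>

lemma quad_error_nonneg: "0 \<le> u \<bullet> (pinv (P * A * P) *\<^sub>v u) - lanczos_quad A P u l"
proof -
  have "u \<bullet> (pinv (P * A * P) *\<^sub>v u) - lanczos_quad A P u l =
      u \<bullet> (pinv (P * A * P) *\<^sub>v u) - 2 * (u \<bullet> x_gal) + x_gal \<bullet> (A *\<^sub>v x_gal)"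
    using galerkin[OF y_gal(1)] by (simp add: quad_eq flip: x_gal_def)
  also have "\<dots> \<ge> 0" unfolding energy_coords[OF x_gal] using mu_pos by (intro sum_nonneg) (auto simp: less_imp_le)
  finally show ?thesis .
qed

text \<open>Optimality of the Galerkin solution: expand the nonnegative energy of
  \<open>x_gal - z\<close>, where the mixed terms equal \<open>u \<bullet> z\<close> by the Galerkin
  identity and symmetry.\<close>

lemma quad_error_le_energy:
  assumes y: "y \<in> carrier_vec k" and z: "z = V *\<^sub>v y"
  shows "u \<bullet> (pinv (P * A * P) *\<^sub>v u) - lanczos_quad A P u l \<le> (\<Sum>i<n. (coord u i - \<mu> i * coord z i)\<^sup>2 / \<mu> i)"
proof -
  note zr = V_range[OF y, folded z]
  have Ac: "A *\<^sub>v x_gal \<in> carrier_vec d" "A *\<^sub>v z \<in> carrier_vec d" using A x_gal zr by auto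
  have zx: "z \<bullet> (A *\<^sub>v x_gal) = u \<bullet> z" and xx: "x_gal \<bullet> (A *\<^sub>v x_gal) = u \<bullet> x_gal"
    using galerkin[OF y] galerkin[OF y_gal(1)] by (simp_all add: z flip: x_gal_def)
  have "x_gal \<bullet> (A *\<^sub>v z) = u \<bullet> z"
    using sym_scalar_prod[OF A A_sym x_gal(1) zr(1)] comm_scalar_prod[OF Ac(1) zr(1)] zx by simp
  have dc: "x_gal - z \<in> carrier_vec d" "P *\<^sub>v (x_gal - z) = x_gal - z"
    using x_gal zr P by (auto simp: mult_minus_distrib_mat_vec)
  have "0 \<le> (x_gal - z) \<bullet> (A *\<^sub>v (x_gal - z))" by (rule range_quad_nonneg(1)[OF dc])
  also have "A *\<^sub>v (x_gal - z) = A *\<^sub>v x_gal - A *\<^sub>v z"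
    by (rule mult_minus_distrib_mat_vec[OF A x_gal(1) zr(1)])
  also have "(x_gal - z) \<bullet> (A *\<^sub>v x_gal - A *\<^sub>v z) = u \<bullet> x_gal - 2 * (u \<bullet> z) + z \<bullet> (A *\<^sub>v z)"
    using Ac x_gal zr zx xx \<open>x_gal \<bullet> (A *\<^sub>v z) = u \<bullet> z\<close>
    by (simp add: minus_scalar_prod_distrib[of _ d] scalar_prod_minus_distrib[of _ d])
  finally show ?thesis unfolding energy_coords[OF zr, symmetric] quad_eq by simp
qed

end

section \<open>Krylov space and polynomials in the compressed matrix\<close>

context lanczos_run
begin

definition krylov :: "nat \<Rightarrow> real vec \<Rightarrow> bool" where
  "krylov s x \<longleftrightarrow> (\<exists>y\<in>carrier_vec k. (\<forall>i<k. s \<le> i \<longrightarrow> y $ i = 0) \<and> x = V *\<^sub>v y)"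

lemma krylov_zero: "krylov 0 (0\<^sub>v d)"
  unfolding krylov_def by (intro bexI[of _ "0\<^sub>v k"]) (auto intro!: eq_vecI simp: V_def)

lemma krylov_add_smult_u:
  assumes "krylov (Suc s) x"
  shows "krylov (Suc s) (a \<cdot>\<^sub>v u + x)"
proof -
  obtain y where y: "y \<in> carrier_vec k" "\<forall>i<k. Suc s \<le> i \<longrightarrow> y $ i = 0" "x = V *\<^sub>v y"
    using assms by (auto simp: krylov_def)
  have "V *\<^sub>v unit_vec k 0 = u"
  proof (rule eq_vecI)
    fix i assume "i < dim_vec u"
    thus "(V *\<^sub>v unit_vec k 0) $ i = u $ i" using u k(1) v1 by (simp add: V_def)
  qed (use u in \<open>simp add: V_def\<close>)
  hence "a \<cdot>\<^sub>v u + x = V *\<^sub>v (a \<cdot>\<^sub>v unit_vec k 0 + y)"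
    using y(1,3) V by (simp add: mult_add_distrib_mat_vec[of _ d k] mult_mat_vec[of _ d k])
  thus ?thesis unfolding krylov_def using y(1,2)
    by (intro bexI[of _ "a \<cdot>\<^sub>v unit_vec k 0 + y"]) auto
qed

text \<open>The Lanczos relation in matrix form. By the recurrence, \<open>P * A * V\<close> and
  \<open>V * \<Theta>\<close> differ only in the last column (the matrix \<open>E\<close>), where
  the next residual is cut off.\<close>

lemma P_A_V:
  assumes y: "y \<in> carrier_vec k"
  shows "P *\<^sub>v (A *\<^sub>v (V *\<^sub>v y)) = V *\<^sub>v (\<Theta> *\<^sub>v y) + (y $ (k - 1)) \<cdot>\<^sub>v lanczos_res A P u k"
proof -
  define E where "E = mat d k (\<lambda>(r, j). if j = k - 1 then lanczos_res A P u k $ r else 0)"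
  have E: "E \<in> carrier_mat d k" by (simp add: E_def)
  have AV: "A * V \<in> carrier_mat d k" using A by simp
  have PAV: "P * (A * V) \<in> carrier_mat d k" using P AV by simp
  have VT': "V * \<Theta> \<in> carrier_mat d k" by (rule mult_carrier_mat[OF V Theta_carrier])
  have "P * (A * V) = V * \<Theta> + E"
  proof (rule eq_matI)
    fix r j assume "r < dim_row (V * \<Theta> + E)" "j < dim_col (V * \<Theta> + E)"
    hence rj: "r < d" "j < k" using E by auto
    have "(P * (A * V)) $$ (r, j) = col (P * (A * V)) j $ r"
      using rj carrier_matD[OF PAV] by simp
    also have "col (P * (A * V)) j = P *\<^sub>v (A *\<^sub>v v (Suc j))"
      using col_mult2[OF P AV rj(2)] col_mult2[OF A V rj(2)] rj by (simp add: col_V)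
    also have "\<dots> $ r = \<beta> (Suc j) * v (Suc (Suc j)) $ r + \<alpha> (Suc j) * v (Suc j) $ r + \<beta> j * v j $ r"
      unfolding recurrence using rj by simp
    finally have 1: "(P * (A * V)) $$ (r, j) =
      \<beta> (Suc j) * v (Suc (Suc j)) $ r + \<alpha> (Suc j) * v (Suc j) $ r + \<beta> j * v j $ r" .
    have "(V * \<Theta>) $$ (r, j) = (\<Sum>i = 0..<k. v (Suc i) $ r * \<Theta> $$ (i, j))"
      using rj carrier_matD[OF Theta_carrier] by (simp add: scalar_prod_def V_def)
    also have "\<dots> = (\<Sum>i = 0..<k. (if i = j then \<alpha> (Suc j) * v (Suc j) $ r else 0) +
        (if Suc i = j then \<beta> j * v j $ r else 0) +
        (if i = Suc j then \<beta> (Suc j) * v (Suc (Suc j)) $ r else 0))"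
      using rj by (intro sum.cong) (auto simp: lanczos_tridiag_def Let_def)
    also have "\<dots> = \<alpha> (Suc j) * v (Suc j) $ r + (\<Sum>i = 0..<k. if Suc i = j then \<beta> j * v j $ r else 0) +
        (if Suc j < k then \<beta> (Suc j) * v (Suc (Suc j)) $ r else 0)"
      using rj by (simp add: sum.distrib)
    also have "(\<Sum>i = 0..<k. if Suc i = j then \<beta> j * v j $ r else 0) = \<beta> j * v j $ r"
      using rj beta0 by (cases j) simp_all
    finally have 2: "(V * \<Theta>) $$ (r, j) = \<alpha> (Suc j) * v (Suc j) $ r + \<beta> j * v j $ r +
        (if Suc j < k then \<beta> (Suc j) * v (Suc (Suc j)) $ r else 0)" .
    have 3: "E $$ (r, j) = (if Suc j < k then 0 else \<beta> (Suc j) * v (Suc (Suc j)) $ r)"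
    proof (cases "Suc j < k")
      case False
      hence "Suc j = k" using rj by simp
      thus ?thesis using rj res_eq[of j] by (auto simp: E_def)
    qed (use rj in \<open>auto simp: E_def\<close>)
    have "(V * \<Theta> + E) $$ (r, j) = (V * \<Theta>) $$ (r, j) + E $$ (r, j)" using rj E by simp
    thus "(P * (A * V)) $$ (r, j) = (V * \<Theta> + E) $$ (r, j)" unfolding 1 2 3 by simp
  qed (use P E in \<open>auto simp: V_def\<close>)
  hence "P *\<^sub>v (A *\<^sub>v (V *\<^sub>v y)) = (V * \<Theta> + E) *\<^sub>v y"
    using assoc_mult_mat_vec[OF P AV y] assoc_mult_mat_vec[OF A V y] by simp
  also have "\<dots> = V *\<^sub>v (\<Theta> *\<^sub>v y) + E *\<^sub>v y"
    by (simp only: add_mult_distrib_mat_vec[OF VT' E y] assoc_mult_mat_vec[OF V Theta_carrier y])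
  also have "E *\<^sub>v y = (y $ (k - 1)) \<cdot>\<^sub>v lanczos_res A P u k"
  proof (rule eq_vecI)
    fix r assume "r < dim_vec ((y $ (k - 1)) \<cdot>\<^sub>v lanczos_res A P u k)"
    hence r: "r < d" by simp
    have "(E *\<^sub>v y) $ r = (\<Sum>j = 0..<k. (if j = k - 1 then lanczos_res A P u k $ r else 0) * y $ j)"
      using r y E unfolding E_def by (simp add: scalar_prod_def)
    also have "\<dots> = (\<Sum>j = 0..<k. if j = k - 1 then y $ (k - 1) * lanczos_res A P u k $ r else 0)"
      by (intro sum.cong) auto
    also have "\<dots> = y $ (k - 1) * lanczos_res A P u k $ r" using k(1) by simp
    finally show "(E *\<^sub>v y) $ r = ((y $ (k - 1)) \<cdot>\<^sub>v lanczos_res A P u k) $ r"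
      using r by simp
  qed (use E in auto)
  finally show ?thesis .
qed

text \<open>The remainder vanishes for one of two reasons. If \<open>k \<le> s\<close>, then
  \<open>k < l\<close>, so the run broke down and the residual is zero; otherwise
  \<open>s \<le> k - 1\<close> and the last coordinate of \<open>y\<close> is zero. After that,
  tridiagonality enlarges the support by at most one index.\<close>

lemma krylov_step:
  assumes s: "s < l" and x: "krylov s x"
  shows "krylov (Suc s) (P *\<^sub>v (A *\<^sub>v x))"
proof -
  obtain y where y: "y \<in> carrier_vec k" "\<forall>i<k. s \<le> i \<longrightarrow> y $ i = 0" "x = V *\<^sub>v y"
    using x by (auto simp: krylov_def)
  have "(y $ (k - 1)) \<cdot>\<^sub>v lanczos_res A P u k = 0\<^sub>v d"
  proof (cases "k \<le> s")
    case True
    hence "\<beta> k = 0" using k(3) s by auto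
    hence "lanczos_res A P u k = 0\<^sub>v d" using vnorm_eq_0[OF res_carrier] by (simp add: lanczos_beta_def)
    thus ?thesis by (auto intro!: eq_vecI)
  next
    case False
    hence "y $ (k - 1) = 0" using y(2) by simp
    moreover have "0 \<cdot>\<^sub>v lanczos_res A P u k = 0\<^sub>v d"
      by (auto intro!: eq_vecI)
    ultimately show ?thesis by metis
  qed
  moreover have Ty: "\<Theta> *\<^sub>v y \<in> carrier_vec k" by (rule mult_mat_vec_carrier[OF Theta_carrier y(1)])
  ultimately have e: "P *\<^sub>v (A *\<^sub>v x) = V *\<^sub>v (\<Theta> *\<^sub>v y)"
    using P_A_V[OF y(1)] y(3) V_range(1) by simp
  have "(\<Theta> *\<^sub>v y) $ i = 0" if i: "i < k" "Suc s \<le> i" for i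
  proof -
    have "(\<Theta> *\<^sub>v y) $ i = (\<Sum>j = 0..<k. \<Theta> $$ (i, j) * y $ j)"
      using i y(1) carrier_matD[OF Theta_carrier] by (auto simp: scalar_prod_def)
    also have "\<dots> = 0"
    proof (rule sum.neutral, rule ballI)
      fix j assume "j \<in> {0..<k}"
      thus "\<Theta> $$ (i, j) * y $ j = 0" using i y(2)
        by (cases "s \<le> j") (auto simp: lanczos_tridiag_def Let_def)
    qed
    finally show ?thesis .
  qed
  thus ?thesis unfolding krylov_def e using Ty by blast
qed

lemma coord_vec: "vec n (coord u) = W\<^sup>T *\<^sub>v u"
  using WT by (intro eq_vecI) (auto simp: coord_def)

text \<open>Induction in Horner form, \<open>q = a + X q'\<close>. The degree bound is written
  through vanishing coefficients so that \<open>s = 0\<close> means \<open>q = 0\<close>.\<close>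

lemma krylov_poly:
  "s \<le> l \<Longrightarrow> \<forall>i\<ge>s. coeff q i = 0 \<Longrightarrow> krylov s (W *\<^sub>v vec n (\<lambda>i. poly q (\<mu> i) * coord u i))"
proof (induction s arbitrary: q)
  case 0
  hence "q = 0" by (intro poly_eqI) simp
  moreover have "W *\<^sub>v vec n (\<lambda>i. 0) = 0\<^sub>v d" using W by (auto intro!: eq_vecI simp: scalar_prod_def)
  ultimately show ?case using krylov_zero by simp
next
  case (Suc s)
  obtain a q' where q: "q = pCons a q'" by (cases q)
  have "\<forall>i\<ge>s. coeff q' i = 0"
  proof (intro allI impI)
    fix i assume "s \<le> i"
    thus "coeff q' i = 0" using Suc.prems(2)[rule_format, of "Suc i"] q by simp
  qed
  define c where "c = vec n (\<lambda>i. poly q' (\<mu> i) * coord u i)"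
  have c: "c \<in> carrier_vec n" by (simp add: c_def)
  have "krylov s (W *\<^sub>v c)" unfolding c_def using Suc \<open>\<forall>i\<ge>s. coeff q' i = 0\<close> by simp
  from krylov_step[OF _ this] have "krylov (Suc s) (P *\<^sub>v (A *\<^sub>v (W *\<^sub>v c)))" using Suc.prems by simp
  hence kr: "krylov (Suc s) (a \<cdot>\<^sub>v u + P *\<^sub>v (A *\<^sub>v (W *\<^sub>v c)))" by (rule krylov_add_smult_u)
  have Wc: "W *\<^sub>v c \<in> carrier_vec d" using W c by simp
  have "P *\<^sub>v (W *\<^sub>v c) = W *\<^sub>v vec n (\<lambda>i. 1 * c $ i)"
    unfolding P_eq by (rule conj_diag_mult_vec[OF c])
  also have "vec n (\<lambda>i. 1 * c $ i) = c" using c by (intro eq_vecI) auto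
  finally have Pc: "P *\<^sub>v (W *\<^sub>v c) = W *\<^sub>v c" .
  have PA: "P * A \<in> carrier_mat d d" using P A by simp
  have "P *\<^sub>v (A *\<^sub>v (W *\<^sub>v c)) = P * A * P *\<^sub>v (W *\<^sub>v c)"
    by (simp only: assoc_mult_mat_vec[OF PA P Wc] assoc_mult_mat_vec[OF P A Wc] Pc)
  also have "\<dots> = W *\<^sub>v vec n (\<lambda>i. \<mu> i * c $ i)" unfolding PAP_eq by (rule conj_diag_mult_vec[OF c])
  finally have 1: "P *\<^sub>v (A *\<^sub>v (W *\<^sub>v c)) = W *\<^sub>v vec n (\<lambda>i. \<mu> i * c $ i)" .
  have "u = W *\<^sub>v vec n (coord u)" unfolding coord_vec using W_range[OF u(1,2)] by simp
  hence "a \<cdot>\<^sub>v u + P *\<^sub>v (A *\<^sub>v (W *\<^sub>v c)) = W *\<^sub>v (a \<cdot>\<^sub>v vec n (coord u) + vec n (\<lambda>i. \<mu> i * c $ i))"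
    unfolding 1 using W by (simp add: mult_add_distrib_mat_vec[of _ d n] mult_mat_vec[of _ d n])
  also have "a \<cdot>\<^sub>v vec n (coord u) + vec n (\<lambda>i. \<mu> i * c $ i) = vec n (\<lambda>i. poly q (\<mu> i) * coord u i)"
    by (intro eq_vecI) (auto simp: q c_def algebra_simps)
  finally show ?case using kr by simp
qed

text \<open>A polynomial with value 1 at the origin is the residual polynomial of a Krylov
  approximation. The energy error is then the average of
  \<open>(poly p (\<mu> i))\<^sup>2 / \<mu> i\<close> with weights
  \<open>(coord u i)\<^sup>2\<close>, which sum to 1.\<close>

lemma quad_error_poly:
  assumes deg: "degree p \<le> l" and p0: "poly p 0 = 1"
    and small: "\<And>i. i < n \<Longrightarrow> \<bar>poly p (\<mu> i)\<bar> \<le> \<delta>" and low: "\<And>i. i < n \<Longrightarrow> a \<le> \<mu> i" and a: "0 < a"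
  shows "\<bar>u \<bullet> (pinv (P * A * P) *\<^sub>v u) - lanczos_quad A P u l\<bar> \<le> \<delta>\<^sup>2 / a"
proof -
  obtain b p' where p: "p = pCons b p'" by (cases p)
  have b: "b = 1" using p0 p by simp
  have "\<forall>i\<ge>l. coeff (- p') i = 0"
  proof (intro allI impI)
    fix i assume "l \<le> i"
    hence "coeff p (Suc i) = 0" using deg by (intro coeff_eq_0) simp
    thus "coeff (- p') i = 0" by (simp add: p)
  qed
  \<comment> \<open>Writing p = 1 + X p', the candidate \<open>z\<close> applies - p' to
    \<open>u\<close>; its residual coordinate \<open>coord u i - \<mu> i * coord z i\<close> is then
    \<open>poly p (\<mu> i) * coord u i\<close>.\<close>
  from krylov_poly[OF order_refl this]
  obtain y z where y: "y \<in> carrier_vec k" and zV: "z = V *\<^sub>v y"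
    and z: "z = W *\<^sub>v vec n (\<lambda>i. poly (- p') (\<mu> i) * coord u i)"
    by (auto simp: krylov_def)
  have cz: "coord z i = poly (- p') (\<mu> i) * coord u i" if "i < n" for i
    using that by (simp add: coord_def z W_coords)
  have "u \<bullet> (pinv (P * A * P) *\<^sub>v u) - lanczos_quad A P u l \<le> (\<Sum>i<n. (coord u i - \<mu> i * coord z i)\<^sup>2 / \<mu> i)"
    by (rule quad_error_le_energy[OF y zV])
  also have "\<dots> = (\<Sum>i<n. (coord u i)\<^sup>2 * ((poly p (\<mu> i))\<^sup>2 / \<mu> i))"
    using b by (intro sum.cong) (auto simp: cz p power2_eq_square algebra_simps)
  also have "\<dots> \<le> (\<Sum>i<n. (coord u i)\<^sup>2 * (\<delta>\<^sup>2 / a))"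
  proof (intro sum_mono mult_left_mono)
    fix i assume "i \<in> {..<n}"
    hence i: "i < n" by simp
    have "(poly p (\<mu> i))\<^sup>2 \<le> \<delta>\<^sup>2" using power_mono[OF small[OF i], of 2] by simp
    thus "(poly p (\<mu> i))\<^sup>2 / \<mu> i \<le> \<delta>\<^sup>2 / a" using low[OF i] a by (intro frac_le) auto
  qed simp
  also have "\<dots> = \<delta>\<^sup>2 / a" unfolding sum_distrib_right[symmetric] coord_norm by simp
  finally show ?thesis using quad_error_nonneg by simp
qed

end

section \<open>Chebyshev polynomials and the convergence rate\<close>

fun chebyshev :: "nat \<Rightarrow> real poly" where
  "chebyshev 0 = 1"
| "chebyshev (Suc 0) = [:0, 1:]"
| "chebyshev (Suc (Suc n)) = [:0, 2:] * chebyshev (Suc n) - chebyshev n"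

lemma degree_chebyshev: "degree (chebyshev n) \<le> n"
proof (induction n rule: chebyshev.induct)
  case (3 n)
  have "degree ([:0, 2:] * chebyshev (Suc n)) \<le> Suc (Suc n)"
    using degree_mult_le[of "[:0, 2:]" "chebyshev (Suc n)"] 3 by simp
  thus ?case using 3 by (auto intro: degree_diff_le)
qed simp_all

lemma chebyshev_cos: "poly (chebyshev n) (cos t) = cos (real n * t)"
proof (induction n rule: chebyshev.induct)
  case (3 n)
  have "real (Suc (Suc n)) * t = real (Suc n) * t + t" "real n * t = real (Suc n) * t - t"
    by (simp_all add: algebra_simps)
  hence "cos (real (Suc (Suc n)) * t) + cos (real n * t) = 2 * cos t * cos (real (Suc n) * t)"
    by (simp only: cos_add cos_diff) (simp add: algebra_simps)
  thus ?case using 3 by simp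
qed simp_all

lemma chebyshev_bounded:
  assumes "\<bar>x\<bar> \<le> 1"
  shows "\<bar>poly (chebyshev n) x\<bar> \<le> 1"
  using chebyshev_cos[of n "arccos x"] assms by (simp add: cos_arccos_abs abs_cos_le_one)

text \<open>Evaluation outside the interval [-1, 1], the counterpart of the cosine formula: both
  \<open>r ^ n\<close> and \<open>1 / r ^ n\<close> satisfy the Chebyshev recurrence at the point
  \<open>(r + 1 / r) / 2\<close>.\<close>

lemma chebyshev_joukowski:
  assumes "r \<noteq> 0"
  shows "poly (chebyshev n) ((r + 1 / r) / 2) = (r ^ n + 1 / r ^ n) / 2"
proof (induction n rule: chebyshev.induct)
  case (3 n)
  have rec: "poly (chebyshev (Suc (Suc n))) ((r + 1 / r) / 2) = (r + 1 / r) * poly (chebyshev (Suc n)) ((r + 1 / r) / 2)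
      - poly (chebyshev n) ((r + 1 / r) / 2)"
    by simp
  show ?case unfolding rec 3 using assms by (simp add: field_simps)
qed simp_all

text \<open>The residual polynomial is a Chebyshev polynomial transplanted to the interval between
  the extreme eigenvalues and normalised at 0. \<open>T\<close> enters only through its list of
  eigenvalues.\<close>

lemma (in lanczos_run) quad_error_rate:
  assumes e: "eigs T = rev (sort (map \<mu> [0..<n]))"
  shows "\<bar>u \<bullet> (pinv (P * A * P) *\<^sub>v u) - lanczos_quad A P u l\<bar>
    \<le> 4 / last (eigs T) * lanczos_rate T powi (- 2 * int l)"
proof -
  define a where "a = last (eigs T)"
  define b where "b = hd (eigs T)"
  note ext = eigs_extremes[OF e n_pos, folded a_def b_def]
  have a: "0 < a" using ext(3) mu_pos by auto
  have "a \<le> b" using ext(1,2)[of 0] n_pos by linarith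
  show ?thesis
  proof (cases "a = b")
    case True
    \<comment> \<open>The condition number is 1, and division by zero makes the rate 0. A nonzero
      power of it is 0, so here the quadrature has to be exact.\<close>
    have rate: "lanczos_rate T = 0"
      using True a by (simp add: lanczos_rate_def cond_number_def flip: a_def b_def)
    have mu: "\<mu> i = a" if "i < n" for i using ext(1,2)[OF that] True by simp
    \<comment> \<open>1 - x / a vanishes at the only eigenvalue and has degree 1, which
      \<open>1 \<le> l\<close> allows.\<close>
    have "\<bar>u \<bullet> (pinv (P * A * P) *\<^sub>v u) - lanczos_quad A P u l\<bar> \<le> 0\<^sup>2 / a"
      by (rule quad_error_poly[where p = "[:1, - 1 / a:]"]) (use a l mu in auto)
    thus ?thesis using l by (simp add: rate power_int_0_left_if)
  next
    case False
    with \<open>a \<le> b\<close> have ab: "a < b" by simp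
    define s where "s = sqrt (b / a)"
    define \<rho> where "\<rho> = (s + 1) / (s - 1)"
    have s: "1 < s" using a ab by (simp add: s_def)
    have s2: "b = s\<^sup>2 * a" using a ab by (simp add: s_def)
    have rate: "lanczos_rate T = \<rho>"
      by (simp add: lanczos_rate_def cond_number_def \<rho>_def s_def flip: a_def b_def)
    have rho: "1 < \<rho>" using s by (simp add: \<rho>_def)
    have s21: "s\<^sup>2 - 1 = (s - 1) * (s + 1)" by (simp add: power2_eq_square algebra_simps)
    have "(b + a) / (b - a) = (s\<^sup>2 + 1) / (s\<^sup>2 - 1)"
    proof -
      have "b + a = (s\<^sup>2 + 1) * a" "b - a = (s\<^sup>2 - 1) * a" by (simp_all add: s2 algebra_simps)
      thus ?thesis using a by simp
    qed
    also have "\<dots> = (\<rho> + 1 / \<rho>) / 2"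
    proof -
      have "s - 1 \<noteq> 0" "s + 1 \<noteq> 0" using s by auto
      hence "\<rho> + 1 / \<rho> = ((s + 1) * (s + 1) + (s - 1) * (s - 1)) / ((s - 1) * (s + 1))"
        unfolding \<rho>_def by (simp add: add_frac_eq)
      also have "(s + 1) * (s + 1) + (s - 1) * (s - 1) = 2 * (s\<^sup>2 + 1)"
        by (simp add: power2_eq_square algebra_simps)
      also have "2 * (s\<^sup>2 + 1) / ((s - 1) * (s + 1)) = 2 * ((s\<^sup>2 + 1) / ((s - 1) * (s + 1)))"
        by (rule times_divide_eq_right[symmetric])
      finally show ?thesis unfolding s21 by (simp only: nonzero_mult_div_cancel_left zero_neq_numeral not_False_eq_True)
    qed
    finally have y0: "(b + a) / (b - a) = (\<rho> + 1 / \<rho>) / 2" .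
    define \<tau> where "\<tau> = (\<rho> ^ l + 1 / \<rho> ^ l) / 2"
    have tau: "\<rho> ^ l / 2 \<le> \<tau>" and tau0: "0 < \<tau>" using rho by (simp_all add: \<tau>_def add_pos_pos)
    \<comment> \<open>The affine map takes \<open>a\<close> to 1, \<open>b\<close> to -1 and 0 to
      \<open>(b + a) / (b - a)\<close>, that is, to \<open>(\<rho> + 1 / \<rho>) / 2\<close>; there
      the Chebyshev polynomial has the value \<open>\<tau>\<close>, which is divided out.\<close>
    define p where "p = Polynomial.smult (1 / \<tau>) (pcompose (chebyshev l) [:(b + a) / (b - a), - 2 / (b - a):])"
    have "\<bar>u \<bullet> (pinv (P * A * P) *\<^sub>v u) - lanczos_quad A P u l\<bar> \<le> (2 / \<rho> ^ l)\<^sup>2 / a"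
    proof (rule quad_error_poly[where p = p])
      show "degree p \<le> l"
        using degree_chebyshev[of l] tau0 ab by (simp add: p_def degree_pcompose)
      show "poly p 0 = 1"
      proof -
        have "poly (chebyshev l) ((b + a) / (b - a)) = \<tau>" unfolding y0 \<tau>_def using rho by (intro chebyshev_joukowski) simp
        thus ?thesis using tau0 by (simp add: p_def poly_pcompose)
      qed
      fix i assume i: "i < n"
      have "\<bar>(b + a) / (b - a) - 2 / (b - a) * \<mu> i\<bar> \<le> 1"
      proof -
        have "(b + a) / (b - a) - 2 / (b - a) * \<mu> i = (b + a - 2 * \<mu> i) / (b - a)"
          by (simp add: diff_divide_distrib)
        thus ?thesis using ext(1,2)[OF i] ab by (simp add: abs_le_iff divide_le_eq le_divide_eq)
      qed
      from chebyshev_bounded[OF this, of l] have "\<bar>poly p (\<mu> i)\<bar> \<le> 1 / \<tau>"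
        using tau0 by (simp add: p_def poly_pcompose abs_mult divide_right_mono mult.commute)
      also have "\<dots> \<le> 1 / (\<rho> ^ l / 2)" using tau tau0 rho by (intro divide_left_mono) auto
      finally show "\<bar>poly p (\<mu> i)\<bar> \<le> 2 / \<rho> ^ l" by simp
    qed (use ext a in auto)
    also have "\<dots> = 4 / a * \<rho> powi (- 2 * int l)"
      using rho by (simp add: power_int_def power_divide power_mult nat_mult_distrib field_simps flip: power_mult)
    finally show ?thesis unfolding rate a_def .
  qed
qed

section \<open>Measurability of the samples\<close>

text \<open>Componentwise measurability in one fixed dimension, so that no sigma-algebra has to be
  chosen on \<open>real vec\<close>, a type containing vectors of all dimensions.\<close>

definition measurable_vec :: "'x measure \<Rightarrow> nat \<Rightarrow> ('x \<Rightarrow> real vec) \<Rightarrow> bool" where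
  "measurable_vec N d g \<longleftrightarrow> (\<forall>x. g x \<in> carrier_vec d) \<and> (\<forall>i<d. (\<lambda>x. g x $ i) \<in> borel_measurable N)"

lemma measurable_vecD:
  assumes "measurable_vec N d g"
  shows "g x \<in> carrier_vec d" "dim_vec (g x) = d" "i < d \<Longrightarrow> (\<lambda>x. g x $ i) \<in> borel_measurable N"
  using assms carrier_vecD by (auto simp: measurable_vec_def)

lemma measurable_vec_diff:
  assumes "measurable_vec N d g" "measurable_vec N d h"
  shows "measurable_vec N d (\<lambda>x. g x - h x)"
proof -
  have "(\<lambda>x. (g x - h x) $ i) = (\<lambda>x. g x $ i - h x $ i)" if "i < d" for i
    using assms that by (intro ext index_minus_vec) (simp add: measurable_vecD)
  thus ?thesis using assms by (auto simp: measurable_vec_def intro!: borel_measurable_diff)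
qed

lemma measurable_vec_smult:
  assumes "c \<in> borel_measurable N" "measurable_vec N d g"
  shows "measurable_vec N d (\<lambda>x. c x \<cdot>\<^sub>v g x)"
proof -
  have "(\<lambda>x. (c x \<cdot>\<^sub>v g x) $ i) = (\<lambda>x. c x * g x $ i)" if "i < d" for i
    using assms that by (intro ext index_smult_vec) (simp add: measurable_vecD)
  thus ?thesis using assms by (auto simp: measurable_vec_def intro!: borel_measurable_times)
qed

lemma measurable_vec_mat:
  assumes B: "B \<in> carrier_mat d d" and g: "measurable_vec N d g"
  shows "measurable_vec N d (\<lambda>x. B *\<^sub>v g x)"
proof -
  have gc: "g x \<in> carrier_vec d" for x using g by (simp add: measurable_vec_def)
  have "(B *\<^sub>v g x) $ i = (\<Sum>j = 0..<d. B $$ (i, j) * g x $ j)" if "i < d" for i x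
    using B that gc[of x] by (auto simp: scalar_prod_def intro!: sum.cong)
  hence "(\<lambda>x. (B *\<^sub>v g x) $ i) = (\<lambda>x. \<Sum>j = 0..<d. B $$ (i, j) * g x $ j)" if "i < d" for i
    using that by blast
  moreover have "(\<lambda>x. \<Sum>j = 0..<d. B $$ (i, j) * g x $ j) \<in> borel_measurable N" for i
    using g by (auto simp: measurable_vec_def intro!: borel_measurable_sum borel_measurable_times)
  moreover have "B *\<^sub>v g x \<in> carrier_vec d" for x by (rule mult_mat_vec_carrier[OF B gc])
  ultimately show ?thesis unfolding measurable_vec_def by (auto simp del: index_mult_mat_vec)
qed

lemma measurable_scalar_prod:
  assumes "measurable_vec N d g" "measurable_vec N d h"
  shows "(\<lambda>x. g x \<bullet> h x) \<in> borel_measurable N"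
proof -
  have "(\<lambda>x. g x \<bullet> h x) = (\<lambda>x. \<Sum>j = 0..<d. g x $ j * h x $ j)"
    using assms by (intro ext) (simp add: measurable_vecD scalar_prod_def)
  thus ?thesis using assms by (auto simp: measurable_vec_def intro!: borel_measurable_sum borel_measurable_times)
qed

lemma measurable_vnorm:
  assumes "measurable_vec N d g"
  shows "(\<lambda>x. vnorm (g x)) \<in> borel_measurable N"
  unfolding vnorm_def using measurable_scalar_prod[OF assms assms] by measurable

text \<open>The same joint induction as for membership in the range. Breakdown needs no case
  distinction, since total real division is measurable also where the norm is 0.\<close>

lemma measurable_lanczos_vec:
  assumes A: "A \<in> carrier_mat d d" and P: "P \<in> carrier_mat d d" and g: "measurable_vec N d g"
  shows "measurable_vec N d (\<lambda>x. lanczos_vec A P (g x) j)" "measurable_vec N d (\<lambda>x. lanczos_res A P (g x) j)"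
proof -
  have "measurable_vec N d (\<lambda>x. lanczos_vec A P (g x) j) \<and> measurable_vec N d (\<lambda>x. lanczos_vec A P (g x) (Suc j))
    \<and> measurable_vec N d (\<lambda>x. lanczos_res A P (g x) j)"
  proof (induction j)
    case 0
    show ?case using A g by (simp add: lanczos_vec.simps lanczos_res.simps measurable_vec_def)
  next
    case (Suc j)
    have "measurable_vec N d (\<lambda>x. lanczos_res A P (g x) (Suc j))"
      unfolding lanczos_res.simps using Suc
      by (intro measurable_vec_mat[OF P] measurable_vec_mat[OF A] measurable_vec_diff measurable_vec_smult
          measurable_scalar_prod[of N d] measurable_vnorm[of N d]) auto
    moreover from this have "measurable_vec N d (\<lambda>x. lanczos_vec A P (g x) (Suc (Suc j)))"
      unfolding lanczos_vec.simps(3)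
      by (intro measurable_vec_smult borel_measurable_divide borel_measurable_const measurable_vnorm)
    ultimately show ?case using Suc by blast
  qed
  thus "measurable_vec N d (\<lambda>x. lanczos_vec A P (g x) j)" "measurable_vec N d (\<lambda>x. lanczos_res A P (g x) j)"
    by blast+
qed

lemma measurable_lanczos_coeffs:
  assumes A: "A \<in> carrier_mat d d" and P: "P \<in> carrier_mat d d" and g: "measurable_vec N d g"
  shows "(\<lambda>x. lanczos_alpha A P (g x) j) \<in> borel_measurable N"
    "(\<lambda>x. lanczos_beta A P (g x) j) \<in> borel_measurable N"
    "(\<lambda>x. lanczos_steps A P (g x) l) \<in> measurable N (count_space UNIV)"
proof -
  note m = measurable_lanczos_vec[OF A P g]
  show "(\<lambda>x. lanczos_alpha A P (g x) j) \<in> borel_measurable N" for j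
    unfolding lanczos_alpha_def by (rule measurable_scalar_prod[OF m(1) measurable_vec_mat[OF A m(1)]])
  show b [measurable]: "(\<lambda>x. lanczos_beta A P (g x) j) \<in> borel_measurable N" for j
    unfolding lanczos_beta_def by (rule measurable_vnorm[OF m(2)])
  show "(\<lambda>x. lanczos_steps A P (g x) l) \<in> measurable N (count_space UNIV)"
    unfolding lanczos_steps_def by measurable
qed

lemma measurable_det:
  assumes "\<And>i j. i < n \<Longrightarrow> j < n \<Longrightarrow> (\<lambda>x. F x i j) \<in> borel_measurable N"
  shows "(\<lambda>x. det (mat n n (\<lambda>(i, j). F x i j)) :: real) \<in> borel_measurable N"
proof -
  have "det (mat n n (\<lambda>(i, j). F x i j)) =
    (\<Sum>p | p permutes {0..<n}. of_int (sign p) * (\<Prod>i = 0..<n. F x i (p i)))" for x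
  proof -
    have "(\<Prod>i = 0..<n. mat n n (\<lambda>(i, j). F x i j) $$ (i, p i)) = (\<Prod>i = 0..<n. F x i (p i))"
      if "p permutes {0..<n}" for p
      using permutes_in_image[OF that] by (intro prod.cong) auto
    thus ?thesis by (subst det_def'[of _ n]) auto
  qed
  moreover have "(\<lambda>x. \<Sum>p | p permutes {0..<n}. of_int (sign p) * (\<Prod>i = 0..<n. F x i (p i))) \<in> borel_measurable N"
  proof (intro borel_measurable_sum borel_measurable_times borel_measurable_const borel_measurable_prod)
    fix p i assume "p \<in> {p. p permutes {0..<n}}" "i \<in> {0..<n}"
    thus "(\<lambda>x. F x i (p i)) \<in> borel_measurable N"
      using permutes_in_image[of p "{0..<n}" i] by (intro assms) auto
  qed
  ultimately show ?thesis by simp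
qed

lemma (in lanczos_run) quad_cramer:
  "lanczos_quad A P u l = det (replace_col \<Theta> (unit_vec k 0) 0) / det \<Theta>"
  using cramer_lemma_mat[OF Theta_carrier y_gal(1), of 0] k(1) Theta_det
  by (simp add: quad_eq_y y_gal(2))

text \<open>
  The inverse computed by Gauss--Jordan elimination is replaced by Cramer's rule, in which
  measurability is evident.
\<close>
definition tridiag_entry :: "real mat \<Rightarrow> real mat \<Rightarrow> real vec \<Rightarrow> nat \<Rightarrow> nat \<Rightarrow> real" where
  "tridiag_entry A P v i j = (if i = j then lanczos_alpha A P v (Suc i)
       else if j = Suc i then lanczos_beta A P v j
       else if i = Suc j then lanczos_beta A P v i
       else 0)"

definition cramer_quad :: "real mat \<Rightarrow> real mat \<Rightarrow> real vec \<Rightarrow> nat \<Rightarrow> real" where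
  "cramer_quad A P v k =
     det (mat k k (\<lambda>(i, j). if j = 0 then (if i = 0 then 1 else 0) else tridiag_entry A P v i j)) /
     det (mat k k (\<lambda>(i, j). tridiag_entry A P v i j))"

lemma (in lanczos_run) quad_eq_cramer: "lanczos_quad A P u l = cramer_quad A P u k"
proof -
  have T: "\<Theta> = mat k k (\<lambda>(i, j). tridiag_entry A P u i j)"
    by (simp add: lanczos_tridiag_def Let_def tridiag_entry_def)
  have "replace_col \<Theta> (unit_vec k 0) 0 =
      mat k k (\<lambda>(i, j). if j = 0 then (if i = 0 then 1 else 0) else tridiag_entry A P u i j)"
    by (rule eq_matI) (auto simp: replace_col_def T)
  thus ?thesis unfolding quad_cramer cramer_quad_def by (simp only: T)
qed

text \<open>The matrix size depends on the argument of \<open>g\<close>. For each fixed size the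
  quotient of determinants is measurable, and the countably many cases are glued along the
  measurable number of steps.\<close>

lemma measurable_cramer_quad:
  assumes A: "A \<in> carrier_mat d d" and P: "P \<in> carrier_mat d d" and g: "measurable_vec N d g"
  shows "(\<lambda>x. cramer_quad A P (g x) (lanczos_steps A P (g x) l)) \<in> borel_measurable N"
proof (rule measurable_compose_countable[OF _ measurable_lanczos_coeffs(3)[OF A P g]])
  fix k
  note [measurable] = measurable_lanczos_coeffs(1,2)[OF A P g]
  have e: "(\<lambda>x. tridiag_entry A P (g x) i j) \<in> borel_measurable N" for i j
    unfolding tridiag_entry_def by measurable
  show "(\<lambda>x. cramer_quad A P (g x) k) \<in> borel_measurable N"
    unfolding cramer_quad_def using e by (intro borel_measurable_divide measurable_det) auto
qed

section \<open>The sample as a function of its probe\<close>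

context spectral_frame
begin

lemma quad_form_P:
  assumes x: "x \<in> carrier_vec d"
  shows "(P *\<^sub>v x) \<bullet> (conj_diag f *\<^sub>v (P *\<^sub>v x)) = x \<bullet> (conj_diag f *\<^sub>v x)"
proof -
  note Px = P_mult_vec(1)[OF x]
  have "W\<^sup>T *\<^sub>v (W *\<^sub>v (W\<^sup>T *\<^sub>v x)) = W\<^sup>T *\<^sub>v x" using WT x by (intro W_coords) simp
  hence "W\<^sup>T *\<^sub>v (P *\<^sub>v x) = W\<^sup>T *\<^sub>v x"
    unfolding WWT[symmetric] by (simp only: assoc_mult_mat_vec[OF W WT x])
  thus ?thesis unfolding conj_diag_quad[OF x] conj_diag_quad[OF Px] by simp
qed

lemma vnorm_P:
  assumes x: "x \<in> carrier_vec d"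
  shows "(vnorm (P *\<^sub>v x))\<^sup>2 = x \<bullet> (P *\<^sub>v x)"
  using quad_form_P[OF x, of "\<lambda>_. 1"] P_mult_vec[OF x] by (simp add: vnorm_power2 flip: P_eq)

lemma normalized_run:
  assumes x: "x \<in> carrier_vec d" and nz: "vnorm (P *\<^sub>v x) \<noteq> 0" and l: "1 \<le> l"
  shows "lanczos_run d n A P W \<mu> ((1 / vnorm (P *\<^sub>v x)) \<cdot>\<^sub>v (P *\<^sub>v x)) l"
proof unfold_locales
  let ?u = "P *\<^sub>v x"
  note Px = P_mult_vec[OF x]
  show "(1 / vnorm ?u) \<cdot>\<^sub>v ?u \<in> carrier_vec d" using Px by simp
  show "P *\<^sub>v ((1 / vnorm ?u) \<cdot>\<^sub>v ?u) = (1 / vnorm ?u) \<cdot>\<^sub>v ?u"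
    unfolding mult_mat_vec[OF P Px(1)] Px(2) ..
  have "((1 / vnorm ?u) \<cdot>\<^sub>v ?u) \<bullet> ((1 / vnorm ?u) \<cdot>\<^sub>v ?u) = (1 / vnorm ?u)\<^sup>2 * (vnorm ?u)\<^sup>2"
    using Px unfolding vnorm_power2 by (simp add: power2_eq_square)
  also have "\<dots> = (1 / vnorm ?u * vnorm ?u)\<^sup>2" by (simp only: power_mult_distrib)
  also have "\<dots> = 1" using nz by simp
  finally show "((1 / vnorm ?u) \<cdot>\<^sub>v ?u) \<bullet> ((1 / vnorm ?u) \<cdot>\<^sub>v ?u) = 1" .
qed (rule l)

lemma slq_sample_nonneg:
  assumes "x \<in> carrier_vec d" "1 \<le> l"
  shows "0 \<le> slq_sample A P l x"
proof (cases "vnorm (P *\<^sub>v x) = 0")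
  case False
  interpret lanczos_run d n A P W \<mu> "(1 / vnorm (P *\<^sub>v x)) \<cdot>\<^sub>v (P *\<^sub>v x)" l
    by (rule normalized_run[OF assms(1) False assms(2)])
  show ?thesis using quad_nonneg by (simp add: slq_sample_def Let_def)
qed (simp add: slq_sample_def)

text \<open>The bound for unit vectors is scaled by the squared norm of the projected probe, which
  is \<open>x \<bullet> (P *\<^sub>v x)\<close>. If the projection is zero, both quantities
  vanish.\<close>

lemma slq_sample_error:
  assumes x: "x \<in> carrier_vec d"
    and bound: "\<And>u. u \<in> (\<lambda>x. P *\<^sub>v x) ` carrier_vec d \<Longrightarrow> vnorm u = 1 \<Longrightarrow>
      \<bar>u \<bullet> (pinv (P * A * P) *\<^sub>v u) - lanczos_quad A P u l\<bar> \<le> \<epsilon>"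
  shows "\<bar>x \<bullet> (pinv (P * A * P) *\<^sub>v x) - slq_sample A P l x\<bar> \<le> \<epsilon> * (x \<bullet> (P *\<^sub>v x))"
proof -
  let ?u = "P *\<^sub>v x"
  note Px = P_mult_vec[OF x]
  note q = quad_form_P[OF x, of "\<lambda>i. 1 / \<mu> i", folded pinv_PAP]
  have Ac: "pinv (P * A * P) \<in> carrier_mat d d" by (simp add: pinv_PAP)
  show ?thesis
  proof (cases "vnorm ?u = 0")
    case True
    hence "?u = 0\<^sub>v d" using vnorm_eq_0[OF Px(1)] by simp
    thus ?thesis using q True x Ac by (simp add: slq_sample_def)
  next
    case False
    define w where "w = (1 / vnorm ?u) \<cdot>\<^sub>v ?u"
    have w: "w \<in> carrier_vec d" "?u = vnorm ?u \<cdot>\<^sub>v w"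
      using Px False by (auto simp: w_def smult_smult_assoc)
    \<comment> \<open>This run is used only for the facts that \<open>w\<close> is a unit vector
      fixed by \<open>P\<close>, so its length is chosen as 1.\<close>
    interpret lanczos_run d n A P W \<mu> w 1
      unfolding w_def by (rule normalized_run[OF x False]) simp
    have "w = P *\<^sub>v w" using u(2) by simp
    hence "\<bar>w \<bullet> (pinv (P * A * P) *\<^sub>v w) - lanczos_quad A P w l\<bar> \<le> \<epsilon>"
      using u(1,3) by (intro bound) (auto simp: vnorm_def)
    hence "(vnorm ?u)\<^sup>2 * \<bar>w \<bullet> (pinv (P * A * P) *\<^sub>v w) - lanczos_quad A P w l\<bar> \<le> (vnorm ?u)\<^sup>2 * \<epsilon>"
      by (intro mult_left_mono) auto
    hence "\<bar>(vnorm ?u)\<^sup>2 * (w \<bullet> (pinv (P * A * P) *\<^sub>v w)) - (vnorm ?u)\<^sup>2 * lanczos_quad A P w l\<bar> \<le> \<epsilon> * (vnorm ?u)\<^sup>2"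
      unfolding right_diff_distrib[symmetric] abs_mult by (simp add: mult.commute)
    moreover have "x \<bullet> (pinv (P * A * P) *\<^sub>v x) = (vnorm ?u)\<^sup>2 * (w \<bullet> (pinv (P * A * P) *\<^sub>v w))"
      unfolding q[symmetric] using w(1) Ac
      by (subst (1 2) w(2)) (simp add: mult_mat_vec[OF Ac] power2_eq_square)
    moreover have "slq_sample A P l x = (vnorm ?u)\<^sup>2 * lanczos_quad A P w l"
      by (simp add: slq_sample_def Let_def w_def)
    ultimately show ?thesis
      unfolding vnorm_P[OF x, symmetric] by simp
  qed
qed

text \<open>The determinant formula represents the sample everywhere: where the projected probe is
  zero, the factor in front makes both sides 0.\<close>

lemma measurable_slq_sample:
  assumes l: "1 \<le> l"
  shows "(\<lambda>f. slq_sample A P l (vec d f)) \<in> borel_measurable (PiM {..<d} (\<lambda>_. borel))"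
proof -
  let ?N = "PiM {..<d} (\<lambda>_. borel :: real measure)"
  have x: "measurable_vec ?N d (vec d)"
    by (auto simp: measurable_vec_def intro!: measurable_component_singleton)
  define u where "u f = P *\<^sub>v vec d f" for f
  define w where "w f = (1 / vnorm (u f)) \<cdot>\<^sub>v u f" for f
  have u: "measurable_vec ?N d u" unfolding u_def by (rule measurable_vec_mat[OF P x])
  have w: "measurable_vec ?N d w" unfolding w_def
    by (intro measurable_vec_smult borel_measurable_divide borel_measurable_const measurable_vnorm[OF u] u)
  have "slq_sample A P l (vec d f) = (vnorm (u f))\<^sup>2 * cramer_quad A P (w f) (lanczos_steps A P (w f) l)" for f
  proof (cases "vnorm (u f) = 0")
    case False
    interpret lanczos_run d n A P W \<mu> "w f" l
      unfolding w_def u_def using normalized_run[OF _ _ l, of "vec d f"] False by (simp add: u_def)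
    show ?thesis using quad_eq_cramer by (simp add: slq_sample_def Let_def u_def w_def)
  qed (simp add: slq_sample_def u_def)
  thus ?thesis
    by (simp add: borel_measurable_times borel_measurable_power measurable_vnorm[OF u]
        measurable_cramer_quad[OF A P w])
qed

end

section \<open>Gaussian quadratic forms\<close>

lemma std_normal_moments:
  "(LINT x|std_normal_distribution. x ^ 0) = 1" "(LINT x|std_normal_distribution. x ^ 1) = 0"
  "(LINT x|std_normal_distribution. x ^ 2) = 1" "(LINT x|std_normal_distribution. x ^ 3) = 0"
  "(LINT x|std_normal_distribution. x ^ 4) = 3"
  using std_normal_distribution_even_moments(1)[of 0] std_normal_distribution_even_moments(1)[of 1]
    std_normal_distribution_even_moments(1)[of 2] integral_std_normal_distribution_moment_odd[of 1]
    integral_std_normal_distribution_moment_odd[of 3]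
  by (simp_all add: fact_numeral)

lemma std_gaussian_product_moment:
  "integrable (std_gaussian d) (\<lambda>f. \<Prod>a<d. f a ^ e a)"
  "(LINT f|std_gaussian d. (\<Prod>a<d. f a ^ e a)) = (\<Prod>a<d. LINT x|std_normal_distribution. x ^ e a)"
proof -
  interpret prob_space std_normal_distribution by (rule prob_space_normal_density) simp
  interpret product_sigma_finite "\<lambda>_ :: nat. std_normal_distribution" by unfold_locales
  show "integrable (std_gaussian d) (\<lambda>f. \<Prod>a<d. f a ^ e a)"
    unfolding std_gaussian_def
    by (rule product_integrable_prod) (auto intro: integrable_std_normal_distribution_moment)
  show "(LINT f|std_gaussian d. (\<Prod>a<d. f a ^ e a)) = (\<Prod>a<d. LINT x|std_normal_distribution. x ^ e a)"
    unfolding std_gaussian_def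
    by (rule product_integral_prod) (auto intro: integrable_std_normal_distribution_moment)
qed

lemma prod_power_of_bool:
  fixes f :: "nat \<Rightarrow> real"
  assumes "c < d"
  shows "(\<Prod>a<d. f a ^ of_bool (a = c)) = f c"
proof -
  have "(\<Prod>a<d. f a ^ of_bool (a = c)) = (\<Prod>a<d. if a = c then f a else 1)"
    by (intro prod.cong) auto
  thus ?thesis using assms by simp
qed

text \<open>Let \<open>e a\<close> be the multiplicity of \<open>a\<close> among the four indices.
  The expectation is a product of one-dimensional moments over the occurring indices only, as the
  others contribute factor 1; the moments 1, 0, 1, 0, 3 and a case split on coincidences give the
  three pairings.\<close>

lemma std_gaussian_moment4:
  assumes "i < d" "j < d" "k < d" "l < d"
  shows "integrable (std_gaussian d) (\<lambda>f. f i * f j * f k * f l)"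
    "(LINT f|std_gaussian d. f i * f j * f k * f l) =
      of_bool (i = j) * of_bool (k = l) + of_bool (i = k) * of_bool (j = l) + of_bool (i = l) * of_bool (j = k)"
proof -
  define e where "e a = (of_bool (a = i) + of_bool (a = j) + of_bool (a = k) + of_bool (a = l) :: nat)" for a
  have e: "(\<Prod>a<d. f a ^ e a) = f i * f j * f k * f l" for f :: "nat \<Rightarrow> real"
    using assms unfolding e_def power_add prod.distrib by (simp only: prod_power_of_bool)
  show "integrable (std_gaussian d) (\<lambda>f. f i * f j * f k * f l)"
    using std_gaussian_product_moment(1)[of d e] by (simp only: e)
  have "(LINT f|std_gaussian d. f i * f j * f k * f l) = (\<Prod>a<d. LINT x|std_normal_distribution. x ^ e a)"
    using std_gaussian_product_moment(2)[of d e] by (simp only: e)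
  also have "\<dots> = (\<Prod>a\<in>{i, j, k, l}. LINT x|std_normal_distribution. x ^ e a)"
    using assms std_normal_moments(1) by (intro prod.mono_neutral_right) (auto simp: e_def)
  also have "\<dots> = of_bool (i = j) * of_bool (k = l) + of_bool (i = k) * of_bool (j = l) + of_bool (i = l) * of_bool (j = k)"
    using std_normal_moments
    by (cases "i = j"; cases "i = k"; cases "i = l"; cases "j = k"; cases "j = l"; cases "k = l")
      (simp_all add: e_def numeral_eq_Suc insert_commute)
  finally show "(LINT f|std_gaussian d. f i * f j * f k * f l) =
      of_bool (i = j) * of_bool (k = l) + of_bool (i = k) * of_bool (j = l) + of_bool (i = l) * of_bool (j = k)" .
qed

lemma std_gaussian_moment2:
  assumes "i < d" "j < d"
  shows "integrable (std_gaussian d) (\<lambda>f. f i * f j)"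
    "(LINT f|std_gaussian d. f i * f j) = of_bool (i = j)"
proof -
  define e where "e a = (of_bool (a = i) + of_bool (a = j) :: nat)" for a
  have e: "(\<Prod>a<d. f a ^ e a) = f i * f j" for f :: "nat \<Rightarrow> real"
    using assms unfolding e_def power_add prod.distrib by (simp only: prod_power_of_bool)
  show "integrable (std_gaussian d) (\<lambda>f. f i * f j)"
    using std_gaussian_product_moment(1)[of d e] by (simp only: e)
  have "(LINT f|std_gaussian d. f i * f j) = (\<Prod>a<d. LINT x|std_normal_distribution. x ^ e a)"
    using std_gaussian_product_moment(2)[of d e] by (simp only: e)
  also have "\<dots> = (\<Prod>a\<in>{i, j}. LINT x|std_normal_distribution. x ^ e a)"
    using assms std_normal_moments(1) by (intro prod.mono_neutral_right) (auto simp: e_def)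
  also have "\<dots> = of_bool (i = j)"
    using std_normal_moments by (cases "i = j") (simp_all add: e_def numeral_eq_Suc)
  finally show "(LINT f|std_gaussian d. f i * f j) = of_bool (i = j)" .
qed

lemma sum_of_bool_eq:
  fixes g :: "nat \<Rightarrow> real"
  assumes "k < d"
  shows "(\<Sum>l<d. g l * of_bool (k = l)) = g k" "(\<Sum>l<d. g l * of_bool (l = k)) = g k"
proof -
  have "(\<Sum>l<d. g l * of_bool (k = l)) = (\<Sum>l<d. if k = l then g l else 0)"
    "(\<Sum>l<d. g l * of_bool (l = k)) = (\<Sum>l<d. if l = k then g l else 0)"
    by (auto intro!: sum.cong)
  thus "(\<Sum>l<d. g l * of_bool (k = l)) = g k" "(\<Sum>l<d. g l * of_bool (l = k)) = g k"
    using assms by simp_all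
qed

text \<open>\<open>B\<close> may be asymmetric, so the two crossed pairings give different sums: one
  of squares and one of products of transposed entries.\<close>

lemma std_gaussian_quad_form:
  fixes B :: "nat \<Rightarrow> nat \<Rightarrow> real" and d :: nat
  defines "q \<equiv> (\<lambda>f. \<Sum>i<d. \<Sum>j<d. B i j * (f i * f j))"
  shows "integrable (std_gaussian d) q" "integrable (std_gaussian d) (\<lambda>f. (q f)\<^sup>2)"
    "(LINT f|std_gaussian d. q f) = (\<Sum>i<d. B i i)"
    "(LINT f|std_gaussian d. (q f)\<^sup>2) =
      (\<Sum>i<d. B i i)\<^sup>2 + (\<Sum>i<d. \<Sum>j<d. (B i j)\<^sup>2) + (\<Sum>i<d. \<Sum>j<d. B i j * B j i)"
proof -
  have 2: "has_bochner_integral (std_gaussian d) q (\<Sum>i<d. \<Sum>j<d. B i j * of_bool (i = j))"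
    unfolding q_def using std_gaussian_moment2
    by (intro has_bochner_integral_sum has_bochner_integral_mult_right) (auto simp: has_bochner_integral_iff)
  thus "integrable (std_gaussian d) q" "(LINT f|std_gaussian d. q f) = (\<Sum>i<d. B i i)"
    by (simp_all add: sum_of_bool_eq has_bochner_integral_iff)
  \<comment> \<open>The order i, k, j, l is the one produced by multiplying two double sums; each
    pairing below then collapses two of the four summations.\<close>
  have q2: "(q f)\<^sup>2 = (\<Sum>i<d. \<Sum>k<d. \<Sum>j<d. \<Sum>l<d. B i j * B k l * (f i * f j * f k * f l))" for f
    unfolding q_def power2_eq_square sum_product by (intro sum.cong refl) (simp add: mult_ac)
  have 4: "has_bochner_integral (std_gaussian d) (\<lambda>f. (q f)\<^sup>2) (\<Sum>i<d. \<Sum>k<d. \<Sum>j<d. \<Sum>l<d. B i j * B k l *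
      (of_bool (i = j) * of_bool (k = l) + of_bool (i = k) * of_bool (j = l) + of_bool (i = l) * of_bool (j = k)))"
    unfolding q2 using std_gaussian_moment4
    by (intro has_bochner_integral_sum has_bochner_integral_mult_right) (auto simp: has_bochner_integral_iff)
  thus "integrable (std_gaussian d) (\<lambda>f. (q f)\<^sup>2)" by (simp add: has_bochner_integral_iff)
  have "(LINT f|std_gaussian d. (q f)\<^sup>2) = (\<Sum>i<d. \<Sum>k<d. \<Sum>j<d. \<Sum>l<d. B i j * B k l *
      (of_bool (i = j) * of_bool (k = l) + of_bool (i = k) * of_bool (j = l) + of_bool (i = l) * of_bool (j = k)))"
    using 4 by (simp only: has_bochner_integral_iff)
  also have "\<dots> = (\<Sum>i<d. \<Sum>k<d. \<Sum>j<d. \<Sum>l<d. B i j * B k l * of_bool (i = j) * of_bool (k = l)) +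
     (\<Sum>i<d. \<Sum>k<d. \<Sum>j<d. \<Sum>l<d. B i j * B k l * of_bool (i = k) * of_bool (j = l)) +
     (\<Sum>i<d. \<Sum>k<d. \<Sum>j<d. \<Sum>l<d. B i j * B k l * of_bool (j = k) * of_bool (i = l))"
    by (simp add: distrib_left sum.distrib mult_ac)
  also have "(\<Sum>i<d. \<Sum>k<d. \<Sum>j<d. \<Sum>l<d. B i j * B k l * of_bool (i = j) * of_bool (k = l)) = (\<Sum>i<d. B i i)\<^sup>2"
  proof -
    have "(\<Sum>i<d. \<Sum>k<d. \<Sum>j<d. \<Sum>l<d. B i j * B k l * of_bool (i = j) * of_bool (k = l)) =
      (\<Sum>i<d. \<Sum>k<d. \<Sum>j<d. B i j * B k k * of_bool (i = j))"
      by (intro sum.cong refl) (simp add: sum_of_bool_eq)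
    thus ?thesis by (simp add: sum_of_bool_eq power2_eq_square sum_product)
  qed
  also have "(\<Sum>i<d. \<Sum>k<d. \<Sum>j<d. \<Sum>l<d. B i j * B k l * of_bool (i = k) * of_bool (j = l)) = (\<Sum>i<d. \<Sum>j<d. (B i j)\<^sup>2)"
  proof -
    have "(\<Sum>i<d. \<Sum>k<d. \<Sum>j<d. \<Sum>l<d. B i j * B k l * of_bool (i = k) * of_bool (j = l)) =
      (\<Sum>i<d. \<Sum>k<d. (\<Sum>j<d. B i j * B k j) * of_bool (i = k))"
      unfolding sum_distrib_right by (intro sum.cong refl) (simp add: sum_of_bool_eq)
    thus ?thesis by (simp add: sum_of_bool_eq power2_eq_square)
  qed
  also have "(\<Sum>i<d. \<Sum>k<d. \<Sum>j<d. \<Sum>l<d. B i j * B k l * of_bool (j = k) * of_bool (i = l)) = (\<Sum>i<d. \<Sum>j<d. B i j * B j i)"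
  proof -
    have "(\<Sum>i<d. \<Sum>k<d. \<Sum>j<d. \<Sum>l<d. B i j * B k l * of_bool (j = k) * of_bool (i = l)) =
      (\<Sum>i<d. \<Sum>k<d. \<Sum>j<d. B i j * B k i * of_bool (j = k))"
      by (intro sum.cong refl) (simp add: sum_of_bool_eq)
    thus ?thesis by (simp add: sum_of_bool_eq)
  qed
  finally show "(LINT f|std_gaussian d. (q f)\<^sup>2) =
      (\<Sum>i<d. B i i)\<^sup>2 + (\<Sum>i<d. \<Sum>j<d. (B i j)\<^sup>2) + (\<Sum>i<d. \<Sum>j<d. B i j * B j i)" .
qed

section \<open>Variance comparison and a strong law\<close>

context prob_space
begin

text \<open>The triangle inequality for standard deviations, obtained from a weighted Young
  inequality. The difference \<open>S - X\<close> has variance at most its second moment, which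
  \<open>D\<close> controls.\<close>

lemma variance_le_of_close:
  fixes X S D :: "'a \<Rightarrow> real"
  assumes X: "integrable M X" "integrable M (\<lambda>x. (X x)\<^sup>2)"
    and S: "integrable M S" "integrable M (\<lambda>x. (S x)\<^sup>2)"
    and D: "integrable M (\<lambda>x. (D x)\<^sup>2)" "expectation (\<lambda>x. (D x)\<^sup>2) \<le> c\<^sup>2"
    and close: "\<And>x. x \<in> space M \<Longrightarrow> \<bar>S x - X x\<bar> \<le> D x"
    and var: "variance X = a\<^sup>2" and a: "0 < a" and c: "0 \<le> c"
  shows "variance S \<le> (a + c)\<^sup>2"
proof -
  define y where "y x = X x - expectation X" for x
  define z where "z x = (S x - X x) - (expectation S - expectation X)" for x
  have meas [measurable]: "X \<in> borel_measurable M" "S \<in> borel_measurable M" using X S by auto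
  have sq: "(S x - X x)\<^sup>2 \<le> (D x)\<^sup>2" if "x \<in> space M" for x
    using power_mono[OF close[OF that], of 2] by simp
  have iSX: "integrable M (\<lambda>x. S x - X x)" using S X by simp
  have i2: "integrable M (\<lambda>x. (S x - X x)\<^sup>2)"
    by (rule Bochner_Integration.integrable_bound[OF D(1)]) (use sq in auto)
  have iy: "integrable M (\<lambda>x. (y x)\<^sup>2)" unfolding y_def power2_diff using X by simp
  have iz: "integrable M (\<lambda>x. (z x)\<^sup>2)"
    unfolding z_def using i2 S X by (subst power2_diff) (intro Bochner_Integration.integrable_add
      Bochner_Integration.integrable_diff integrable_const integrable_mult_left integrable_mult_right, auto)
  have Ey: "expectation (\<lambda>x. (y x)\<^sup>2) = a\<^sup>2" unfolding y_def using var by simp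
  have Ez: "expectation (\<lambda>x. (z x)\<^sup>2) \<le> c\<^sup>2"
  proof -
    have "expectation (\<lambda>x. (z x)\<^sup>2) = variance (\<lambda>x. S x - X x)"
      unfolding z_def using S X by simp
    also have "\<dots> = expectation (\<lambda>x. (S x - X x)\<^sup>2) - (expectation (\<lambda>x. S x - X x))\<^sup>2"
      by (rule variance_eq[OF iSX i2])
    also have "\<dots> \<le> expectation (\<lambda>x. (S x - X x)\<^sup>2)" by simp
    also have "\<dots> \<le> expectation (\<lambda>x. (D x)\<^sup>2)" by (rule integral_mono[OF i2 D(1) sq])
    finally show ?thesis using D(2) by linarith
  qed
  have bound: "variance S \<le> (1 + t) * a\<^sup>2 + (1 + 1 / t) * c\<^sup>2" if t: "0 < t" for t
  proof -
    have "(S x - expectation S)\<^sup>2 \<le> (1 + t) * (y x)\<^sup>2 + (1 + 1 / t) * (z x)\<^sup>2" for x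
    proof -
      have "0 \<le> (sqrt t * y x - z x / sqrt t)\<^sup>2" by simp
      also have "\<dots> = t * (y x)\<^sup>2 + (z x)\<^sup>2 / t - 2 * (y x * z x)"
        using t by (simp add: power2_diff power_mult_distrib power_divide)
      finally have "2 * (y x * z x) \<le> t * (y x)\<^sup>2 + (z x)\<^sup>2 / t" by simp
      moreover have "S x - expectation S = y x + z x" by (simp add: y_def z_def)
      ultimately show ?thesis by (simp add: power2_sum algebra_simps)
    qed
    hence "variance S \<le> expectation (\<lambda>x. (1 + t) * (y x)\<^sup>2 + (1 + 1 / t) * (z x)\<^sup>2)"
      using iy iz S by (intro integral_mono) (auto simp: power2_diff)
    also have "\<dots> = (1 + t) * a\<^sup>2 + (1 + 1 / t) * expectation (\<lambda>x. (z x)\<^sup>2)"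
      using iy iz Ey by simp
    also have "\<dots> \<le> (1 + t) * a\<^sup>2 + (1 + 1 / t) * c\<^sup>2"
      using Ez t by (intro add_left_mono mult_left_mono) auto
    finally show ?thesis .
  qed
  show ?thesis
  proof (cases "c = 0")
    case True
    have "variance S \<le> a\<^sup>2"
    proof (rule field_le_epsilon)
      fix e :: real assume "0 < e"
      \<comment> \<open>For \<open>c = 0\<close> the best weight would be 0, which is excluded; a
        weight tending to 0 replaces it, scaled so that the excess is exactly
        \<open>e\<close>.\<close>
      have "(1 + e / a\<^sup>2) * a\<^sup>2 = a\<^sup>2 + e" using a by (simp add: distrib_right)
      thus "variance S \<le> a\<^sup>2 + e" using bound[of "e / a\<^sup>2"] a \<open>0 < e\<close> True by simp
    qed
    thus ?thesis using True by simp
  next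
    case False
    hence "0 < c" using c by simp
    \<comment> \<open>\<open>c / a\<close> is the minimising weight and turns the bound into a
      perfect square.\<close>
    hence "(1 + c / a) * a\<^sup>2 + (1 + 1 / (c / a)) * c\<^sup>2 = (a + c)\<^sup>2"
      using a by (simp add: field_simps power2_eq_square)
    thus ?thesis using bound[of "c / a"] a \<open>0 < c\<close> by simp
  qed
qed

text \<open>Independence makes the mixed terms vanish. The result gives both the variance of the
  estimator and the decay needed for the strong law.\<close>

lemma centered_sum_second_moment:
  fixes Y :: "nat \<Rightarrow> 'a \<Rightarrow> real"
  assumes indep: "indep_vars (\<lambda>_. borel) Y UNIV"
    and int: "\<And>i. integrable M (Y i)" "\<And>i. integrable M (\<lambda>x. (Y i x)\<^sup>2)"
    and mean: "\<And>i. expectation (Y i) = \<mu>" and var: "\<And>i. variance (Y i) = s"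
  shows "has_bochner_integral M (\<lambda>x. (\<Sum>i<n. Y i x - \<mu>)\<^sup>2) (real n * s)"
proof -
  have indepZ: "indep_vars (\<lambda>_. borel) (\<lambda>i x. Y i x - \<mu>) UNIV"
    by (rule indep_vars_compose2[OF indep]) simp
  have m0: "expectation (\<lambda>x. Y i x - \<mu>) = 0" for i using int mean by (simp add: prob_space)
  have h: "has_bochner_integral M (\<lambda>x. (Y i x - \<mu>) * (Y j x - \<mu>)) (if i = j then s else 0)" for i j
  proof (cases "i = j")
    case True
    have "integrable M (\<lambda>x. (Y i x - \<mu>)\<^sup>2)" using int by (simp add: power2_diff)
    thus ?thesis using True var[of i] mean[of i]
      by (simp add: has_bochner_integral_iff power2_eq_square)
  next
    case False
    have "indep_vars (\<lambda>_. borel) (\<lambda>i x. Y i x - \<mu>) {i, j}"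
      by (rule indep_vars_subset[OF indepZ]) simp
    note p = indep_vars_lebesgue_integral[OF _ this] indep_vars_integrable[OF _ this]
    have "expectation (\<lambda>x. \<Prod>a\<in>{i, j}. Y a x - \<mu>) = (\<Prod>a\<in>{i, j}. expectation (\<lambda>x. Y a x - \<mu>))"
      "integrable M (\<lambda>x. \<Prod>a\<in>{i, j}. Y a x - \<mu>)"
      by (rule p, simp_all add: int)+
    thus ?thesis using False m0 by (simp add: has_bochner_integral_iff)
  qed
  have "(\<lambda>x. (\<Sum>i<n. Y i x - \<mu>)\<^sup>2) = (\<lambda>x. \<Sum>i<n. \<Sum>j<n. (Y i x - \<mu>) * (Y j x - \<mu>))"
    by (simp only: power2_eq_square sum_product)
  moreover have "has_bochner_integral M (\<lambda>x. \<Sum>i<n. \<Sum>j<n. (Y i x - \<mu>) * (Y j x - \<mu>))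
      (\<Sum>i<n. \<Sum>j<n. if i = j then s else 0)"
    by (intro has_bochner_integral_sum h)
  ultimately show ?thesis by simp
qed

end

section \<open>A strong law for nonnegative summands\<close>

lemma filterlim_floor_sqrt: "filterlim floor_sqrt at_top sequentially"
  unfolding filterlim_at_top eventually_sequentially
proof
  fix Z :: nat
  show "\<exists>N. \<forall>n\<ge>N. Z \<le> floor_sqrt n" by (intro exI[of _ "Z\<^sup>2"]) (auto simp: le_floor_sqrt_iff)
qed

text \<open>With r = floor(sqrt n), monotonicity squeezes the average at n between those at the
  neighbouring squares, up to the factors (r / (r+1))^2 and its inverse, which tend to 1.\<close>

lemma averages_tendsto_of_squares:
  fixes s :: "nat \<Rightarrow> real"
  assumes mono: "mono s" and nonneg: "\<And>n. 0 \<le> s n"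
    and lim: "(\<lambda>m. s (m\<^sup>2) / real (m\<^sup>2)) \<longlonglongrightarrow> \<mu>"
  shows "(\<lambda>n. s n / real n) \<longlonglongrightarrow> \<mu>"
proof -
  have r1: "(\<lambda>m. (real m / real (Suc m))\<^sup>2) \<longlonglongrightarrow> 1\<^sup>2"
    by (intro tendsto_power LIMSEQ_n_over_Suc_n)
  have r2: "(\<lambda>m. (real (Suc m) / real m)\<^sup>2) \<longlonglongrightarrow> 1\<^sup>2"
    by (intro tendsto_power LIMSEQ_Suc_n_over_n)
  have low: "(\<lambda>m. s (m\<^sup>2) / real (m\<^sup>2) * (real m / real (Suc m))\<^sup>2) \<longlonglongrightarrow> \<mu>"
    using tendsto_mult[OF lim r1] by simp
  have up: "(\<lambda>m. s ((Suc m)\<^sup>2) / real ((Suc m)\<^sup>2) * (real (Suc m) / real m)\<^sup>2) \<longlonglongrightarrow> \<mu>"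
    using tendsto_mult[OF LIMSEQ_Suc[OF lim] r2] by simp
  note f = filterlim_floor_sqrt
  show ?thesis
  proof (rule tendsto_sandwich[OF _ _ filterlim_compose[OF low f] filterlim_compose[OF up f]])
    show "\<forall>\<^sub>F n in sequentially. s ((floor_sqrt n)\<^sup>2) / real ((floor_sqrt n)\<^sup>2) *
        (real (floor_sqrt n) / real (Suc (floor_sqrt n)))\<^sup>2 \<le> s n / real n"
    proof (intro eventually_sequentiallyI[of 1])
      fix n :: nat assume n: "1 \<le> n"
      define r where "r = floor_sqrt n"
      have r: "1 \<le> r" "r\<^sup>2 \<le> n" "n \<le> (Suc r)\<^sup>2"
        using n Suc_floor_sqrt_power2_gt[of n] by (auto simp: r_def Suc_le_eq intro: less_imp_le)
      have "s (r\<^sup>2) / real (r\<^sup>2) * (real r / real (Suc r))\<^sup>2 = s (r\<^sup>2) / real ((Suc r)\<^sup>2)"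
        using r(1) by (simp add: power_divide del: of_nat_Suc)
      also have "\<dots> \<le> s n / real n"
        using n monoD[OF mono r(2)] nonneg by (intro frac_le of_nat_mono r(3)) auto
      finally show "s ((floor_sqrt n)\<^sup>2) / real ((floor_sqrt n)\<^sup>2) *
        (real (floor_sqrt n) / real (Suc (floor_sqrt n)))\<^sup>2 \<le> s n / real n" by (simp only: r_def)
    qed
    show "\<forall>\<^sub>F n in sequentially. s n / real n \<le> s ((Suc (floor_sqrt n))\<^sup>2) / real ((Suc (floor_sqrt n))\<^sup>2) *
        (real (Suc (floor_sqrt n)) / real (floor_sqrt n))\<^sup>2"
    proof (intro eventually_sequentiallyI[of 1])
      fix n :: nat assume n: "1 \<le> n"
      define r where "r = floor_sqrt n"
      have r: "1 \<le> r" "r\<^sup>2 \<le> n" "n \<le> (Suc r)\<^sup>2"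
        using n Suc_floor_sqrt_power2_gt[of n] by (auto simp: r_def Suc_le_eq intro: less_imp_le)
      have "s n / real n \<le> s ((Suc r)\<^sup>2) / real (r\<^sup>2)"
        using r(1) monoD[OF mono r(3)] nonneg by (intro frac_le of_nat_mono r(2)) auto
      also have "\<dots> = s ((Suc r)\<^sup>2) / real ((Suc r)\<^sup>2) * (real (Suc r) / real r)\<^sup>2"
        using r(1) by (simp add: power_divide del: of_nat_Suc)
      finally show "s n / real n \<le> s ((Suc (floor_sqrt n))\<^sup>2) / real ((Suc (floor_sqrt n))\<^sup>2) *
        (real (Suc (floor_sqrt n)) / real (floor_sqrt n))\<^sup>2" by (simp only: r_def)
    qed
  qed
qed

text \<open>Along the squares the expected squared deviations are
  \<open>v / (real (Suc m))\<^sup>2\<close>, a summable sequence. The random series of squared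
  deviations therefore has finite expectation, converges almost surely, and its terms tend to
  0.\<close>

lemma (in prob_space) strong_law_nonneg:
  fixes Y :: "nat \<Rightarrow> 'a \<Rightarrow> real"
  assumes indep: "indep_vars (\<lambda>_. borel) Y UNIV"
    and nonneg: "\<And>i x. x \<in> space M \<Longrightarrow> 0 \<le> Y i x"
    and int: "\<And>i. integrable M (Y i)" "\<And>i. integrable M (\<lambda>x. (Y i x)\<^sup>2)"
    and mean: "\<And>i. expectation (Y i) = \<mu>" and var: "\<And>i. variance (Y i) = v"
  shows "AE x in M. (\<lambda>n. (\<Sum>i<n. Y i x) / real n) \<longlonglongrightarrow> \<mu>"
proof -
  \<comment> \<open>Starting at \<open>Suc m\<close> keeps the denominators nonzero.\<close>
  define g where "g m x = ((\<Sum>i<(Suc m)\<^sup>2. Y i x - \<mu>) / real ((Suc m)\<^sup>2))\<^sup>2" for m x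
  have v: "0 \<le> v" using var[of 0] variance_positive[of "Y 0"] by simp
  have g: "has_bochner_integral M (g m) (v / (real (Suc m))\<^sup>2)" for m
  proof -
    have "has_bochner_integral M (\<lambda>x. (\<Sum>i<(Suc m)\<^sup>2. Y i x - \<mu>)\<^sup>2 / (real ((Suc m)\<^sup>2))\<^sup>2)
        (real ((Suc m)\<^sup>2) * v / (real ((Suc m)\<^sup>2))\<^sup>2)"
      by (intro has_bochner_integral_divide_zero centered_sum_second_moment[OF indep int mean var])
    moreover have "real ((Suc m)\<^sup>2) * v / (real ((Suc m)\<^sup>2))\<^sup>2 = v / (real (Suc m))\<^sup>2"
      unfolding of_nat_power by (simp add: power2_eq_square del: of_nat_Suc)
    ultimately show ?thesis unfolding g_def power_divide by simp
  qed
  have gm [measurable]: "g m \<in> borel_measurable M" for m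
    using g[of m] by (auto simp: has_bochner_integral_iff)
  have g0: "0 \<le> g m x" for m x by (simp add: g_def)
  have summ: "summable (\<lambda>m. v / (real (Suc m))\<^sup>2)"
  proof -
    have "summable (\<lambda>m. inverse (real (Suc m) ^ 2))"
      using inverse_power_summable[of 2, where ?'a = real] by (subst summable_Suc_iff) auto
    from summable_mult[OF this, of v] show ?thesis by (simp add: divide_inverse)
  qed
  have "(\<integral>\<^sup>+x. (\<Sum>m. ennreal (g m x)) \<partial>M) = (\<Sum>m. \<integral>\<^sup>+x. ennreal (g m x) \<partial>M)"
    by (rule nn_integral_suminf) measurable
  also have "\<dots> = (\<Sum>m. ennreal (v / (real (Suc m))\<^sup>2))"
    using g g0 by (intro suminf_cong) (simp add: nn_integral_eq_integral has_bochner_integral_iff)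
  also have "\<dots> \<noteq> \<infinity>"
    using summ v by (subst suminf_ennreal2) auto
  finally have "AE x in M. (\<Sum>m. ennreal (g m x)) \<noteq> \<infinity>"
    by (intro nn_integral_PInf_AE) auto
  from this AE_space show ?thesis
  proof eventually_elim
    case (elim x)
    have "summable (\<lambda>m. g m x)" using elim g0 by (intro summable_suminf_not_top) auto
    hence "(\<lambda>m. g m x) \<longlonglongrightarrow> 0" by (rule summable_LIMSEQ_zero)
    hence "(\<lambda>m. sqrt (g m x)) \<longlonglongrightarrow> sqrt 0" by (rule tendsto_real_sqrt)
    hence "(\<lambda>m. \<bar>(\<Sum>i<(Suc m)\<^sup>2. Y i x - \<mu>) / real ((Suc m)\<^sup>2)\<bar>) \<longlonglongrightarrow> 0"
      by (simp only: g_def real_sqrt_abs real_sqrt_zero)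
    hence "(\<lambda>m. (\<Sum>i<(Suc m)\<^sup>2. Y i x - \<mu>) / real ((Suc m)\<^sup>2)) \<longlonglongrightarrow> 0"
      by (simp only: tendsto_rabs_zero_iff)
    moreover have "(\<Sum>i<(Suc m)\<^sup>2. Y i x - \<mu>) / real ((Suc m)\<^sup>2) =
        (\<Sum>i<(Suc m)\<^sup>2. Y i x) / real ((Suc m)\<^sup>2) - \<mu>" for m
      by (simp add: sum_subtractf diff_divide_distrib del: of_nat_Suc)
    ultimately have "(\<lambda>m. (\<Sum>i<(Suc m)\<^sup>2. Y i x) / real ((Suc m)\<^sup>2) - \<mu>) \<longlonglongrightarrow> 0" by simp
    hence "(\<lambda>m. (\<Sum>i<(Suc m)\<^sup>2. Y i x) / real ((Suc m)\<^sup>2)) \<longlonglongrightarrow> \<mu>" by (simp add: LIM_zero_iff)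
    hence "(\<lambda>m. (\<Sum>i<m\<^sup>2. Y i x) / real (m\<^sup>2)) \<longlonglongrightarrow> \<mu>" by (rule LIMSEQ_imp_Suc)
    moreover have "mono (\<lambda>n. \<Sum>i<n. Y i x)"
      using nonneg elim by (intro monoI sum_mono2) auto
    moreover have "0 \<le> (\<Sum>i<n. Y i x)" for n
      using nonneg elim by (intro sum_nonneg) auto
    ultimately show ?case using averages_tendsto_of_squares by blast
  qed
qed

section \<open>The estimator\<close>

locale probe_model = spectral_frame + prob_space M for M :: "'w measure" +
  fixes \<xi> :: "nat \<Rightarrow> 'w \<Rightarrow> real vec"
  assumes probes: "iid_std_gaussian M d \<xi>"
begin

abbreviation "coords i \<omega> \<equiv> vec_coords d (\<xi> i \<omega>)"

lemma probe_carrier: "\<omega> \<in> space M \<Longrightarrow> \<xi> i \<omega> \<in> carrier_vec d"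
  using probes by (simp add: iid_std_gaussian_def)

lemma vec_of_coords: "\<omega> \<in> space M \<Longrightarrow> vec d (coords i \<omega>) = \<xi> i \<omega>"
  using probe_carrier[of \<omega> i] by (intro eq_vecI) (auto simp: vec_coords_def)

lemma indep_coords: "indep_vars (\<lambda>_. PiM {..<d} (\<lambda>_. borel)) coords UNIV"
  and distr_coords: "distr M (PiM {..<d} (\<lambda>_. borel)) (coords i) = std_gaussian d"
  using probes by (simp_all add: iid_std_gaussian_def)

lemma measurable_coords: "coords i \<in> measurable M (PiM {..<d} (\<lambda>_. borel))"
  using indep_coords by (auto simp: indep_vars_def)

lemma has_integral_coords:
  fixes h :: "(nat \<Rightarrow> real) \<Rightarrow> real"
  assumes h: "h \<in> borel_measurable (PiM {..<d} (\<lambda>_. borel))" and int: "has_bochner_integral (std_gaussian d) h r"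
  shows "has_bochner_integral M (\<lambda>\<omega>. h (coords i \<omega>)) r"
  using int unfolding has_bochner_integral_iff distr_coords[of i, symmetric]
  by (simp add: integrable_distr_eq[OF measurable_coords h] integral_distr[OF measurable_coords h])

lemma indep_of_coords:
  fixes h :: "(nat \<Rightarrow> real) \<Rightarrow> real"
  assumes "h \<in> borel_measurable (PiM {..<d} (\<lambda>_. borel))"
  shows "indep_vars (\<lambda>_. borel) (\<lambda>i \<omega>. h (coords i \<omega>)) UNIV"
  by (rule indep_vars_compose2[OF indep_coords assms])

text \<open>A probe is determined by its coordinates only on \<open>space M\<close>, so
  \<open>Y i\<close> is not literally a composition with them; independence nevertheless sees only
  preimages intersected with the space.\<close>

lemma indep_vars_transfer:
  fixes h :: "(nat \<Rightarrow> real) \<Rightarrow> real" and Y :: "nat \<Rightarrow> 'w \<Rightarrow> real"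
  assumes h: "h \<in> borel_measurable (PiM {..<d} (\<lambda>_. borel))"
    and Y: "\<And>i \<omega>. \<omega> \<in> space M \<Longrightarrow> Y i \<omega> = h (coords i \<omega>)"
  shows "indep_vars (\<lambda>_. borel) Y UNIV"
proof -
  have "Y i \<in> borel_measurable M \<longleftrightarrow> (\<lambda>\<omega>. h (coords i \<omega>)) \<in> borel_measurable M" for i
    by (rule measurable_cong) (rule Y)
  moreover have "Y i -` B \<inter> space M = (\<lambda>\<omega>. h (coords i \<omega>)) -` B \<inter> space M" for i B
    using Y by auto
  ultimately show ?thesis using indep_of_coords[OF h] unfolding indep_vars_def2 by simp
qed

text \<open>Two choices of \<open>g\<close> matter: \<open>1 / \<mu>\<close> gives the exact
  quadratic form of the pseudoinverse, and the constant 1 gives the squared norm of the projected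
  probe.\<close>

definition quad :: "(nat \<Rightarrow> real) \<Rightarrow> nat \<Rightarrow> 'w \<Rightarrow> real" where
  "quad g i \<omega> = \<xi> i \<omega> \<bullet> (conj_diag g *\<^sub>v \<xi> i \<omega>)"

lemma measurable_quad_coords:
  "(\<lambda>f. \<Sum>i<d. \<Sum>j<d. B i j * (f i * f j)) \<in> borel_measurable (PiM {..<d} (\<lambda>_. borel :: real measure))"
  by (intro borel_measurable_sum borel_measurable_times borel_measurable_const measurable_component_singleton) auto

lemma quad_eq_coords:
  assumes "\<omega> \<in> space M"
  shows "quad g i \<omega> = (\<Sum>a<d. \<Sum>b<d. conj_diag g $$ (a, b) * (coords i \<omega> a * coords i \<omega> b))"
  using probe_carrier[OF assms, of i] carrier_matD[OF conj_diag_carrier[of g]]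
  by (auto simp: quad_def scalar_prod_def lessThan_atLeast0 vec_coords_def sum_distrib_left mult_ac intro!: sum.cong)

text \<open>The mean is the trace of \<open>conj_diag g\<close>. By symmetry both crossed pairings
  equal its squared Frobenius norm, whence the factor 2.\<close>

lemma quad_moments:
  "has_bochner_integral M (quad g i) (\<Sum>j<n. g j)"
  "has_bochner_integral M (\<lambda>\<omega>. (quad g i \<omega>)\<^sup>2) ((\<Sum>j<n. g j)\<^sup>2 + 2 * (\<Sum>j<n. (g j)\<^sup>2))"
  "indep_vars (\<lambda>_. borel) (quad g) UNIV"
proof -
  let ?B = "\<lambda>a b. conj_diag g $$ (a, b)"
  let ?q = "\<lambda>f. \<Sum>a<d. \<Sum>b<d. ?B a b * (f a * f b :: real)"
  note dim = carrier_matD[OF conj_diag_carrier[of g]]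
  have tr: "(\<Sum>a<d. ?B a a) = (\<Sum>j<n. g j)"
    using trace_conj_diag[of g] by (simp add: mat_trace_def dim)
  have sym: "?B b a = ?B a b" if "a < d" "b < d" for a b
    using arg_cong[OF conj_diag_transpose[of g], of "\<lambda>X. X $$ (a, b)"] that dim by simp
  have fr: "(\<Sum>a<d. \<Sum>b<d. (?B a b)\<^sup>2) = (\<Sum>j<n. (g j)\<^sup>2)"
    using frobenius_conj_diag[of g] by (simp add: frobenius_norm_def dim sum_nonneg)
  have fr': "(\<Sum>a<d. \<Sum>b<d. ?B a b * ?B b a) = (\<Sum>j<n. (g j)\<^sup>2)"
    unfolding fr[symmetric] by (intro sum.cong refl) (auto simp: sym power2_eq_square)
  have "has_bochner_integral M (\<lambda>\<omega>. ?q (coords i \<omega>)) (\<Sum>j<n. g j)"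
    using std_gaussian_quad_form[of d ?B] measurable_quad_coords tr
    by (intro has_integral_coords) (auto simp: has_bochner_integral_iff)
  thus "has_bochner_integral M (quad g i) (\<Sum>j<n. g j)"
    by (rule has_bochner_integral_cong[THEN iffD1, rotated -1]) (simp_all add: quad_eq_coords)
  have "has_bochner_integral M (\<lambda>\<omega>. (?q (coords i \<omega>))\<^sup>2) ((\<Sum>j<n. g j)\<^sup>2 + 2 * (\<Sum>j<n. (g j)\<^sup>2))"
  proof (rule has_integral_coords)
    show "(\<lambda>f. (?q f)\<^sup>2) \<in> borel_measurable (PiM {..<d} (\<lambda>_. borel))"
      by (rule borel_measurable_power[OF measurable_quad_coords])
    show "has_bochner_integral (std_gaussian d) (\<lambda>f. (?q f)\<^sup>2) ((\<Sum>j<n. g j)\<^sup>2 + 2 * (\<Sum>j<n. (g j)\<^sup>2))"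
      using std_gaussian_quad_form(2,4)[of d ?B] unfolding tr fr fr' by (simp add: has_bochner_integral_iff)
  qed
  thus "has_bochner_integral M (\<lambda>\<omega>. (quad g i \<omega>)\<^sup>2) ((\<Sum>j<n. g j)\<^sup>2 + 2 * (\<Sum>j<n. (g j)\<^sup>2))"
    by (rule has_bochner_integral_cong[THEN iffD1, rotated -1]) (simp_all add: quad_eq_coords)
  show "indep_vars (\<lambda>_. borel) (quad g) UNIV"
    by (rule indep_vars_transfer[OF measurable_quad_coords quad_eq_coords])
qed

lemma quad_nonneg:
  assumes "\<omega> \<in> space M" "\<And>j. j < n \<Longrightarrow> 0 \<le> g j"
  shows "0 \<le> quad g i \<omega>"
  unfolding quad_def conj_diag_quad[OF probe_carrier[OF assms(1)]] by (intro sum_nonneg) (simp add: assms(2))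

lemma quad_strong_law:
  assumes "\<And>j. j < n \<Longrightarrow> 0 \<le> g j"
  shows "AE \<omega> in M. (\<lambda>N. (\<Sum>i<N. quad g i \<omega>) / real N) \<longlonglongrightarrow> (\<Sum>j<n. g j)"
proof (rule strong_law_nonneg[OF quad_moments(3)])
  have int: "integrable M (quad g i)" "integrable M (\<lambda>\<omega>. (quad g i \<omega>)\<^sup>2)" "expectation (quad g i) = (\<Sum>j<n. g j)"
    "expectation (\<lambda>\<omega>. (quad g i \<omega>)\<^sup>2) = (\<Sum>j<n. g j)\<^sup>2 + 2 * (\<Sum>j<n. (g j)\<^sup>2)" for i
    using quad_moments(1,2)[of g i] by (simp_all add: has_bochner_integral_iff)
  show "integrable M (quad g i)" "integrable M (\<lambda>\<omega>. (quad g i \<omega>)\<^sup>2)" "expectation (quad g i) = (\<Sum>j<n. g j)" for i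
    by (rule int)+
  show "variance (quad g i) = 2 * (\<Sum>j<n. (g j)\<^sup>2)" for i
    using variance_eq[OF int(1,2)] by (simp add: int)
qed (rule quad_nonneg[OF _ assms])

abbreviation "S l i \<omega> \<equiv> slq_sample A P l (\<xi> i \<omega>)"
abbreviation "t_exact \<equiv> \<Sum>j<n. 1 / \<mu> j"
abbreviation "F_exact \<equiv> frobenius_norm (pinv (P * A * P))"

text \<open>The accuracy at a fixed \<open>l\<close> is kept as an abstract
  \<open>\<epsilon>\<close>, so that the probabilistic estimates apply to any constant and any
  rate.\<close>

definition error_bound :: "nat \<Rightarrow> real \<Rightarrow> bool" where
  "error_bound l \<epsilon> \<longleftrightarrow> 1 \<le> l \<and> 0 \<le> \<epsilon> \<and> (\<forall>u\<in>(\<lambda>x. P *\<^sub>v x) ` carrier_vec d. vnorm u = 1 \<longrightarrow>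
     \<bar>u \<bullet> (pinv (P * A * P) *\<^sub>v u) - lanczos_quad A P u l\<bar> \<le> \<epsilon>)"

lemma sample_close:
  assumes "error_bound l \<epsilon>" "\<omega> \<in> space M"
  shows "\<bar>quad (\<lambda>j. 1 / \<mu> j) i \<omega> - S l i \<omega>\<bar> \<le> \<epsilon> * quad (\<lambda>_. 1) i \<omega>"
proof -
  have "\<bar>u \<bullet> (pinv (P * A * P) *\<^sub>v u) - lanczos_quad A P u l\<bar> \<le> \<epsilon>"
    if "u \<in> (\<lambda>x. P *\<^sub>v x) ` carrier_vec d" "vnorm u = 1" for u
    using assms that unfolding error_bound_def by blast
  from slq_sample_error[OF probe_carrier[OF assms(2)] this]
  show ?thesis by (simp add: quad_def pinv_PAP flip: P_eq)
qed

lemma sample_eq_coords: "\<omega> \<in> space M \<Longrightarrow> S l i \<omega> = slq_sample A P l (vec d (coords i \<omega>))"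
  by (simp add: vec_of_coords)

lemma indep_samples: "1 \<le> l \<Longrightarrow> indep_vars (\<lambda>_. borel) (S l) UNIV"
  by (rule indep_vars_transfer[OF measurable_slq_sample sample_eq_coords])

lemma sample_integrable:
  assumes eb: "error_bound l \<epsilon>"
  shows "integrable M (S l i)" "integrable M (\<lambda>\<omega>. (S l i \<omega>)\<^sup>2)"
proof -
  have l: "1 \<le> l" and e: "0 \<le> \<epsilon>" using eb by (auto simp: error_bound_def)
  let ?X = "quad (\<lambda>j. 1 / \<mu> j) i" and ?Z = "quad (\<lambda>_. 1) i"
  have [measurable]: "S l i \<in> borel_measurable M" using indep_samples[OF l] by (auto simp: indep_vars_def)
  have int: "integrable M ?X" "integrable M (\<lambda>\<omega>. (?X \<omega>)\<^sup>2)" "integrable M ?Z" "integrable M (\<lambda>\<omega>. (?Z \<omega>)\<^sup>2)"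
    using quad_moments(1,2) by (auto simp: has_bochner_integral_iff)
  have X0: "0 \<le> ?X \<omega>" and Z0: "0 \<le> ?Z \<omega>" if "\<omega> \<in> space M" for \<omega>
    using quad_nonneg[OF that] mu_pos by (auto simp: less_imp_le)
  have b: "\<bar>S l i \<omega>\<bar> \<le> ?X \<omega> + \<epsilon> * ?Z \<omega>" if "\<omega> \<in> space M" for \<omega>
    using sample_close[OF eb that, of i] X0[OF that] by linarith
  show "integrable M (S l i)"
    by (rule Bochner_Integration.integrable_bound[of M "\<lambda>\<omega>. ?X \<omega> + \<epsilon> * ?Z \<omega>"])
      (use int b X0 Z0 e in \<open>auto intro!: AE_I2 simp: abs_of_nonneg\<close>)
  have "(S l i \<omega>)\<^sup>2 \<le> 2 * (?X \<omega>)\<^sup>2 + 2 * \<epsilon>\<^sup>2 * (?Z \<omega>)\<^sup>2" if "\<omega> \<in> space M" for \<omega>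
  proof -
    have "(S l i \<omega>)\<^sup>2 \<le> (?X \<omega> + \<epsilon> * ?Z \<omega>)\<^sup>2" using power_mono[OF b[OF that], of 2] by simp
    also have "\<dots> \<le> 2 * (?X \<omega>)\<^sup>2 + 2 * (\<epsilon> * ?Z \<omega>)\<^sup>2"
      using zero_le_power2[of "?X \<omega> - \<epsilon> * ?Z \<omega>"] unfolding power2_sum power2_diff by linarith
    finally show ?thesis by (simp add: power_mult_distrib)
  qed
  note b2 = this
  show "integrable M (\<lambda>\<omega>. (S l i \<omega>)\<^sup>2)"
  proof (rule Bochner_Integration.integrable_bound)
    show "integrable M (\<lambda>\<omega>. 2 * (?X \<omega>)\<^sup>2 + 2 * \<epsilon>\<^sup>2 * (?Z \<omega>)\<^sup>2)" using int by simp
    show "(\<lambda>\<omega>. (S l i \<omega>)\<^sup>2) \<in> borel_measurable M" by measurable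
    show "AE \<omega> in M. norm ((S l i \<omega>)\<^sup>2) \<le> norm (2 * (?X \<omega>)\<^sup>2 + 2 * \<epsilon>\<^sup>2 * (?Z \<omega>)\<^sup>2)"
    proof (rule AE_I2)
      fix \<omega> assume "\<omega> \<in> space M"
      from order_trans[OF b2[OF this] abs_ge_self]
      show "norm ((S l i \<omega>)\<^sup>2) \<le> norm (2 * (?X \<omega>)\<^sup>2 + 2 * \<epsilon>\<^sup>2 * (?Z \<omega>)\<^sup>2)"
        unfolding real_norm_def abs_power2 .
    qed
  qed
qed

text \<open>Each sample is the same function of the coordinates of its own probe, so means and
  variances are integrals against the one measure \<open>std_gaussian d\<close>.\<close>

lemma sample_identically_distributed:
  assumes eb: "error_bound l \<epsilon>"
  shows "expectation (S l i) = expectation (S l 0)" "variance (S l i) = variance (S l 0)"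
proof -
  have l: "1 \<le> l" using eb by (auto simp: error_bound_def)
  let ?h = "\<lambda>f. slq_sample A P l (vec d f)"
  have E: "expectation (S l i) = (LINT f|std_gaussian d. ?h f)" for i
    unfolding distr_coords[of i, symmetric] integral_distr[OF measurable_coords measurable_slq_sample[OF l]]
    by (intro Bochner_Integration.integral_cong) (simp_all add: sample_eq_coords)
  have V: "variance (S l i) = (LINT f|std_gaussian d. (?h f - expectation (S l i))\<^sup>2)" for i
    unfolding distr_coords[of i, symmetric]
    by (subst integral_distr[OF measurable_coords])
      (auto intro!: borel_measurable_power borel_measurable_diff measurable_slq_sample[OF l]
        Bochner_Integration.integral_cong simp: sample_eq_coords)
  show "expectation (S l i) = expectation (S l 0)" unfolding E ..
  thus "variance (S l i) = variance (S l 0)" unfolding V[of i] V[of 0] by simp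
qed

lemma sample_bias:
  assumes eb: "error_bound l \<epsilon>"
  shows "\<bar>expectation (S l i) - t_exact\<bar> \<le> \<epsilon> * real n"
proof -
  let ?X = "quad (\<lambda>j. 1 / \<mu> j) i" and ?Z = "quad (\<lambda>_. 1) i"
  have int: "integrable M ?X" "expectation ?X = t_exact" "integrable M ?Z" "expectation ?Z = real n"
    using quad_moments(1)[of _ i] by (auto simp: has_bochner_integral_iff)
  note iS = sample_integrable(1)[OF eb, of i]
  have "\<bar>expectation (S l i) - t_exact\<bar> = \<bar>expectation (\<lambda>\<omega>. ?X \<omega> - S l i \<omega>)\<bar>"
    using int iS by (simp add: abs_minus_commute)
  also have "\<dots> \<le> expectation (\<lambda>\<omega>. \<bar>?X \<omega> - S l i \<omega>\<bar>)" by (rule integral_abs_bound)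
  also have "\<dots> \<le> expectation (\<lambda>\<omega>. \<epsilon> * ?Z \<omega>)"
    using int iS sample_close[OF eb] by (intro integral_mono) auto
  also have "\<dots> = \<epsilon> * real n" using int by simp
  finally show ?thesis .
qed

lemma F_exact: "F_exact\<^sup>2 = (\<Sum>j<n. (1 / \<mu> j)\<^sup>2)" "0 < F_exact"
proof -
  show F2: "F_exact\<^sup>2 = (\<Sum>j<n. (1 / \<mu> j)\<^sup>2)" unfolding pinv_PAP by (rule frobenius_conj_diag)
  have "0 < (\<Sum>j<n. (1 / \<mu> j)\<^sup>2)"
    using mu_pos n_pos by (intro sum_pos zero_less_power divide_pos_pos) auto
  hence "F_exact \<noteq> 0" unfolding F2[symmetric] by (metis zero_less_power2)
  moreover have "0 \<le> F_exact" unfolding frobenius_norm_def by (intro real_sqrt_ge_zero sum_nonneg) simp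
  ultimately show "0 < F_exact" by linarith
qed

text \<open>The exact form has standard deviation \<open>sqrt 2 * F_exact\<close>. The distance to
  it is at most \<open>\<epsilon>\<close> times a form with second moment n^2 + 2n <= (n+1)^2, which
  is the origin of the summand n + 1.\<close>

lemma sample_variance:
  assumes eb: "error_bound l \<epsilon>"
  shows "variance (S l i) \<le> (sqrt 2 * F_exact + \<epsilon> * (real n + 1))\<^sup>2"
proof -
  let ?X = "quad (\<lambda>j. 1 / \<mu> j) i" and ?Z = "quad (\<lambda>_. 1) i"
  have e: "0 \<le> \<epsilon>" using eb by (auto simp: error_bound_def)
  have X: "integrable M ?X" "integrable M (\<lambda>\<omega>. (?X \<omega>)\<^sup>2)" "expectation ?X = t_exact"
    "expectation (\<lambda>\<omega>. (?X \<omega>)\<^sup>2) = t_exact\<^sup>2 + 2 * F_exact\<^sup>2"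
    using quad_moments(1,2)[of "\<lambda>j. 1 / \<mu> j" i] by (simp_all only: has_bochner_integral_iff F_exact(1))
  have Z: "integrable M (\<lambda>\<omega>. (?Z \<omega>)\<^sup>2)" "expectation (\<lambda>\<omega>. (?Z \<omega>)\<^sup>2) = (real n)\<^sup>2 + 2 * real n"
    using quad_moments(2)[of "\<lambda>_. 1" i] by (simp_all add: has_bochner_integral_iff)
  have iD: "integrable M (\<lambda>\<omega>. (\<epsilon> * ?Z \<omega>)\<^sup>2)" unfolding power_mult_distrib using Z by simp
  show ?thesis
  proof (rule variance_le_of_close[OF X(1,2) sample_integrable[OF eb] iD])
    have "expectation (\<lambda>\<omega>. (\<epsilon> * ?Z \<omega>)\<^sup>2) = \<epsilon>\<^sup>2 * ((real n)\<^sup>2 + 2 * real n)"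
      unfolding power_mult_distrib using Z by simp
    also have "\<dots> \<le> \<epsilon>\<^sup>2 * (real n + 1)\<^sup>2"
      by (intro mult_left_mono) (simp_all add: power2_eq_square algebra_simps)
    finally show "expectation (\<lambda>\<omega>. (\<epsilon> * ?Z \<omega>)\<^sup>2) \<le> (\<epsilon> * (real n + 1))\<^sup>2" by (simp add: power_mult_distrib)
    show "\<bar>S l i \<omega> - ?X \<omega>\<bar> \<le> \<epsilon> * ?Z \<omega>" if "\<omega> \<in> space M" for \<omega>
      using sample_close[OF eb that] by (simp add: abs_minus_commute)
    show "variance ?X = (sqrt 2 * F_exact)\<^sup>2"
      unfolding variance_eq[OF X(1,2)] by (simp add: X power_mult_distrib)
  qed (use F_exact(2) e in auto)
qed

abbreviation "t_hat \<equiv> pslq_estimator A P \<xi>"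

lemma estimator_moments:
  assumes eb: "error_bound l \<epsilon>" and N: "1 \<le> N"
  shows "integrable M (t_hat N l)" "integrable M (\<lambda>\<omega>. (t_hat N l \<omega>)\<^sup>2)"
    "expectation (t_hat N l) = expectation (S l 0)" "variance (t_hat N l) = variance (S l 0) / real N"
proof -
  have l: "1 \<le> l" using eb by (auto simp: error_bound_def)
  define m where "m = expectation (S l 0)"
  have "has_bochner_integral M (\<lambda>\<omega>. (\<Sum>i<N. S l i \<omega>) / real N) ((\<Sum>i<N. m) / real N)"
    unfolding m_def using sample_integrable(1)[OF eb] sample_identically_distributed(1)[OF eb]
    by (intro has_bochner_integral_divide_zero has_bochner_integral_sum) (simp add: has_bochner_integral_iff)
  moreover have "t_hat N l = (\<lambda>\<omega>. (\<Sum>i<N. S l i \<omega>) / real N)"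
    by (rule ext) (simp add: pslq_estimator_def)
  ultimately have E: "has_bochner_integral M (t_hat N l) m" using N by simp
  thus "integrable M (t_hat N l)" and Em: "expectation (t_hat N l) = expectation (S l 0)"
    by (simp_all add: has_bochner_integral_iff m_def)
  have "has_bochner_integral M (\<lambda>\<omega>. (\<Sum>i<N. S l i \<omega> - m)\<^sup>2 / (real N)\<^sup>2) (real N * variance (S l 0) / (real N)\<^sup>2)"
    unfolding m_def
    by (intro has_bochner_integral_divide_zero centered_sum_second_moment[OF indep_samples[OF l]
        sample_integrable[OF eb] sample_identically_distributed[OF eb]])
  moreover have "(\<Sum>i<N. S l i \<omega> - m)\<^sup>2 / (real N)\<^sup>2 = (t_hat N l \<omega> - m)\<^sup>2" for \<omega>
    unfolding power_divide[symmetric] using N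
    by (simp add: pslq_estimator_def sum_subtractf diff_divide_distrib)
  moreover have "real N * variance (S l 0) / (real N)\<^sup>2 = variance (S l 0) / real N"
    using N by (simp add: power2_eq_square)
  ultimately have V: "has_bochner_integral M (\<lambda>\<omega>. (t_hat N l \<omega> - m)\<^sup>2) (variance (S l 0) / real N)" by simp
  thus "variance (t_hat N l) = variance (S l 0) / real N"
    unfolding Em m_def by (simp only: has_bochner_integral_iff)
  \<comment> \<open>Square integrability is recovered from the centred square, which is already
    known to be integrable.\<close>
  have "(\<lambda>\<omega>. (t_hat N l \<omega>)\<^sup>2) = (\<lambda>\<omega>. (t_hat N l \<omega> - m)\<^sup>2 + 2 * m * t_hat N l \<omega> - m\<^sup>2)"
    by (auto simp: power2_eq_square algebra_simps)
  thus "integrable M (\<lambda>\<omega>. (t_hat N l \<omega>)\<^sup>2)"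
    using V E by (simp add: has_bochner_integral_iff)
qed

lemma estimator_strong_law:
  assumes eb: "error_bound l \<epsilon>"
  shows "AE \<omega> in M. (\<lambda>N. t_hat N l \<omega>) \<longlonglongrightarrow> expectation (S l 0)"
  unfolding pslq_estimator_def
proof (rule strong_law_nonneg)
  show "indep_vars (\<lambda>_. borel) (S l) UNIV" using eb by (intro indep_samples) (simp add: error_bound_def)
  show "0 \<le> S l i \<omega>" if "\<omega> \<in> space M" for i \<omega>
    using eb by (intro slq_sample_nonneg probe_carrier[OF that]) (simp add: error_bound_def)
qed (rule sample_integrable[OF eb] sample_identically_distributed[OF eb])+

text \<open>The samples change with \<open>N\<close>, so the strong law cannot be applied to them.
  It is applied to the exact forms and to the squared norms of the projections, neither of which
  involves \<open>l\<close>; the averages differ by at most \<open>\<epsilon> (l N)\<close> times a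
  convergent average.\<close>

lemma estimator_consistent:
  assumes eb: "\<And>l. 1 \<le> l \<Longrightarrow> error_bound l (\<epsilon> l)" and lim: "\<epsilon> \<longlonglongrightarrow> 0"
    and l: "filterlim l at_top sequentially"
  shows "AE \<omega> in M. (\<lambda>N. t_hat N (l N) \<omega>) \<longlonglongrightarrow> t_exact"
proof -
  let ?X = "quad (\<lambda>j. 1 / \<mu> j)" and ?Z = "quad (\<lambda>_. 1)"
  have "AE \<omega> in M. (\<lambda>N. (\<Sum>i<N. ?X i \<omega>) / real N) \<longlonglongrightarrow> t_exact"
    using mu_pos by (intro quad_strong_law) (simp add: less_imp_le)
  moreover have "AE \<omega> in M. (\<lambda>N. (\<Sum>i<N. ?Z i \<omega>) / real N) \<longlonglongrightarrow> real n"
    using quad_strong_law[of "\<lambda>_. 1"] by simp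
  ultimately show ?thesis using AE_space
  proof eventually_elim
    case (elim \<omega>)
    have "(\<lambda>N. \<epsilon> (l N) * ((\<Sum>i<N. ?Z i \<omega>) / real N)) \<longlonglongrightarrow> 0 * real n"
      by (intro tendsto_mult elim filterlim_compose[OF lim l])
    hence lim0: "(\<lambda>N. \<epsilon> (l N) * ((\<Sum>i<N. ?Z i \<omega>) / real N)) \<longlonglongrightarrow> 0" by simp
    have "\<forall>\<^sub>F N in sequentially. 1 \<le> l N" using l by (simp add: filterlim_at_top)
    hence "\<forall>\<^sub>F N in sequentially. norm (t_hat N (l N) \<omega> - (\<Sum>i<N. ?X i \<omega>) / real N)
        \<le> \<epsilon> (l N) * ((\<Sum>i<N. ?Z i \<omega>) / real N)"
    proof eventually_elim
      case (elim N)
      have "\<bar>(\<Sum>i<N. S (l N) i \<omega>) - (\<Sum>i<N. ?X i \<omega>)\<bar> \<le> (\<Sum>i<N. \<bar>S (l N) i \<omega> - ?X i \<omega>\<bar>)"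
        unfolding sum_subtractf[symmetric] by (rule sum_abs)
      also have "\<dots> \<le> (\<Sum>i<N. \<epsilon> (l N) * ?Z i \<omega>)"
        using sample_close[OF eb[OF elim] \<open>\<omega> \<in> space M\<close>] by (intro sum_mono) (simp add: abs_minus_commute)
      finally have "\<bar>(\<Sum>i<N. S (l N) i \<omega>) - (\<Sum>i<N. ?X i \<omega>)\<bar> / real N \<le> \<epsilon> (l N) * (\<Sum>i<N. ?Z i \<omega>) / real N"
        unfolding sum_distrib_left by (intro divide_right_mono) auto
      thus ?case by (simp add: pslq_estimator_def flip: diff_divide_distrib)
    qed
    from Lim_null_comparison[OF this lim0]
    have "(\<lambda>N. t_hat N (l N) \<omega> - (\<Sum>i<N. ?X i \<omega>) / real N) \<longlonglongrightarrow> 0" .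
    from tendsto_add[OF this elim(1)] show ?case by simp
  qed
qed

end

section \<open>The rate, an explicit constant and the theorem\<close>

lemma lanczos_rate_power: "\<rho> powi (- 2 * int l) = ((1 / \<rho>)\<^sup>2) ^ l" for \<rho> :: real
proof -
  have "\<rho> powi (- 2 * int l) = inverse (\<rho> powi int (2 * l))"
    by (simp flip: power_int_minus)
  also have "\<dots> = ((1 / \<rho>)\<^sup>2) ^ l"
    by (simp only: power_int_of_nat power_mult power_inverse inverse_eq_divide power_one_over)
  finally show ?thesis .
qed

text \<open>The condition number is at least 1. At 1 the denominator is zero and the rate is 0 by
  convention; above 1 the numerator exceeds the positive denominator.\<close>

lemma lanczos_rate_cases:
  assumes "eigs T = rev (sort (map f [0..<n]))" "0 < n" "\<And>i. i < n \<Longrightarrow> 0 < f i"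
  shows "1 < cond_number T \<Longrightarrow> 1 < lanczos_rate T" "lanczos_rate T = 0 \<or> 1 < lanczos_rate T"
    "0 < last (eigs T)"
proof -
  note ext = eigs_extremes[OF assms(1,2)]
  show last: "0 < last (eigs T)" using ext(3) assms(3) by auto
  have "last (eigs T) \<le> hd (eigs T)" using ext(1,2)[OF assms(2)] by linarith
  hence "1 \<le> cond_number T" using last by (simp add: cond_number_def)
  moreover show gt: "1 < lanczos_rate T" if "1 < cond_number T"
  proof -
    have "1 < sqrt (cond_number T)" using that by simp
    thus ?thesis by (simp add: lanczos_rate_def)
  qed
  ultimately show "lanczos_rate T = 0 \<or> 1 < lanczos_rate T"
    by (cases "cond_number T = 1") (simp_all add: lanczos_rate_def)
qed

lemma lanczos_rate_square:
  assumes "lanczos_rate T = 0 \<or> 1 < lanczos_rate T"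
  shows "0 \<le> (1 / lanczos_rate T)\<^sup>2" "(1 / lanczos_rate T)\<^sup>2 < 1"
  using assms by (auto simp: power_one_over power2_eq_square less_1_mult)

text \<open>The constant is computed from the list of eigenvalues alone, so one function of that
  list serves all deflations at once.\<close>

lemma gauss_lanczos_bound_exists:
  assumes defl: "lanczos_deflation d m A b Q Qp"
  shows "0 < 4 / last (eigs (Qp\<^sup>T * A * Qp))"
    "gauss_lanczos_bound A Q Qp (4 / last (eigs (Qp\<^sup>T * A * Qp)))"
proof -
  obtain U W \<mu> where fr: "spectral_frame d (d - m) A (perp_proj Q) W \<mu>"
    and e: "eigs (Qp\<^sup>T * A * Qp) = rev (sort (map \<mu> [0..<d - m]))"
    using deflation_frame[OF defl] by blast
  interpret spectral_frame d "d - m" A "perp_proj Q" W \<mu> by (rule fr)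
  show "0 < 4 / last (eigs (Qp\<^sup>T * A * Qp))"
    using lanczos_rate_cases(3)[OF e n_pos mu_pos] by simp
  show "gauss_lanczos_bound A Q Qp (4 / last (eigs (Qp\<^sup>T * A * Qp)))"
    unfolding gauss_lanczos_bound_def Let_def
  proof (intro allI impI ballI)
    fix l :: nat and u
    assume l: "1 \<le> l" and u: "u \<in> (\<lambda>x. perp_proj Q *\<^sub>v x) ` carrier_vec (dim_row A)" and unit: "vnorm u = 1"
    have uc: "u \<in> carrier_vec d" "perp_proj Q *\<^sub>v u = u"
      using u A P_mult_vec by auto
    have "u \<bullet> u = 1" using vnorm_power2[of u] unit by simp
    interpret lanczos_run d "d - m" A "perp_proj Q" W \<mu> u l
      by unfold_locales (use uc \<open>u \<bullet> u = 1\<close> l in auto)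
    show "\<bar>u \<bullet> (pinv (perp_proj Q * A * perp_proj Q) *\<^sub>v u) - lanczos_quad A (perp_proj Q) u l\<bar>
      \<le> 4 / last (eigs (Qp\<^sup>T * A * Qp)) * lanczos_rate (Qp\<^sup>T * A * Qp) powi (- 2 * int l)"
      by (rule quad_error_rate[OF e])
  qed
qed

lemma trace_minv:
  assumes "spectral_frame n n T (1\<^sub>m n) U \<mu>"
  shows "mat_trace (minv T) = (\<Sum>i<n. 1 / \<mu> i)"
proof -
  interpret spectral_frame n n T "1\<^sub>m n" U \<mu> by (rule assms)
  have T: "T = conj_diag \<mu>" using PAP_eq A by simp
  have "T * conj_diag (\<lambda>i. 1 / \<mu> i) = conj_diag (\<lambda>_. 1)"
    unfolding T conj_diag_mult using mu_pos by (intro conj_diag_cong) (metis less_irrefl nonzero_mult_div_cancel_left times_divide_eq_right mult.right_neutral)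
  hence "T * conj_diag (\<lambda>i. 1 / \<mu> i) = 1\<^sub>m n" by (simp flip: P_eq)
  hence "minv T = conj_diag (\<lambda>i. 1 / \<mu> i)" by (intro minv_eqI[OF A]) simp_all
  thus ?thesis by (simp add: trace_conj_diag)
qed

lemma (in probe_model) error_bound_of_gauss:
  assumes P: "P = perp_proj Q" and gb: "gauss_lanczos_bound A Q Qp C" and C: "0 < C" and l: "1 \<le> l"
  shows "error_bound l (C * ((1 / lanczos_rate (Qp\<^sup>T * A * Qp))\<^sup>2) ^ l)"
  unfolding error_bound_def
proof (intro conjI)
  show "0 \<le> C * ((1 / lanczos_rate (Qp\<^sup>T * A * Qp))\<^sup>2) ^ l" using C by simp
  show "\<forall>u\<in>(\<lambda>x. P *\<^sub>v x) ` carrier_vec d. vnorm u = 1 \<longrightarrow>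
     \<bar>u \<bullet> (pinv (P * A * P) *\<^sub>v u) - lanczos_quad A P u l\<bar> \<le> C * ((1 / lanczos_rate (Qp\<^sup>T * A * Qp))\<^sup>2) ^ l"
    using gb A l unfolding gauss_lanczos_bound_def Let_def lanczos_rate_power P by auto
qed (rule l)

theorem theorem20:
  fixes d m :: nat and A Q Qp P T Ap :: "real mat" and b :: "real vec"
    and M :: "'w measure" and \<xi> :: "nat \<Rightarrow> 'w \<Rightarrow> real vec"
    and \<rho> t F :: real and S :: "nat \<Rightarrow> nat \<Rightarrow> 'w \<Rightarrow> real"
    and t_hat :: "nat \<Rightarrow> nat \<Rightarrow> 'w \<Rightarrow> real"
  assumes deflation: "lanczos_deflation d m A b Q Qp"
    and P: "P = perp_proj Q"
    and T: "T = Qp\<^sup>T * A * Qp"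
    and Ap: "Ap = P * A * P"
    and rho: "\<rho> = lanczos_rate T"
    and t: "t = mat_trace (pinv Ap)"
    and F: "F = frobenius_norm (pinv Ap)"
    and M: "prob_space M"
    and probes: "iid_std_gaussian M d \<xi>"
    and S: "S = (\<lambda>l i \<omega>. slq_sample A P l (\<xi> i \<omega>))"
    and t_hat: "t_hat = pslq_estimator A P \<xi>"
  shows
    "t = mat_trace (minv T) \<and>
     (1 < cond_number T \<longrightarrow> 1 < \<rho>) \<and>
     (\<exists>c :: real list \<Rightarrow> real. \<forall>d m A b Q Qp. lanczos_deflation d m A b Q Qp \<longrightarrow>
        0 < c (eigs (Qp\<^sup>T * A * Qp)) \<and>
        gauss_lanczos_bound A Q Qp (c (eigs (Qp\<^sup>T * A * Qp)))) \<and>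
     (\<forall>N\<ge>1. \<forall>l\<ge>1. integrable M (t_hat N l) \<and> integrable M (\<lambda>\<omega>. (t_hat N l \<omega>)\<^sup>2)) \<and>
     (\<forall>C>0. gauss_lanczos_bound A Q Qp C \<longrightarrow>
        (\<forall>N\<ge>1. \<forall>l\<ge>1.
           \<bar>prob_space.expectation M (t_hat N l) - t\<bar>
             \<le> C * \<rho> powi (- 2 * int l) * mat_trace P \<and>
           C * \<rho> powi (- 2 * int l) * mat_trace P
             = C * \<rho> powi (- 2 * int l) * (real d - real m)) \<and>
        (\<forall>N\<ge>1. \<forall>l\<ge>1.
           prob_space.variance M (t_hat N l)
             \<le> 1 / real N * (sqrt 2 * F + C * \<rho> powi (- 2 * int l) * (real d - real m + 1))\<^sup>2 \<and>
           1 / real N * (sqrt 2 * F + C * \<rho> powi (- 2 * int l) * (real d - real m + 1))\<^sup>2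
             \<le> 2 * (real d - real m) * last (eigs A) powi (- 2) / real N *
               (1 + C * \<rho> powi (- 2 * int l) * (real d - real m + 1) / (sqrt 2 * F))\<^sup>2) \<and>
        (\<lambda>l. C * \<rho> powi (- 2 * int l) * (real d - real m + 1) / (sqrt 2 * F))
          \<longlonglongrightarrow> 0 \<and>
        (\<forall>N\<ge>1.
           (\<lambda>l. 1 / real N *
              (sqrt 2 * F + C * \<rho> powi (- 2 * int l) * (real d - real m + 1))\<^sup>2)
             \<longlonglongrightarrow> 2 * F\<^sup>2 / real N) \<and>
        (\<forall>l\<ge>1. \<bar>prob_space.expectation M (S l 0) - t\<bar>
           \<le> C * \<rho> powi (- 2 * int l) * (real d - real m))) \<and>
     (\<exists>K q. 0 \<le> q \<and> q < 1 \<and>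
        (\<forall>N\<ge>1. \<forall>l\<ge>1. \<bar>prob_space.expectation M (t_hat N l) - t\<bar> \<le> K * q ^ l)) \<and>
     (\<forall>l\<ge>1. (\<lambda>N. prob_space.variance M (t_hat N l)) \<in> O(\<lambda>N. 1 / real N)) \<and>
     (\<forall>l\<ge>1. AE \<omega> in M.
        (\<lambda>N. t_hat N l \<omega>) \<longlonglongrightarrow> prob_space.expectation M (S l 0)) \<and>
     (\<forall>l :: nat \<Rightarrow> nat. filterlim l at_top sequentially \<longrightarrow>
        (AE \<omega> in M. (\<lambda>N. t_hat N (l N) \<omega>) \<longlonglongrightarrow> t))"
proof -
  define n where "n = d - m"
  note P_proj = P
  from deflation have spd: "sym_pos_def d A" and m: "m < d" by (auto simp: lanczos_deflation_def)
  obtain U W \<mu> where fr: "spectral_frame d n A P W \<mu>" and frT: "spectral_frame n n T (1\<^sub>m n) U \<mu>"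
    and e: "eigs T = rev (sort (map \<mu> [0..<n]))"
    using deflation_frame[OF deflation] unfolding n_def P T by blast
  interpret prob_space M by (rule M)
  interpret spectral_frame d n A P W \<mu> by (rule fr)
  interpret probe_model d n A P W \<mu> M \<xi> by unfold_locales (rule probes)
  \<comment> \<open>All bounds become statements about the geometric sequence \<open>q ^ l\<close>.
    If \<open>\<rho> = 0\<close>, then \<open>1 / 0 = 0\<close> gives \<open>q = 0\<close>, in
    agreement with the value of \<open>powi\<close>.\<close>
  define q where "q = (1 / \<rho>)\<^sup>2"
  note rate = lanczos_rate_cases[OF e n_pos mu_pos]
  have q: "0 \<le> q" "q < 1" using lanczos_rate_square[OF rate(2)] unfolding q_def rho by auto
  have pw: "\<rho> powi (- 2 * int l) = q ^ l" for l unfolding q_def by (rule lanczos_rate_power)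
  have nd: "real d - real m = real n" using m by (simp add: n_def)
  have tr_P: "mat_trace P = real n" unfolding P_eq trace_conj_diag by simp
  have t_eq: "t = t_exact" unfolding t Ap pinv_PAP by (rule trace_conj_diag)
  have F_eq: "F = F_exact" by (simp only: F Ap)
  note F_pos = F_exact(2)[folded F_eq]
  have eb: "error_bound l (C * q ^ l)" if "gauss_lanczos_bound A Q Qp C" "0 < C" "1 \<le> l" for C l
    using error_bound_of_gauss[OF P_proj that] unfolding q_def rho T .
  \<comment> \<open>This explicit constant supports every conclusion in which \<open>C\<close> does
    not appear.\<close>
  define C0 where "C0 = 4 / last (eigs T)"
  have C0: "0 < C0" "gauss_lanczos_bound A Q Qp C0"
    using gauss_lanczos_bound_exists[OF deflation] unfolding C0_def T by auto
  note eb0 = eb[OF C0(2,1)]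
  have lim: "(\<lambda>l. C * q ^ l) \<longlonglongrightarrow> 0" for C
    using tendsto_mult_right_zero[OF LIMSEQ_realpow_zero[OF q], of C] by simp
  define \<nu> where "\<nu> = last (eigs A)"
  have lam: "0 < \<nu>" "\<And>i. i < n \<Longrightarrow> \<nu> \<le> \<mu> i"
    using sym_pos_def_rayleigh[OF spd] m mu_lower unfolding \<nu>_def by auto
  \<comment> \<open>Every eigenvalue of the compression is at least the least eigenvalue of
    \<open>A\<close>, by the Rayleigh bound, so each of the \<open>n\<close> summands is at most its
    inverse square.\<close>
  have F2: "F\<^sup>2 \<le> real n * \<nu> powi (- 2)"
  proof -
    have "F\<^sup>2 = (\<Sum>j<n. (1 / \<mu> j)\<^sup>2)" unfolding F_eq by (rule F_exact(1))
    also have "\<dots> \<le> (\<Sum>j<n. (1 / \<nu>)\<^sup>2)"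
      using lam mu_pos by (intro sum_mono power_mono divide_left_mono mult_pos_pos) (auto simp: less_imp_le)
    also have "\<dots> = real n * \<nu> powi (- 2)"
      by (simp add: power_int_def inverse_eq_divide power_divide)
    finally show ?thesis .
  qed
  have S_eq: "S l 0 = (\<lambda>\<omega>. slq_sample A P l (\<xi> 0 \<omega>))" for l by (simp add: S)
  have bias: "\<bar>expectation (t_hat N l) - t\<bar> \<le> C * q ^ l * real n"
    if "gauss_lanczos_bound A Q Qp C" "0 < C" "1 \<le> l" "1 \<le> N" for C l N
    using sample_bias[OF eb[OF that(1-3)], of 0] estimator_moments(3)[OF eb[OF that(1-3)] that(4)]
    unfolding t_hat t_eq by simp
  have 1: "t = mat_trace (minv T)" unfolding t_eq by (rule trace_minv[OF frT, symmetric])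
  have 2: "\<exists>c :: real list \<Rightarrow> real. \<forall>d m A b Q Qp. lanczos_deflation d m A b Q Qp \<longrightarrow>
        0 < c (eigs (Qp\<^sup>T * A * Qp)) \<and> gauss_lanczos_bound A Q Qp (c (eigs (Qp\<^sup>T * A * Qp)))"
    using gauss_lanczos_bound_exists by (intro exI[of _ "\<lambda>xs. 4 / last xs"]) blast
  have 3: "integrable M (t_hat N l)" "integrable M (\<lambda>\<omega>. (t_hat N l \<omega>)\<^sup>2)" if "1 \<le> N" "1 \<le> l" for N l
    using estimator_moments(1,2)[OF eb0 that(1)] that(2) unfolding t_hat by blast+
  have 4: "variance (t_hat N l) \<le> 1 / real N * (sqrt 2 * F + C * q ^ l * (real n + 1))\<^sup>2"
    if "gauss_lanczos_bound A Q Qp C" "0 < C" "1 \<le> l" "1 \<le> N" for C l N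
    using divide_right_mono[OF sample_variance[OF eb[OF that(1-3)], of 0], of "real N"]
    unfolding t_hat estimator_moments(4)[OF eb[OF that(1-3)] that(4)] F_eq by simp
  \<comment> \<open>Factoring \<open>sqrt 2 * F\<close> out of the sum isolates the relative error;
    only the factor \<open>F\<^sup>2\<close> in front is then estimated.\<close>
  have 5: "1 / real N * (sqrt 2 * F + x)\<^sup>2 \<le> 2 * real n * \<nu> powi (- 2) / real N * (1 + x / (sqrt 2 * F))\<^sup>2"
    for N x
  proof -
    have "sqrt 2 * F + x = sqrt 2 * F * (1 + x / (sqrt 2 * F))" using F_pos by (simp add: distrib_left)
    hence "(sqrt 2 * F + x)\<^sup>2 = 2 * F\<^sup>2 * (1 + x / (sqrt 2 * F))\<^sup>2" by (simp add: power_mult_distrib)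
    also have "\<dots> \<le> 2 * (real n * \<nu> powi (- 2)) * (1 + x / (sqrt 2 * F))\<^sup>2"
      using F2 by (intro mult_right_mono mult_left_mono) auto
    finally have "(sqrt 2 * F + x)\<^sup>2 / real N \<le> 2 * (real n * \<nu> powi (- 2)) * (1 + x / (sqrt 2 * F))\<^sup>2 / real N"
      by (rule divide_right_mono) simp
    thus ?thesis by (simp add: mult_ac)
  qed
  have 6: "(\<lambda>l. C * q ^ l * (real n + 1) / (sqrt 2 * F)) \<longlonglongrightarrow> 0" for C
    using tendsto_divide_zero[OF tendsto_mult_left_zero[OF lim]] by blast
  have 7: "(\<lambda>l. 1 / real N * (sqrt 2 * F + C * q ^ l * (real n + 1))\<^sup>2) \<longlonglongrightarrow> 2 * F\<^sup>2 / real N" for C N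
  proof -
    have "(\<lambda>l. 1 / real N * (sqrt 2 * F + C * q ^ l * (real n + 1))\<^sup>2) \<longlonglongrightarrow>
        1 / real N * (sqrt 2 * F + 0)\<^sup>2"
      by (intro tendsto_intros tendsto_mult_left_zero lim)
    thus ?thesis by (simp add: power_mult_distrib)
  qed
  have 8: "\<bar>expectation (S l 0) - t\<bar> \<le> C * q ^ l * real n"
    if "gauss_lanczos_bound A Q Qp C" "0 < C" "1 \<le> l" for C l
    unfolding S_eq t_eq by (rule sample_bias[OF eb[OF that]])
  have 9: "\<exists>K q. 0 \<le> q \<and> q < 1 \<and> (\<forall>N\<ge>1. \<forall>l\<ge>1. \<bar>expectation (t_hat N l) - t\<bar> \<le> K * q ^ l)"
    using bias[OF C0(2,1)] q by (intro exI[of _ "C0 * real n"] exI[of _ q]) (simp add: mult_ac)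
  have 10: "(\<lambda>N. variance (t_hat N l)) \<in> O(\<lambda>N. 1 / real N)" if l: "1 \<le> l" for l
  proof (rule bigoI)
    show "\<forall>\<^sub>F N in sequentially. norm (variance (t_hat N l)) \<le> \<bar>variance (S l 0)\<bar> * norm (1 / real N)"
      using eventually_ge_at_top[of 1]
    proof eventually_elim
      case (elim N)
      show ?case
        unfolding t_hat estimator_moments(4)[OF eb0[OF l] elim] S_eq by (simp add: abs_divide)
    qed
  qed
  have 11: "AE \<omega> in M. (\<lambda>N. t_hat N l \<omega>) \<longlonglongrightarrow> expectation (S l 0)" if "1 \<le> l" for l
    unfolding t_hat S_eq by (rule estimator_strong_law[OF eb0[OF that]])
  have 12: "AE \<omega> in M. (\<lambda>N. t_hat N (l N) \<omega>) \<longlonglongrightarrow> t" if "filterlim l at_top sequentially" for l :: "nat \<Rightarrow> nat"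
    unfolding t_hat t_eq by (rule estimator_consistent[OF eb0 lim that])
  show ?thesis
    unfolding pw nd tr_P \<nu>_def[symmetric]
    by (intro conjI allI impI)
      (rule 1 rate(1)[folded rho] 2 3 bias refl 4 5 6 7 8 9 10 11 12; assumption)+
qed

end
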